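(* The first Grigorchuk group $\mathfrak{G}$ is $\mathbb{Z}/2$-cellular, and the $3$-torsion Gupta-Sidki group $\bar{\bar{\Gamma}}$ is $\mathbb{Z}/3$-cellular.
   Context: Given a group $A$, the class of $A$-cellular groups is the smallest class of groups containing $A$ and closed under colimits. The first Grigorchuk group $\mathfrak{G}$ is the group of automorphisms of the rooted binary tree generated by $a,b,c,d$, where $a$ swaps the two subtrees hanging from the root, and $b,c,d$ fix the first level and are defined recursively by their actions on the two subtrees: $b=(a,c)$, $c=(a,d)$, $d=(1,b)$. The Gupta-Sidki $3$-group $\bar{\bar{\Gamma}}$ is the group of automorphisms of the rooted ternary tree generated by $a$ and $t$, where $a$ cyclically permutes the three subtrees hanging from the root, and $t$ fixes the first level and is defined recursively by $t=(a,a^{-1},t)$. *)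

theory Defs
  imports "HOL-Algebra.Elementary_Groups"
begin

section \<open>Diagrams of groups and their colimits\<close>

record ('o, 'm) cat =
  Obj :: "'o set"
  Arr :: "'m set"
  Dom :: "'m \<Rightarrow> 'o"
  Cod :: "'m \<Rightarrow> 'o"
  Ident :: "'o \<Rightarrow> 'm"
  Comp :: "'m \<Rightarrow> 'm \<Rightarrow> 'm"  \<comment> \<open>\<open>Comp C g f\<close> is \<open>g\<close> after \<open>f\<close>\<close>

definition small_category :: "('o, 'm) cat \<Rightarrow> bool" where
  "small_category C \<longleftrightarrow>
     (\<forall>f\<in>Arr C. Dom C f \<in> Obj C \<and> Cod C f \<in> Obj C) \<and>
     (\<forall>i\<in>Obj C. Ident C i \<in> Arr C \<and> Dom C (Ident C i) = i \<and> Cod C (Ident C i) = i) \<and>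
     (\<forall>f\<in>Arr C. \<forall>g\<in>Arr C. Cod C f = Dom C g \<longrightarrow>
        Comp C g f \<in> Arr C \<and> Dom C (Comp C g f) = Dom C f \<and> Cod C (Comp C g f) = Cod C g) \<and>
     (\<forall>f\<in>Arr C. Comp C f (Ident C (Dom C f)) = f \<and> Comp C (Ident C (Cod C f)) f = f) \<and>
     (\<forall>f\<in>Arr C. \<forall>g\<in>Arr C. \<forall>h\<in>Arr C. Cod C f = Dom C g \<and> Cod C g = Dom C h \<longrightarrow>
        Comp C h (Comp C g f) = Comp C (Comp C h g) f)"

text \<open>A functor from \<open>C\<close> to groups. Homomorphisms are HOL functions, hence they are only ever
  compared on carriers.\<close>

definition group_diagram ::
  "('o, 'm) cat \<Rightarrow> ('o \<Rightarrow> 'g monoid) \<Rightarrow> ('m \<Rightarrow> 'g \<Rightarrow> 'g) \<Rightarrow> bool" where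
  "group_diagram C D T \<longleftrightarrow>
     small_category C \<and>
     (\<forall>i\<in>Obj C. group (D i)) \<and>
     (\<forall>f\<in>Arr C. T f \<in> hom (D (Dom C f)) (D (Cod C f))) \<and>
     (\<forall>i\<in>Obj C. \<forall>x\<in>carrier (D i). T (Ident C i) x = x) \<and>
     (\<forall>f\<in>Arr C. \<forall>g\<in>Arr C. Cod C f = Dom C g \<longrightarrow>
        (\<forall>x\<in>carrier (D (Dom C f)). T (Comp C g f) x = T g (T f x)))"

definition group_cocone ::
  "('o, 'm) cat \<Rightarrow> ('o \<Rightarrow> 'g monoid) \<Rightarrow> ('m \<Rightarrow> 'g \<Rightarrow> 'g) \<Rightarrow>
    'h monoid \<Rightarrow> ('o \<Rightarrow> 'g \<Rightarrow> 'h) \<Rightarrow> bool" where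
  "group_cocone C D T G \<kappa> \<longleftrightarrow>
     group G \<and>
     (\<forall>i\<in>Obj C. \<kappa> i \<in> hom (D i) G) \<and>
     (\<forall>f\<in>Arr C. \<forall>x\<in>carrier (D (Dom C f)). \<kappa> (Cod C f) (T f x) = \<kappa> (Dom C f) x)"

definition group_colimit ::
  "('o, 'm) cat \<Rightarrow> ('o \<Rightarrow> 'g monoid) \<Rightarrow> ('m \<Rightarrow> 'g \<Rightarrow> 'g) \<Rightarrow>
    'g monoid \<Rightarrow> ('o \<Rightarrow> 'g \<Rightarrow> 'g) \<Rightarrow> bool" where
  "group_colimit C D T G \<iota> \<longleftrightarrow>
     group_cocone C D T G \<iota> \<and>
     (\<forall>(H :: 'g monoid) \<kappa>. group_cocone C D T H \<kappa> \<longrightarrow>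
        (\<exists>h\<in>hom G H. \<forall>i\<in>Obj C. \<forall>x\<in>carrier (D i). h (\<iota> i x) = \<kappa> i x) \<and>
        (\<forall>h\<in>hom G H. \<forall>h'\<in>hom G H.
           (\<forall>i\<in>Obj C. \<forall>x\<in>carrier (D i). h (\<iota> i x) = \<kappa> i x \<and> h' (\<iota> i x) = \<kappa> i x) \<longrightarrow>
           (\<forall>y\<in>carrier G. h y = h' y)))"


section \<open>Cellular groups\<close>

text \<open>HOL cannot quantify over all types inside a definition, so an infinite type \<open>'u\<close> plays the
  role of the universe: the groups are those with carrier in \<open>'u\<close>, and the diagrams are those
  indexed by categories with objects and arrows in \<open>'u\<close>. The colimit of such a diagram, being a
  quotient of a set of words over \<open>'u \<times> 'u\<close>, has an isomorphic copy with carrier in \<open>'u\<close>. Hence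
  colimits always exist in this universe, and testing the universal property in
  \<^const>\<open>group_colimit\<close> against groups with carrier in \<open>'u\<close> is the same as testing it against all
  groups. The class is closed under isomorphism, since an isomorphic copy of a group is a colimit
  of the one-object diagram on it.\<close>

inductive cellular_in :: "'a monoid \<Rightarrow> 'u monoid \<Rightarrow> bool" for A :: "'a monoid" where
  base: "group G \<Longrightarrow> A \<cong> G \<Longrightarrow> cellular_in A G"
| colimit: "group_diagram (C :: ('u, 'u) cat) D T \<Longrightarrow> (\<forall>i\<in>Obj C. cellular_in A (D i)) \<Longrightarrow>
    group_colimit C D T G \<iota> \<Longrightarrow> cellular_in A G"

definition cellular :: "'u itself \<Rightarrow> 'a monoid \<Rightarrow> 'b monoid \<Rightarrow> bool" where
  "cellular _ A G \<longleftrightarrow> (\<exists>G' :: 'u monoid. G \<cong> G' \<and> cellular_in A G')"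


section \<open>Automorphism groups of regular rooted trees\<close>

text \<open>The vertices of the rooted tree over an alphabet \<open>'x\<close> are the finite words, the root is the
  empty word, and the children of \<open>u\<close> are the words \<open>u @ [x]\<close>. The subtree hanging from the root
  at \<open>x\<close> consists of the words \<open>x # w\<close> and is identified with the whole tree by deleting \<open>x\<close>.\<close>

definition tree_adj :: "'x list \<Rightarrow> 'x list \<Rightarrow> bool" where
  "tree_adj u v \<longleftrightarrow> (\<exists>x. v = u @ [x] \<or> u = v @ [x])"

definition tree_aut :: "('x list \<Rightarrow> 'x list) monoid" where
  "tree_aut = \<lparr>carrier = {f. bij f \<and> f [] = [] \<and> (\<forall>u v. tree_adj (f u) (f v) \<longleftrightarrow> tree_adj u v)},
     monoid.mult = (\<circ>), one = id\<rparr>"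

subsection \<open>The first Grigorchuk group\<close>

fun grig_a :: "bool list \<Rightarrow> bool list" where
  "grig_a [] = []"
| "grig_a (x # w) = (\<not> x) # w"

fun grig_b grig_c grig_d :: "bool list \<Rightarrow> bool list" where
  "grig_b [] = []"
| "grig_b (False # w) = False # grig_a w"
| "grig_b (True # w) = True # grig_c w"
| "grig_c [] = []"
| "grig_c (False # w) = False # grig_a w"
| "grig_c (True # w) = True # grig_d w"
| "grig_d [] = []"
| "grig_d (False # w) = False # w"
| "grig_d (True # w) = True # grig_b w"

definition grigorchuk_group :: "(bool list \<Rightarrow> bool list) monoid" where
  "grigorchuk_group = subgroup_generated tree_aut {grig_a, grig_b, grig_c, grig_d}"

subsection \<open>The Gupta--Sidki 3-group\<close>

datatype letter3 = L0 | L1 | L2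

fun rot :: "letter3 \<Rightarrow> letter3" where
  "rot L0 = L1"
| "rot L1 = L2"
| "rot L2 = L0"

fun gs_a :: "letter3 list \<Rightarrow> letter3 list" where
  "gs_a [] = []"
| "gs_a (x # w) = rot x # w"

fun gs_t :: "letter3 list \<Rightarrow> letter3 list" where
  "gs_t [] = []"
| "gs_t (L0 # w) = L0 # gs_a w"
| "gs_t (L1 # w) = L1 # inv_into UNIV gs_a w"
| "gs_t (L2 # w) = L2 # gs_t w"

definition gupta_sidki_group :: "(letter3 list \<Rightarrow> letter3 list) monoid" where
  "gupta_sidki_group = subgroup_generated tree_aut {gs_a, gs_t}"

subsection \<open>The generators are tree automorphisms\<close>

text \<open>\<^const>\<open>subgroup_generated\<close> discards generators outside the carrier; the following facts show
  that none is discarded.\<close>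

lemma group_tree_aut: "group (tree_aut :: ('x list \<Rightarrow> 'x list) monoid)"
proof (rule groupI)
  fix f :: "'x list \<Rightarrow> 'x list"
  assume f: "f \<in> carrier tree_aut"
  then have b: "bij f" and r: "f [] = []" and adj: "\<And>u v. tree_adj (f u) (f v) \<longleftrightarrow> tree_adj u v"
    by (auto simp: tree_aut_def)
  have fi: "f (inv_into UNIV f x) = x" for x
    using b by (simp add: bij_is_surj surj_f_inv_f)
  have "inv_into UNIV f [] = []"
    by (metis b bij_is_inj inv_f_f r)
  moreover have "tree_adj (inv_into UNIV f u) (inv_into UNIV f v) \<longleftrightarrow> tree_adj u v" for u v
    using adj[of "inv_into UNIV f u" "inv_into UNIV f v"] by (simp add: fi)
  ultimately have "inv_into UNIV f \<in> carrier tree_aut"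
    using b by (simp add: tree_aut_def bij_imp_bij_inv)
  moreover have "inv_into UNIV f \<circ> f = id"
    using b by (simp add: bij_is_inj)
  ultimately show "\<exists>g\<in>carrier tree_aut. g \<otimes>\<^bsub>tree_aut\<^esub> f = \<one>\<^bsub>tree_aut\<^esub>"
    by (auto simp: tree_aut_def)
qed (auto simp: tree_aut_def bij_comp comp_assoc)

lemma tree_autI:
  assumes inv: "\<And>w. g (f w) = w" "\<And>w. f (g w) = w"
    and len: "\<And>w. length (f w) = length w" "\<And>w. length (g w) = length w"
    and pre: "\<And>w x. \<exists>y. f (w @ [x]) = f w @ [y]" "\<And>w x. \<exists>y. g (w @ [x]) = g w @ [y]"
  shows "f \<in> carrier tree_aut"
proof -
  have adj: "tree_adj (h u) (h v)"
    if h: "\<And>w x. \<exists>y. h (w @ [x]) = h w @ [y]" and uv: "tree_adj u v"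
    for h :: "'a list \<Rightarrow> 'a list" and u v
  proof -
    obtain x where "v = u @ [x] \<or> u = v @ [x]"
      using uv by (auto simp: tree_adj_def)
    then show ?thesis
      using h[of u x] h[of v x] by (auto simp: tree_adj_def)
  qed
  have "bij f"
    by (rule o_bij[of g]) (simp_all add: fun_eq_iff inv)
  moreover have "f [] = []"
    using len(1)[of "[]"] by simp
  moreover have "tree_adj (f u) (f v) \<longleftrightarrow> tree_adj u v" for u v
  proof
    assume "tree_adj (f u) (f v)"
    from adj[of g, OF pre(2) this] show "tree_adj u v"
      by (simp add: inv)
  qed (rule adj[OF pre(1)])
  ultimately show ?thesis
    by (simp add: tree_aut_def)
qed

lemma grig_a_invol: "grig_a (grig_a w) = w"
  by (cases w) auto

lemma grig_invol: "grig_b (grig_b w) = w" "grig_c (grig_c w) = w" "grig_d (grig_d w) = w"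
  by (induction w and w and w rule: grig_b_grig_c_grig_d.induct) (auto simp: grig_a_invol)

lemma length_grig_a: "length (grig_a w) = length w"
  by (cases w) auto

lemma length_grig:
  "length (grig_b w) = length w" "length (grig_c w) = length w" "length (grig_d w) = length w"
  by (induction w and w and w rule: grig_b_grig_c_grig_d.induct) (auto simp: length_grig_a)

lemma grig_a_append: "\<exists>y. grig_a (w @ [x]) = grig_a w @ [y]"
  by (cases w) auto

lemma grig_append:
  "\<exists>y. grig_b (w @ [x]) = grig_b w @ [y]" "\<exists>y. grig_c (w @ [x]) = grig_c w @ [y]"
  "\<exists>y. grig_d (w @ [x]) = grig_d w @ [y]"
  by (induction w and w and w rule: grig_b_grig_c_grig_d.induct)
    (cases x; auto simp: grig_a_append)+

lemma grig_in_tree_aut: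
  "{grig_a, grig_b, grig_c, grig_d} \<subseteq> carrier tree_aut"
proof -
  have "grig_a \<in> carrier tree_aut"
    by (rule tree_autI[of grig_a grig_a]) (rule grig_a_invol length_grig_a grig_a_append)+
  moreover have "grig_b \<in> carrier tree_aut"
    by (rule tree_autI[of grig_b grig_b]) (rule grig_invol length_grig grig_append)+
  moreover have "grig_c \<in> carrier tree_aut"
    by (rule tree_autI[of grig_c grig_c]) (rule grig_invol length_grig grig_append)+
  moreover have "grig_d \<in> carrier tree_aut"
    by (rule tree_autI[of grig_d grig_d]) (rule grig_invol length_grig grig_append)+
  ultimately show ?thesis by simp
qed

lemma rot3: "rot (rot (rot x)) = x"
  by (cases x) auto

lemma gs_a3: "gs_a (gs_a (gs_a w)) = w"
  by (cases w) (auto simp: rot3)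

lemma inv_gs_a: "inv_into UNIV gs_a w = gs_a (gs_a w)"
  by (metis gs_a3 injI inv_f_f)

lemma length_gs_a: "length (gs_a w) = length w"
  by (cases w) auto

lemma gs_a_append: "\<exists>y. gs_a (w @ [x]) = gs_a w @ [y]"
  by (cases w) auto

lemma gs_aa_append: "\<exists>y. gs_a (gs_a (w @ [x])) = gs_a (gs_a w) @ [y]"
  by (metis gs_a_append)

lemma gs_t3: "gs_t (gs_t (gs_t w)) = w"
  by (induction w rule: gs_t.induct) (auto simp: inv_gs_a gs_a3)

lemma length_gs_t: "length (gs_t w) = length w"
  by (induction w rule: gs_t.induct) (auto simp: inv_gs_a length_gs_a)

lemma gs_t_append: "\<exists>y. gs_t (w @ [x]) = gs_t w @ [y]"
proof (induction w rule: gs_t.induct)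
  case 1
  show ?case by (cases x) (auto simp: inv_gs_a)
qed (auto simp: inv_gs_a gs_a_append gs_aa_append)

lemma gs_in_tree_aut: "{gs_a, gs_t} \<subseteq> carrier tree_aut"
proof -
  have "gs_a \<in> carrier tree_aut"
    by (rule tree_autI[of "gs_a \<circ> gs_a" gs_a])
      (auto simp: gs_a3 length_gs_a gs_a_append gs_aa_append)
  moreover have "\<exists>y. gs_t (gs_t (w @ [x])) = gs_t (gs_t w) @ [y]" for w x
    by (metis gs_t_append)
  then have "gs_t \<in> carrier tree_aut"
    by (intro tree_autI[of "gs_t \<circ> gs_t" gs_t]) (auto simp: gs_t3 length_gs_t gs_t_append)
  ultimately show ?thesis by simp
qed

end

theory Submission
  imports Defs "HOL-Library.Countable"
begin

text \<open>
A group \<open>G\<close> generated by elements of order \<open>p\<close> is a quotient of a free product of copies of the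
cyclic group of order \<open>p\<close>, which is cellular. Identifying two elements with trivial \<open>p\<close>-th power in
a cellular group is a coequalizer of two maps from the cyclic group, and countably many cellular
quotients of the free product have a pushout. Hence there is a smallest cellular quotient \<open>E\<close> of the
free product that still maps onto \<open>G\<close>, and two elements of \<open>E\<close> with trivial \<open>p\<close>-th power are equal if
they have the same image in \<open>G\<close>. Consequently the kernel \<open>K\<close> of \<open>E \<rightarrow> G\<close> is central, because a conjugate
of a generator by an element of \<open>K\<close> lies over that generator, and \<open>K\<close> has no \<open>p\<close>-torsion. The theorem
\<open>cellular_if_rigid\<close> reduces the claim to \<open>K = 1\<close>.

In homological terms \<open>K\<close> vanishes if the Schur multiplier of \<open>G\<close> is a \<open>p\<close>-group. For the two groups here
a direct argument from self-similarity is given, without presentations or homology. A substitution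
lifts a word \<open>w\<close> to a word that acts by \<open>w\<close> on one subtree below the root, while on the other subtrees
it acts through a small finite group: dihedral of order 8 for the Grigorchuk group, and cyclic of
order 9 for the Gupta--Sidki group. Elements supported on different subtrees commute in the tree,
and in \<open>E\<close> as well: their commutator is central, and a suitable power of it is trivial since it
suffices to consider elements of \<open>p\<close>-power order on one side. The main step is that a relator of
\<open>G\<close> splits: its value in \<open>E\<close> is the product of the lifts of its sections
(\<open>splits_if_dihedral_trivial\<close>, \<open>splits_if_conj_balanced\<close>). The error in this equation is a conjugation invariant homomorphism into
\<open>K\<close>, and on the generators of its domain it takes values of \<open>p\<close>-power order, so it is trivial.

A relator is evaluated by induction on the number of its letters other than \<open>a\<close>. Its sections are
relators with fewer such letters, and their lifts are their values for another choice of generators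
inside the same group \<open>E\<close>, namely the old one composed with the substitution. So the induction runs
over all choices of generators that satisfy a few conditions stable under substitution, collected in
the locales \<open>grig_marking\<close> and \<open>gs_marking\<close>. It ends with words supported on a single conjugate of the
finite group generated by \<open>b\<close>, \<open>c\<close>, \<open>d\<close>, or by \<open>t\<close>.
\<close>

section \<open>Colimits of bipartite diagrams\<close>

text \<open>All colimits below are taken over categories in which every arrow other than an identity goes from
a source to a sink. Two such arrows never compose, so a diagram is just a family of homomorphisms
and composition is determined by the identity laws. Objects and arrows may be indexed by any
countable types, since these embed into the infinite type \<open>'u\<close>. The universal property is split
into existence, and uniqueness in the form that homomorphisms agreeing on the image of the cocone
are equal.\<close>

lemma cellular_in_bipartite_colimit:
  fixes A :: "'a monoid" and G :: "'u monoid"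
    and D :: "'i::countable \<Rightarrow> 'u monoid" and T :: "'e::countable \<Rightarrow> 'u \<Rightarrow> 'u"
  assumes inf: "infinite (UNIV :: 'u set)"
    and ends: "\<And>e. e \<in> E \<Longrightarrow> src e \<in> I \<and> tgt e \<in> I"
    and bip: "\<And>e e'. e \<in> E \<Longrightarrow> e' \<in> E \<Longrightarrow> tgt e \<noteq> src e'"
    and D: "\<And>i. i \<in> I \<Longrightarrow> group (D i)" "\<And>i. i \<in> I \<Longrightarrow> cellular_in A (D i)"
    and T: "\<And>e. e \<in> E \<Longrightarrow> T e \<in> hom (D (src e)) (D (tgt e))"
    and G: "group G"
    and \<iota>: "\<And>i. i \<in> I \<Longrightarrow> \<iota> i \<in> hom (D i) G"
    and \<iota>T: "\<And>e x. e \<in> E \<Longrightarrow> x \<in> carrier (D (src e)) \<Longrightarrow> \<iota> (tgt e) (T e x) = \<iota> (src e) x"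
    and ex: "\<And>(H :: 'u monoid) \<kappa>. group H \<Longrightarrow> (\<And>i. i \<in> I \<Longrightarrow> \<kappa> i \<in> hom (D i) H) \<Longrightarrow>
        (\<And>e x. e \<in> E \<Longrightarrow> x \<in> carrier (D (src e)) \<Longrightarrow> \<kappa> (tgt e) (T e x) = \<kappa> (src e) x) \<Longrightarrow>
        \<exists>h\<in>hom G H. \<forall>i\<in>I. \<forall>x\<in>carrier (D i). h (\<iota> i x) = \<kappa> i x"
    and uniq: "\<And>(H :: 'u monoid) h h'. group H \<Longrightarrow> h \<in> hom G H \<Longrightarrow> h' \<in> hom G H \<Longrightarrow>
        (\<And>i x. i \<in> I \<Longrightarrow> x \<in> carrier (D i) \<Longrightarrow> h (\<iota> i x) = h' (\<iota> i x)) \<Longrightarrow>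
        \<forall>y\<in>carrier G. h y = h' y"
  shows "cellular_in A G"
proof -
  obtain f :: "nat \<Rightarrow> 'u" where f: "inj f"
    using infinite_countable_subset[OF inf] by blast
  define eo :: "'i \<Rightarrow> 'u" where "eo = f \<circ> to_nat"
  define ea :: "'i + 'e \<Rightarrow> 'u" where "ea = f \<circ> to_nat"
  have inj: "inj eo" "inj ea"
    unfolding eo_def ea_def by (intro inj_compose f inj_to_nat)+
  define uo where "uo = inv_into UNIV eo"
  define ua where "ua = inv_into UNIV ea"
  have [simp]: "uo (eo i) = i" "ua (ea k) = k" for i k
    using inj by (simp_all add: uo_def ua_def)
  define C :: "('u, 'u) cat" where "C =
    \<lparr>Obj = eo ` I, Arr = ea ` (Inl ` I \<union> Inr ` E),
     Dom = \<lambda>x. eo (case ua x of Inl i \<Rightarrow> i | Inr e \<Rightarrow> src e),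
     Cod = \<lambda>x. eo (case ua x of Inl i \<Rightarrow> i | Inr e \<Rightarrow> tgt e),
     Ident = \<lambda>x. ea (Inl (uo x)),
     Comp = \<lambda>g f. (case ua f of Inl i \<Rightarrow> g | Inr e \<Rightarrow> f)\<rparr>"
  have eo_eq [simp]: "eo i = eo j \<longleftrightarrow> i = j" for i j
    using inj by (auto dest: injD)
  have cat: "small_category C"
    using ends bip by (auto simp: small_category_def C_def)
  define T' where "T' x = (case ua x of Inl i \<Rightarrow> (\<lambda>y. y) | Inr e \<Rightarrow> T e)" for x
  have dia: "group_diagram C (D \<circ> uo) T'"
    unfolding group_diagram_def using cat D T ends bip
    by (auto simp: C_def T'_def hom_in_carrier intro: homI)
  have "group_cocone C (D \<circ> uo) T' G (\<iota> \<circ> uo)"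
    unfolding group_cocone_def using G \<iota> \<iota>T by (auto simp: C_def T'_def)
  moreover have "(\<exists>h\<in>hom G H. \<forall>i\<in>Obj C. \<forall>x\<in>carrier ((D \<circ> uo) i). h ((\<iota> \<circ> uo) i x) = \<kappa> i x) \<and>
        (\<forall>h\<in>hom G H. \<forall>h'\<in>hom G H.
           (\<forall>i\<in>Obj C. \<forall>x\<in>carrier ((D \<circ> uo) i).
              h ((\<iota> \<circ> uo) i x) = \<kappa> i x \<and> h' ((\<iota> \<circ> uo) i x) = \<kappa> i x) \<longrightarrow>
           (\<forall>y\<in>carrier G. h y = h' y))"
    if H: "group_cocone C (D \<circ> uo) T' H \<kappa>" for H :: "'u monoid" and \<kappa>
  proof -
    have gH: "group H" and \<kappa>: "\<And>i. i \<in> I \<Longrightarrow> \<kappa> (eo i) \<in> hom (D i) H"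
      using H by (auto simp: group_cocone_def C_def)
    have \<kappa>T: "\<kappa> (eo (tgt e)) (T e x) = \<kappa> (eo (src e)) x"
      if "e \<in> E" "x \<in> carrier (D (src e))" for e x
    proof -
      have "ea (Inr e) \<in> Arr C" using that by (auto simp: C_def)
      then have "\<forall>x\<in>carrier ((D \<circ> uo) (Dom C (ea (Inr e)))).
          \<kappa> (Cod C (ea (Inr e))) (T' (ea (Inr e)) x) = \<kappa> (Dom C (ea (Inr e))) x"
        using H unfolding group_cocone_def by blast
      then show ?thesis using that by (simp add: C_def T'_def)
    qed
    obtain h where "h \<in> hom G H" "\<forall>i\<in>I. \<forall>x\<in>carrier (D i). h (\<iota> i x) = \<kappa> (eo i) x"
      using ex[of H "\<lambda>i. \<kappa> (eo i)", OF gH \<kappa> \<kappa>T] by blast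
    then have "\<exists>h\<in>hom G H. \<forall>i\<in>Obj C. \<forall>x\<in>carrier ((D \<circ> uo) i). h ((\<iota> \<circ> uo) i x) = \<kappa> i x"
      by (auto simp: C_def)
    then show ?thesis
      using uniq[OF gH] by (auto simp: C_def)
  qed
  ultimately have "group_colimit C (D \<circ> uo) T' G (\<iota> \<circ> uo)"
    unfolding group_colimit_def by blast
  moreover have "\<forall>i\<in>Obj C. cellular_in A ((D \<circ> uo) i)"
    using D by (auto simp: C_def)
  ultimately show ?thesis
    using dia cellular_in.colimit by blast
qed

section \<open>Groups given by words and relations\<close>

primrec ev :: "('g, 'b) monoid_scheme \<Rightarrow> ('l \<Rightarrow> 'g) \<Rightarrow> 'l list \<Rightarrow> 'g" where
  "ev G m [] = \<one>\<^bsub>G\<^esub>"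
| "ev G m (x # w) = m x \<otimes>\<^bsub>G\<^esub> ev G m w"

lemma (in monoid) ev_closed: "range m \<subseteq> carrier G \<Longrightarrow> ev G m w \<in> carrier G"
  by (induction w) auto

lemma (in monoid) ev_append:
  "range m \<subseteq> carrier G \<Longrightarrow> ev G m (u @ v) = ev G m u \<otimes> ev G m v"
  by (induction u) (auto simp: ev_closed m_assoc image_subset_iff)

lemma (in monoid) ev_replicate:
  "range m \<subseteq> carrier G \<Longrightarrow> ev G m (concat (replicate n u)) = ev G m u [^] n"
  by (induction n) (simp_all add: ev_append ev_closed nat_pow_Suc2[unfolded nat_pow_Suc])

lemma (in monoid) ev_replicate_letter:
  "range m \<subseteq> carrier G \<Longrightarrow> ev G m (replicate n x) = m x [^] n"
  by (induction n) (simp_all add: nat_pow_Suc2[unfolded nat_pow_Suc] image_subset_iff)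

lemma ev_hom:
  assumes "group G" "group H" "h \<in> hom G H" "range m \<subseteq> carrier G"
  shows "h (ev G m w) = ev H (\<lambda>x. h (m x)) w"
proof (induction w)
  case Nil
  show ?case using assms by (simp add: hom_one)
next
  case (Cons x w)
  have "m x \<in> carrier G" "ev G m w \<in> carrier G"
    using assms group.axioms(1) monoid.ev_closed by blast+
  then show ?case
    using Cons hom_mult[OF assms(3)] by simp
qed

text \<open>Transport of structure along an injection; it moves a countable group into the type \<open>'u\<close>.\<close>

definition group_copy :: "('x \<Rightarrow> 'y) \<Rightarrow> 'x monoid \<Rightarrow> 'y monoid" where
  "group_copy f G = \<lparr>carrier = f ` carrier G,
     monoid.mult = (\<lambda>x y. f (inv_into UNIV f x \<otimes>\<^bsub>G\<^esub> inv_into UNIV f y)), one = f \<one>\<^bsub>G\<^esub>\<rparr>"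

lemma group_copy:
  assumes "group G" "inj f"
  shows "group (group_copy f G)" "f \<in> iso G (group_copy f G)"
proof -
  interpret group G by fact
  have [simp]: "inv_into UNIV f (f x) = x" for x
    using assms by simp
  show grp: "group (group_copy f G)"
  proof (rule groupI)
    show "\<exists>y\<in>carrier (group_copy f G). y \<otimes>\<^bsub>group_copy f G\<^esub> x = \<one>\<^bsub>group_copy f G\<^esub>"
      if x: "x \<in> carrier (group_copy f G)" for x
    proof -
      obtain y where y: "x = f y" "y \<in> carrier G"
        using x by (auto simp: group_copy_def)
      then show ?thesis
        by (auto simp: group_copy_def intro!: bexI[of _ "inv\<^bsub>G\<^esub> y"])
    qed
  qed (auto simp: group_copy_def m_assoc)
  show "f \<in> iso G (group_copy f G)"
    using inj_on_subset[OF assms(2) subset_UNIV]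
    by (simp add: iso_def hom_def group_copy_def bij_betw_def)
qed

text \<open>A congruence on positive words. Since \<open>p\<close>-th powers of letters are trivial, a letter has the
inverse \<open>x\<^sup>p\<^sup>-\<^sup>1\<close>, so that positive words suffice to
present a group.\<close>

locale word_congruence =
  fixes p :: nat and r :: "'l::countable list \<Rightarrow> 'l list \<Rightarrow> bool"
  assumes p_pos: "0 < p"
    and refl: "r u u"
    and sym: "r u v \<Longrightarrow> r v u"
    and trans: "r u v \<Longrightarrow> r v w \<Longrightarrow> r u w"
    and cong: "r u v \<Longrightarrow> r (x @ u @ y) (x @ v @ y)"
    and power: "r (replicate p l) []"

text \<open>The quotient is realised on chosen representatives rather than on congruence classes: its carrier
is then a set of words, which is countable and fits into \<open>'u\<close>.\<close>

definition normal_form :: "('l list \<Rightarrow> 'l list \<Rightarrow> bool) \<Rightarrow> 'l list \<Rightarrow> 'l list" where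
  "normal_form r w = (SOME v. r v w)"

definition word_quot :: "('l list \<Rightarrow> 'l list \<Rightarrow> bool) \<Rightarrow> 'l list monoid" where
  "word_quot r = \<lparr>carrier = range (normal_form r), monoid.mult = (\<lambda>u v. normal_form r (u @ v)), one = normal_form r []\<rparr>"

context word_congruence
begin

lemma normal_form: "r (normal_form r w) w"
  unfolding normal_form_def by (rule someI[of _ w]) (rule refl)

lemma normal_form_eq_iff: "normal_form r u = normal_form r v \<longleftrightarrow> r u v"
proof
  show "r u v" if "normal_form r u = normal_form r v"
    using trans[OF sym[OF normal_form[of u]], of v] normal_form[of v] that by simp
  show "normal_form r u = normal_form r v" if "r u v"
  proof -
    have "(\<lambda>w. r w u) = (\<lambda>w. r w v)"
      using that by (auto intro: trans sym)
    then show ?thesis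
      by (simp add: normal_form_def)
  qed
qed

lemma append_cong: "r u u' \<Longrightarrow> r v v' \<Longrightarrow> r (u @ v) (u' @ v')"
  using trans[of "u @ v" "u' @ v" "u' @ v'"] cong[of u u' "[]" v] cong[of v v' u' "[]"] by simp

lemma inverse_word: "\<exists>v. r (v @ w) []"
proof (induction w)
  case Nil
  show ?case using refl by (intro exI[of _ "[]"]) simp
next
  case (Cons x w)
  then obtain v where v: "r (v @ w) []" by blast
  have "r (v @ replicate p x @ w) (v @ [] @ w)"
    by (rule cong[OF power])
  moreover have "replicate p x = replicate (p - 1) x @ [x]"
    using p_pos by (metis Suc_pred' replicate_Suc replicate_append_same)
  ultimately have "r ((v @ replicate (p - 1) x) @ x # w) []"
    using trans[OF _ v] by simp
  then show ?case ..
qed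

lemma group_word_quot: "group (word_quot r)"
proof (rule groupI)
  show "x \<otimes>\<^bsub>word_quot r\<^esub> y \<otimes>\<^bsub>word_quot r\<^esub> z = x \<otimes>\<^bsub>word_quot r\<^esub> (y \<otimes>\<^bsub>word_quot r\<^esub> z)" for x y z
  proof -
    have "r (normal_form r (x @ y) @ z) ((x @ y) @ z)" "r (x @ normal_form r (y @ z)) (x @ y @ z)"
      by (rule append_cong normal_form refl)+
    then show ?thesis
      by (simp add: word_quot_def normal_form_eq_iff) (rule trans, assumption, rule sym)
  qed
  show "\<one>\<^bsub>word_quot r\<^esub> \<otimes>\<^bsub>word_quot r\<^esub> x = x" if x: "x \<in> carrier (word_quot r)" for x
  proof -
    obtain w where w: "x = normal_form r w"
      using x by (auto simp: word_quot_def)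
    have "r (normal_form r [] @ normal_form r w) ([] @ w)"
      by (rule append_cong normal_form)+
    then show ?thesis
      by (simp add: w word_quot_def normal_form_eq_iff)
  qed
  show "\<exists>y\<in>carrier (word_quot r). y \<otimes>\<^bsub>word_quot r\<^esub> x = \<one>\<^bsub>word_quot r\<^esub>"
    if x: "x \<in> carrier (word_quot r)" for x
  proof -
    obtain v where "r (v @ x) []" using inverse_word by blast
    then have "r (normal_form r v @ x) []"
      by (rule trans[OF append_cong[OF normal_form refl]])
    then show ?thesis by (auto simp: word_quot_def normal_form_eq_iff)
  qed
qed (auto simp: word_quot_def)

end

definition to_u :: "'x::countable \<Rightarrow> 'u" where
  "to_u = (SOME f :: nat \<Rightarrow> 'u. inj f) \<circ> to_nat"

lemma inj_to_u:
  assumes "infinite (UNIV :: 'u set)"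
  shows "inj (to_u :: 'x::countable \<Rightarrow> 'u)"
proof -
  have "\<exists>f :: nat \<Rightarrow> 'u. inj f"
    using infinite_countable_subset[OF assms] by blast
  then have "inj (SOME f :: nat \<Rightarrow> 'u. inj f)"
    by (rule someI_ex)
  then show ?thesis
    unfolding to_u_def by (intro inj_compose inj_to_nat)
qed

definition word_group :: "('l::countable list \<Rightarrow> 'l list \<Rightarrow> bool) \<Rightarrow> 'u monoid" where
  "word_group r = group_copy to_u (word_quot r)"

definition mark :: "('l::countable list \<Rightarrow> 'l list \<Rightarrow> bool) \<Rightarrow> 'l \<Rightarrow> 'u" where
  "mark r x = to_u (normal_form r [x])"

locale word_congruence_in = word_congruence p r
  for p and r :: "'l::countable list \<Rightarrow> 'l list \<Rightarrow> bool" +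
  fixes U :: "'u itself"
  assumes inf: "infinite (UNIV :: 'u set)"
begin

abbreviation P :: "'u monoid" where "P \<equiv> word_group r"
abbreviation \<mu> :: "'l \<Rightarrow> 'u" where "\<mu> \<equiv> mark r"

lemma group_P: "group P"
  unfolding word_group_def by (rule group_copy[OF group_word_quot inj_to_u[OF inf]])

lemma carrier_P: "carrier P = range (\<lambda>w. to_u (normal_form r w))"
  by (auto simp: word_group_def group_copy_def word_quot_def)

lemma mark_closed: "range \<mu> \<subseteq> carrier P"
  by (auto simp: carrier_P mark_def)

lemma ev_P: "ev P \<mu> w = to_u (normal_form r w)"
proof -
  have [simp]: "inv_into UNIV to_u (to_u x :: 'u) = x" for x :: "'l list"
    by (rule inv_f_f[OF inj_to_u[OF inf]])
  show ?thesis
  proof (induction w)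
    case Nil
    show ?case by (simp add: word_group_def group_copy_def word_quot_def)
  next
    case (Cons x w)
    have "normal_form r (normal_form r [x] @ normal_form r w) = normal_form r (x # w)"
      using append_cong[OF normal_form normal_form, of "[x]" w] by (simp add: normal_form_eq_iff)
    moreover have "ev P \<mu> (x # w) = to_u (normal_form r [x]) \<otimes>\<^bsub>P\<^esub> to_u (normal_form r w)"
      by (simp add: Cons mark_def)
    ultimately show ?case
      by (simp add: word_group_def group_copy_def word_quot_def)
  qed
qed

lemma ev_P_eq_iff: "ev P \<mu> u = ev P \<mu> v \<longleftrightarrow> r u v"
  using inj_eq[OF inj_to_u[OF inf]] by (metis ev_P normal_form_eq_iff)

lemma carrier_P': "carrier P = range (ev P \<mu>)"
  by (simp add: carrier_P ev_P)

text \<open>The universal property of the group presented by a congruence.\<close>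

lemma hom_from_P:
  assumes H: "group H" "range n \<subseteq> carrier H"
    and rel: "\<And>u v. r u v \<Longrightarrow> ev H n u = ev H n v"
  shows "\<exists>h. h \<in> hom P H \<and> (\<forall>w. h (ev P \<mu> w) = ev H n w)"
proof (intro exI conjI allI)
  interpret H: group H by fact
  define h where "h x = ev H n (SOME w. ev P \<mu> w = x)" for x
  show h: "h (ev P \<mu> w) = ev H n w" for w
  proof -
    have "ev P \<mu> (SOME v. ev P \<mu> v = ev P \<mu> w) = ev P \<mu> w"
      by (rule someI[of _ w]) simp
    then show ?thesis
      unfolding h_def ev_P_eq_iff by (rule rel)
  qed
  show "h \<in> hom P H"
  proof (rule homI)
    show "h x \<in> carrier H" if "x \<in> carrier P" for x
      using that H.ev_closed[OF H(2)] unfolding carrier_P' by (auto simp: h)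
    show "h (x \<otimes>\<^bsub>P\<^esub> y) = h x \<otimes>\<^bsub>H\<^esub> h y" if x: "x \<in> carrier P" and y: "y \<in> carrier P" for x y
    proof -
      obtain u where u: "x = ev P \<mu> u" using x unfolding carrier_P' by blast
      obtain v where v: "y = ev P \<mu> v" using y unfolding carrier_P' by blast
      note uv = u v
      have "x \<otimes>\<^bsub>P\<^esub> y = ev P \<mu> (u @ v)"
        unfolding uv using group_P mark_closed by (simp add: monoid.ev_append group.axioms(1))
      then show ?thesis
        using h uv H H.ev_append by metis
    qed
  qed
qed

lemma hom_from_P_unique:
  assumes "group H" "h \<in> hom P H" "h' \<in> hom P H" "\<And>l. h (\<mu> l) = h' (\<mu> l)"
  shows "\<forall>y\<in>carrier P. h y = h' y"
proof
  fix y assume "y \<in> carrier P"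
  then obtain w where w: "y = ev P \<mu> w"
    unfolding carrier_P' by blast
  show "h y = h' y"
    unfolding w ev_hom[OF group_P assms(1) assms(2) mark_closed]
      ev_hom[OF group_P assms(1) assms(3) mark_closed] by (simp add: assms(4))
qed

lemma mark_power: "\<mu> l [^]\<^bsub>P\<^esub> p = \<one>\<^bsub>P\<^esub>"
proof -
  have "ev P \<mu> (replicate p l) = ev P \<mu> []"
    by (simp add: ev_P_eq_iff power del: ev.simps)
  then show ?thesis
    using mark_closed group_P by (simp add: monoid.ev_replicate_letter group.axioms(1))
qed

end

section \<open>A criterion for cellularity\<close>

definition cyc :: "nat \<Rightarrow> 'u monoid" where
  "cyc p = group_copy (to_u :: int \<Rightarrow> 'u) (integer_mod_group p)"

text \<open>The homomorphism from the cyclic group that sends its generator \<open>to_u 1\<close> to \<open>x\<close>.\<close>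

definition cyc_hom :: "('h, 'b) monoid_scheme \<Rightarrow> 'h \<Rightarrow> 'u \<Rightarrow> 'h" where
  "cyc_hom H x k = x [^]\<^bsub>H\<^esub> (inv_into UNIV to_u k :: int)"

context
  fixes p :: nat and U :: "'u itself"
  assumes p: "1 < p" and inf: "infinite (UNIV :: 'u set)"
begin

lemma cyc_iso: "(to_u :: int \<Rightarrow> 'u) \<in> iso (integer_mod_group p) (cyc p)"
  and group_cyc: "group (cyc p :: 'u monoid)"
  unfolding cyc_def by (rule group_copy[OF group_integer_mod_group inj_to_u[OF inf]])+

lemma inv_to_u [simp]: "inv_into UNIV to_u (to_u x :: 'u) = x"
  by (rule inv_f_f[OF inj_to_u[OF inf]])

lemma carrier_cyc: "carrier (cyc p :: 'u monoid) = to_u ` {0..<int p}"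
  using p by (simp add: cyc_def group_copy_def carrier_integer_mod_group)

lemma cyc_gen: "(to_u (1::int) :: 'u) \<in> carrier (cyc p)"
  using p by (simp add: carrier_cyc)

lemma cyc_hom:
  assumes H: "group H" "x \<in> carrier H" "x [^]\<^bsub>H\<^esub> p = \<one>\<^bsub>H\<^esub>"
  shows "cyc_hom H x \<in> hom (cyc p :: 'u monoid) H" "cyc_hom H x (to_u (1::int) :: 'u) = x"
proof -
  interpret H: group H by fact
  have mod: "x [^]\<^bsub>H\<^esub> (k mod int p) = x [^]\<^bsub>H\<^esub> k" for k :: int
  proof -
    have "x [^]\<^bsub>H\<^esub> k = x [^]\<^bsub>H\<^esub> (int p * (k div int p) + k mod int p)"
      by simp
    also have "\<dots> = (x [^]\<^bsub>H\<^esub> int p) [^]\<^bsub>H\<^esub> (k div int p) \<otimes>\<^bsub>H\<^esub> x [^]\<^bsub>H\<^esub> (k mod int p)"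
      using H by (simp only: H.int_pow_mult H.int_pow_pow)
    also have "\<dots> = x [^]\<^bsub>H\<^esub> (k mod int p)"
      using H by (simp add: int_pow_int)
    finally show ?thesis ..
  qed
  show "cyc_hom H x \<in> hom (cyc p :: 'u monoid) H"
    using H mod
    by (auto intro!: homI simp: carrier_cyc cyc_hom_def H.int_pow_mult)
      (simp add: cyc_def group_copy_def mod H.int_pow_mult)
  show "cyc_hom H x (to_u (1::int) :: 'u) = x"
    using H by (simp add: cyc_hom_def)
qed

lemma hom_cyc_eq:
  assumes H: "group H" "\<kappa> \<in> hom (cyc p :: 'u monoid) H"
  shows "\<kappa> (to_u (1::int)) \<in> carrier H" "\<kappa> (to_u (1::int)) [^]\<^bsub>H\<^esub> p = \<one>\<^bsub>H\<^esub>"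
    "k \<in> carrier (cyc p) \<Longrightarrow> \<kappa> k = cyc_hom H (\<kappa> (to_u (1::int))) k"
proof -
  interpret H: group H by fact
  have h: "\<kappa> \<circ> to_u \<in> hom (integer_mod_group p) H"
    using cyc_iso H by (auto simp: iso_def intro: hom_compose)
  interpret h: group_hom "integer_mod_group p" H "\<kappa> \<circ> to_u"
    using H h by (simp add: group_hom_def group_hom_axioms_def)
  have one: "1 \<in> carrier (integer_mod_group p)"
    using p by simp
  show "\<kappa> (to_u (1::int)) \<in> carrier H"
    using h.hom_closed[OF one] by simp
  show "\<kappa> (to_u (1::int)) [^]\<^bsub>H\<^esub> p = \<one>\<^bsub>H\<^esub>"
    using h.hom_nat_pow[OF one, of p] h.hom_one by simp
  show "\<kappa> k = cyc_hom H (\<kappa> (to_u (1::int))) k" if k: "k \<in> carrier (cyc p)"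
  proof -
    obtain j where j: "k = to_u j" "0 \<le> j" "j < int p"
      using k by (auto simp: carrier_cyc)
    then show ?thesis
      using h.hom_int_pow[OF one, of j] by (simp add: cyc_hom_def int_pow_integer_mod_group)
  qed
qed

lemma hom_cyc_ext:
  assumes H: "group H" "\<kappa> \<in> hom (cyc p :: 'u monoid) H" "\<kappa>' \<in> hom (cyc p :: 'u monoid) H"
    and "\<kappa> (to_u (1::int)) = \<kappa>' (to_u (1::int))" "k \<in> carrier (cyc p)"
  shows "\<kappa> k = \<kappa>' k"
  using hom_cyc_eq(3)[OF H(1,2)] hom_cyc_eq(3)[OF H(1,3)] assms(4,5) by simp

end

text \<open>A model of a set \<open>R\<close> of relations is a group with marked elements that satisfy \<open>R\<close> and have trivial
\<open>p\<close>-th powers. The consequences of \<open>R\<close> are defined semantically, by quantifying over all models with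
carrier in \<open>'u\<close>, so that the presented group has its universal property by construction.\<close>

definition model :: "nat \<Rightarrow> ('l list \<Rightarrow> 'l list \<Rightarrow> bool) \<Rightarrow> ('h, 'b) monoid_scheme \<Rightarrow> ('l \<Rightarrow> 'h) \<Rightarrow> bool"
  where "model p R H n \<longleftrightarrow> group H \<and> range n \<subseteq> carrier H \<and> (\<forall>l. n l [^]\<^bsub>H\<^esub> p = \<one>\<^bsub>H\<^esub>) \<and>
     (\<forall>u v. R u v \<longrightarrow> ev H n u = ev H n v)"

definition implied :: "'u itself \<Rightarrow> nat \<Rightarrow> ('l list \<Rightarrow> 'l list \<Rightarrow> bool) \<Rightarrow> 'l list \<Rightarrow> 'l list \<Rightarrow> bool" where
  "implied _ p R u v \<longleftrightarrow> (\<forall>(H :: 'u monoid) n. model p R H n \<longrightarrow> ev H n u = ev H n v)"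

lemma model_implied: "model p R (H :: 'u monoid) n \<Longrightarrow> model p (implied TYPE('u) p R) H n"
  by (auto simp: model_def implied_def)

lemma implied_incl: "R u v \<Longrightarrow> implied TYPE('u) p R u v"
  by (auto simp: model_def implied_def)

lemma model_mono: "model p R H n \<Longrightarrow> (\<And>u v. S u v \<Longrightarrow> R u v) \<Longrightarrow> model p S H n"
  by (auto simp: model_def)

lemma word_congruence_implied:
  assumes "0 < p"
  shows "word_congruence p (implied TYPE('u) p (R :: 'l::countable list \<Rightarrow> _))"
proof
  show "implied TYPE('u) p R (x @ u @ y) (x @ v @ y)" if "implied TYPE('u) p R u v" for u v x y
    using that unfolding implied_def model_def by (simp add: group.axioms(1) monoid.ev_append)
  show "implied TYPE('u) p R (replicate p l) []" for l
    unfolding implied_def model_def by (simp add: group.axioms(1) monoid.ev_replicate_letter)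
qed (use assms in \<open>simp_all add: implied_def\<close>)

lemma word_congruence_model:
  assumes "0 < p" "model p (\<lambda>u v. False) G g"
  shows "word_congruence p (\<lambda>u v. ev G g u = ev G (g :: 'l::countable \<Rightarrow> _) v)"
  using assms unfolding model_def
  by unfold_locales (simp_all add: monoid.ev_append monoid.ev_replicate_letter group.axioms(1))

definition cellular_relation :: "'u itself \<Rightarrow> nat \<Rightarrow> 'a monoid \<Rightarrow> ('l::countable list \<Rightarrow> 'l list \<Rightarrow> bool) \<Rightarrow> bool" where
  "cellular_relation _ p A r \<longleftrightarrow> word_congruence p r \<and> cellular_in A (word_group r :: 'u monoid)"

context
  fixes p :: nat and U :: "'u itself" and A :: "'a monoid"
  assumes p: "1 < p" and inf: "infinite (UNIV :: 'u set)"
    and A: "cellular_in A (cyc p :: 'u monoid)"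
begin

lemma wci: "word_congruence p r \<Longrightarrow> word_congruence_in TYPE('u) p r"
  using inf by (simp add: word_congruence_in_def word_congruence_in_axioms_def)

lemma wci_implied: "word_congruence_in TYPE('u) p (implied TYPE('u) p R)"
  using p by (intro wci word_congruence_implied) simp

lemma model_word_group:
  assumes "word_congruence p r"
  shows "model p r (word_group r :: 'u monoid) (mark r)"
proof -
  interpret word_congruence_in p r "TYPE('u)" by (rule wci[OF assms])
  show ?thesis
    using group_P mark_closed mark_power ev_P_eq_iff by (auto simp: model_def)
qed

text \<open>The group presented by \<open>r\<close> has a copy in \<open>'u\<close>, so it is itself one of the models over which
\<^const>\<open>implied\<close> quantifies.\<close>

lemma implied_least:
  assumes r: "word_congruence p r" and R: "\<And>u v. R u v \<Longrightarrow> r u v" and w: "implied TYPE('u) p R u v"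
  shows "r u v"
proof -
  interpret word_congruence_in p r "TYPE('u)" by (rule wci[OF r])
  have "model p R P \<mu>"
    using model_word_group[OF r] R by (rule model_mono)
  then show ?thesis
    using w by (intro ev_P_eq_iff[THEN iffD1]) (simp only: implied_def)
qed

text \<open>Without relations, the presented group is the free product of one copy of the cyclic group for each
letter, which is the colimit of a discrete diagram.\<close>

lemma cellular_relation_free_product: "cellular_relation TYPE('u) p A (implied TYPE('u) p (\<lambda>u v :: 'l::countable list. False))"
proof -
  let ?r = "implied TYPE('u) p (\<lambda>u v :: 'l list. False)"
  interpret r: word_congruence_in p ?r "TYPE('u)" by (rule wci_implied)
  note hom = cyc_hom[OF p inf r.group_P]
  have mu: "r.\<mu> l \<in> carrier r.P" for l using r.mark_closed by blast
  have "cellular_in A r.P"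
  proof (rule cellular_in_bipartite_colimit[OF inf, where I = "UNIV :: 'l set" and E = "{} :: 'l set"
        and D = "\<lambda>_. cyc p" and \<iota> = "\<lambda>l. cyc_hom r.P (r.\<mu> l)"])
    show "group (cyc p :: 'u monoid)" by (rule group_cyc[OF p inf])
    show "cyc_hom r.P (r.\<mu> l) \<in> hom (cyc p :: 'u monoid) r.P" for l
      using hom(1)[OF mu[of l] r.mark_power[of l]] .
    show "\<exists>h\<in>hom r.P H. \<forall>l\<in>UNIV. \<forall>x\<in>carrier (cyc p :: 'u monoid). h (cyc_hom r.P (r.\<mu> l) x) = \<kappa> l x"
      if H: "group H" and \<kappa>: "\<And>l. l \<in> (UNIV :: 'l set) \<Longrightarrow> \<kappa> l \<in> hom (cyc p :: 'u monoid) H"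
      for H :: "'u monoid" and \<kappa>
    proof -
      define n where "n l = \<kappa> l (to_u (1::int))" for l
      have mod: "model p (\<lambda>u v :: 'l list. False) H n"
        using hom_cyc_eq(1,2)[OF p inf H \<kappa>] H by (auto simp: model_def n_def)
      obtain h where h: "h \<in> hom r.P H" "\<And>w. h (ev r.P r.\<mu> w) = ev H n w"
        using r.hom_from_P[of H n] model_implied[OF mod] unfolding model_def by meson
      have "h (r.\<mu> l) = n l" for l
        using h(2)[of "[l]"] mod mu r.group_P
        by (auto simp: model_def group.axioms(1) monoid.r_one image_subset_iff)
      then have "h (cyc_hom r.P (r.\<mu> l) x) = \<kappa> l x" if "x \<in> carrier (cyc p :: 'u monoid)" for l x
        using hom_cyc_ext[OF p inf H hom_compose[OF hom(1)[OF mu r.mark_power] h(1)] \<kappa>, of l l x]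
          hom(2)[OF mu r.mark_power] that by (simp add: n_def)
      then show ?thesis using h(1) by blast
    qed
    show "\<forall>y\<in>carrier r.P. h y = h' y"
      if H: "group H" "h \<in> hom r.P H" "h' \<in> hom r.P H"
        "\<And>l x. l \<in> UNIV \<Longrightarrow> x \<in> carrier (cyc p :: 'u monoid) \<Longrightarrow>
           h (cyc_hom r.P (r.\<mu> l) x) = h' (cyc_hom r.P (r.\<mu> l) x)"
      for H :: "'u monoid" and h h'
    proof (rule r.hom_from_P_unique[OF H(1-3)])
      show "h (r.\<mu> l) = h' (r.\<mu> l)" for l
        using H(4)[OF UNIV_I cyc_gen[OF p inf], of l] hom(2)[OF mu r.mark_power] by simp
    qed
  qed (use A r.group_P in auto)
  then show ?thesis
    using r.word_congruence_axioms by (simp add: cellular_relation_def)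
qed

text \<open>Words \<open>u\<close> and \<open>v\<close> whose \<open>p\<close>-th powers are trivial define two homomorphisms from the cyclic group;
imposing \<open>u = v\<close> means taking their coequalizer.\<close>

lemma cellular_relation_coequalizer:
  fixes r :: "'l::countable list \<Rightarrow> 'l list \<Rightarrow> bool"
  assumes r: "cellular_relation TYPE('u) p A r"
    and u: "r (concat (replicate p u)) []" and v: "r (concat (replicate p v)) []"
  shows "cellular_relation TYPE('u) p A (implied TYPE('u) p (\<lambda>x y. r x y \<or> x = u \<and> y = v))"
proof -
  let ?s = "implied TYPE('u) p (\<lambda>x y. r x y \<or> x = u \<and> y = v)"
  interpret r: word_congruence_in p r "TYPE('u)" using r by (intro wci) (simp add: cellular_relation_def)
  interpret s: word_congruence_in p ?s "TYPE('u)" by (rule wci_implied)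
  have rs: "r x y \<Longrightarrow> ?s x y" for x y by (rule implied_incl) simp
  have suv: "?s u v" by (rule implied_incl) simp
  have "\<exists>q. q \<in> hom r.P s.P \<and> (\<forall>w. q (ev r.P r.\<mu> w) = ev s.P s.\<mu> w)"
    by (rule r.hom_from_P[OF s.group_P s.mark_closed]) (simp only: s.ev_P_eq_iff rs)
  then obtain q where q: "q \<in> hom r.P s.P" "\<And>w. q (ev r.P r.\<mu> w) = ev s.P s.\<mu> w"
    by blast
  \<comment> \<open>The two homomorphisms from the cyclic group send its generator to the values of \<open>u\<close> and \<open>v\<close>.\<close>
  define side where "side b = ev r.P r.\<mu> (if b then u else v)" for b
  have side: "side b \<in> carrier r.P" "side b [^]\<^bsub>r.P\<^esub> p = \<one>\<^bsub>r.P\<^esub>" for b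
  proof -
    have "ev r.P r.\<mu> (concat (replicate p (if b then u else v))) = ev r.P r.\<mu> []"
      unfolding r.ev_P_eq_iff using u v by simp
    then show "side b [^]\<^bsub>r.P\<^esub> p = \<one>\<^bsub>r.P\<^esub>"
      using r.group_P r.mark_closed
      by (simp add: side_def monoid.ev_replicate group.axioms(1))
    show "side b \<in> carrier r.P"
      using r.group_P r.mark_closed by (simp add: side_def monoid.ev_closed group.axioms(1))
  qed
  have qside: "q (side b) = ev s.P s.\<mu> u" for b
    using q(2) s.ev_P_eq_iff[THEN iffD2, OF suv] by (simp add: side_def)
  note sh = cyc_hom[OF p inf r.group_P side]
  have "cellular_in A s.P"
  proof (rule cellular_in_bipartite_colimit[OF inf, where I = "UNIV :: bool set" and E = "UNIV :: bool set"
        and D = "\<lambda>b. if b then r.P else cyc p" and src = "\<lambda>_. False" and tgt = "\<lambda>_. True"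
        and T = "\<lambda>b. cyc_hom r.P (side b)"
        and \<iota> = "\<lambda>b. if b then q else q \<circ> cyc_hom r.P (side True)"])
    show "\<exists>h\<in>hom s.P H. \<forall>i\<in>UNIV. \<forall>x\<in>carrier (if i then r.P else cyc p).
           h ((if i then q else q \<circ> cyc_hom r.P (side True)) x) = \<kappa> i x"
      if H: "group H" and \<kappa>: "\<And>i. i \<in> UNIV \<Longrightarrow> \<kappa> i \<in> hom (if i then r.P else cyc p) H"
        and c: "\<And>e x. e \<in> UNIV \<Longrightarrow> x \<in> carrier (if False then r.P else cyc p) \<Longrightarrow>
           \<kappa> True (cyc_hom r.P (side e) x) = \<kappa> False x"
      for H :: "'u monoid" and \<kappa> :: "bool \<Rightarrow> _"
    proof -
      have k: "\<kappa> True \<in> hom r.P H" "\<kappa> False \<in> hom (cyc p) H"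
        using \<kappa>[of True] \<kappa>[of False] by auto
      define n where "n l = \<kappa> True (r.\<mu> l)" for l
      have evn: "\<kappa> True (ev r.P r.\<mu> w) = ev H n w" for w
        unfolding n_def by (rule ev_hom[OF r.group_P H k(1) r.mark_closed])
      have "ev H n u = ev H n v"
      proof -
        have "\<kappa> True (side True) = \<kappa> True (side False)"
          using c[OF UNIV_I, of "to_u (1::int)" True] c[OF UNIV_I, of "to_u (1::int)" False]
            cyc_gen[OF p inf] sh(2) by simp
        then show ?thesis using evn by (simp add: side_def)
      qed
      moreover have "ev H n x = ev H n y" if "r x y" for x y
        using arg_cong[OF r.ev_P_eq_iff[THEN iffD2, OF that], of "\<kappa> True"] by (simp only: evn)
      moreover have "n l [^]\<^bsub>H\<^esub> p = \<one>\<^bsub>H\<^esub>" "n l \<in> carrier H" for l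
      proof -
        interpret k: group_hom r.P H "\<kappa> True"
          using r.group_P H k by (simp add: group_hom_def group_hom_axioms_def)
        have mu: "r.\<mu> l \<in> carrier r.P" using r.mark_closed by blast
        show "n l [^]\<^bsub>H\<^esub> p = \<one>\<^bsub>H\<^esub>" "n l \<in> carrier H"
          using k.hom_nat_pow[OF mu, of p] r.mark_power[of l] k.hom_closed[OF mu] k.hom_one
          by (simp_all add: n_def)
      qed
      ultimately have mod: "model p (\<lambda>x y. r x y \<or> x = u \<and> y = v) H n"
        using H by (auto simp: model_def)
      obtain h where h: "h \<in> hom s.P H" "\<And>w. h (ev s.P s.\<mu> w) = ev H n w"
        using s.hom_from_P[of H n] model_implied[OF mod] unfolding model_def by meson
      have hq: "h (q x) = \<kappa> True x" if "x \<in> carrier r.P" for x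
        using that q(2) h(2) evn unfolding r.carrier_P' by auto
      have "h (q (cyc_hom r.P (side True) x)) = \<kappa> False x" if "x \<in> carrier (cyc p)" for x
        using hq hom_in_carrier[OF sh(1) that] c[OF UNIV_I, of x True] that by simp
      then show ?thesis using h(1) hq by (intro bexI[of _ h]) auto
    qed
    show "\<forall>y\<in>carrier s.P. h y = h' y"
      if H: "group H" "h \<in> hom s.P H" "h' \<in> hom s.P H"
        "\<And>i x. i \<in> UNIV \<Longrightarrow> x \<in> carrier (if i then r.P else cyc p) \<Longrightarrow>
           h ((if i then q else q \<circ> cyc_hom r.P (side True)) x) =
           h' ((if i then q else q \<circ> cyc_hom r.P (side True)) x)"
      for H :: "'u monoid" and h h'
    proof (rule s.hom_from_P_unique[OF H(1-3)])
      show "h (s.\<mu> l) = h' (s.\<mu> l)" for l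
      proof -
        have mu: "r.\<mu> l \<in> carrier r.P" "s.\<mu> l \<in> carrier s.P"
          using r.mark_closed s.mark_closed by blast+
        have "q (r.\<mu> l) = s.\<mu> l"
          using q(2)[of "[l]"] mu r.group_P s.group_P by (simp add: group.axioms(1) monoid.r_one)
        then show ?thesis using H(4)[of True "r.\<mu> l"] mu by simp
      qed
    qed
    show "(if tgt then q else q \<circ> cyc_hom r.P (side True)) \<in> hom (if tgt then r.P else cyc p) s.P" for tgt
      using q(1) sh(1) by (auto intro: hom_compose)
    show "(if True then q else q \<circ> cyc_hom r.P (side True)) (cyc_hom r.P (side e) x) =
         (if False then q else q \<circ> cyc_hom r.P (side True)) x"
      if "x \<in> carrier (if False then r.P else cyc p)" for e x
      using hom_cyc_ext[OF p inf s.group_P hom_compose[OF sh(1) q(1)] hom_compose[OF sh(1) q(1)],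
          of e True x] that sh(2) qside by simp
  qed (use A r r.group_P s.group_P group_cyc[OF p inf] sh in \<open>auto simp: cellular_relation_def\<close>)
  then show ?thesis
    using s.word_congruence_axioms by (simp add: cellular_relation_def)
qed

text \<open>A countable union of sets of relations is imposed by the pushout of all the quotient maps from the
free product.\<close>

lemma cellular_relation_union:
  fixes r :: "'i::countable \<Rightarrow> 'l::countable list \<Rightarrow> 'l list \<Rightarrow> bool"
  assumes r: "\<And>i. cellular_relation TYPE('u) p A (r i)"
  shows "cellular_relation TYPE('u) p A (implied TYPE('u) p (\<lambda>x y. \<exists>i. r i x y))"
proof -
  let ?f = "implied TYPE('u) p (\<lambda>x y :: 'l list. False)"
  let ?s = "implied TYPE('u) p (\<lambda>x y. \<exists>i. r i x y)"
  have wc: "word_congruence p (r i)" for i using r by (simp add: cellular_relation_def)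
  interpret r: word_congruence_in p "r i" "TYPE('u)" for i by (rule wci[OF wc])
  interpret f: word_congruence_in p ?f "TYPE('u)" by (rule wci_implied)
  interpret s: word_congruence_in p ?s "TYPE('u)" by (rule wci_implied)
  have fr: "r i x y" if "?f x y" for i x y
    by (rule implied_least[OF wc _ that]) simp
  have rs: "r i x y \<Longrightarrow> ?s x y" for i x y by (rule implied_incl) blast
  have "\<exists>q. q \<in> hom (r.P i) s.P \<and> (\<forall>w. q (ev (r.P i) (r.\<mu> i) w) = ev s.P s.\<mu> w)" for i
    by (rule r.hom_from_P[OF s.group_P s.mark_closed]) (simp only: s.ev_P_eq_iff rs)
  then obtain q where q: "\<And>i. q i \<in> hom (r.P i) s.P" "\<And>i w. q i (ev (r.P i) (r.\<mu> i) w) = ev s.P s.\<mu> w"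
    by meson
  have "\<exists>t. t \<in> hom f.P (r.P i) \<and> (\<forall>w. t (ev f.P f.\<mu> w) = ev (r.P i) (r.\<mu> i) w)" for i
    by (rule f.hom_from_P[OF r.group_P r.mark_closed]) (simp only: r.ev_P_eq_iff fr)
  then obtain t where t: "\<And>i. t i \<in> hom f.P (r.P i)" "\<And>i w. t i (ev f.P f.\<mu> w) = ev (r.P i) (r.\<mu> i) w"
    by meson
  have "\<exists>q. q \<in> hom f.P s.P \<and> (\<forall>w. q (ev f.P f.\<mu> w) = ev s.P s.\<mu> w)"
    by (rule f.hom_from_P[OF s.group_P s.mark_closed]) (simp only: s.ev_P_eq_iff rs[OF fr])
  then obtain q0 where q0: "q0 \<in> hom f.P s.P" "\<And>w. q0 (ev f.P f.\<mu> w) = ev s.P s.\<mu> w"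
    by blast
  let ?D = "\<lambda>i. case i of None \<Rightarrow> f.P | Some i \<Rightarrow> r.P i"
  let ?\<iota> = "\<lambda>i. case i of None \<Rightarrow> q0 | Some i \<Rightarrow> q i"
  have "cellular_in A s.P"
  proof (rule cellular_in_bipartite_colimit[OF inf, where I = "UNIV :: 'i option set"
        and E = "UNIV :: 'i set" and D = ?D and src = "\<lambda>_. None" and tgt = Some and T = t and \<iota> = ?\<iota>])
    show "?\<iota> i \<in> hom (?D i) s.P" for i
      using q(1) q0(1) by (cases i) auto
    show "?\<iota> (Some e) (t e x) = ?\<iota> None x" if x: "x \<in> carrier (?D None)" for e x
    proof -
      obtain w where "x = ev f.P f.\<mu> w" using x unfolding option.case f.carrier_P' by blast
      then show ?thesis by (simp add: t q q0)
    qed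
    show "\<exists>h\<in>hom s.P H. \<forall>i\<in>UNIV. \<forall>x\<in>carrier (?D i). h (?\<iota> i x) = \<kappa> i x"
      if H: "group H" and \<kappa>: "\<And>i. i \<in> UNIV \<Longrightarrow> \<kappa> i \<in> hom (?D i) H"
        and c: "\<And>e x. e \<in> UNIV \<Longrightarrow> x \<in> carrier (?D None) \<Longrightarrow> \<kappa> (Some e) (t e x) = \<kappa> None x"
      for H :: "'u monoid" and \<kappa>
    proof -
      have k: "\<kappa> None \<in> hom f.P H" "\<And>i. \<kappa> (Some i) \<in> hom (r.P i) H"
        using \<kappa>[of None] \<kappa>[of "Some _"] by auto
      define n where "n l = \<kappa> None (f.\<mu> l)" for l
      have evn: "\<kappa> None (ev f.P f.\<mu> w) = ev H n w" for w
        unfolding n_def by (rule ev_hom[OF f.group_P H k(1) f.mark_closed])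
      have evi: "\<kappa> (Some i) (ev (r.P i) (r.\<mu> i) w) = ev H n w" for i w
        using c[OF UNIV_I, of "ev f.P f.\<mu> w" i] evn[of w] t(2)[of i w]
          monoid.ev_closed[OF group.axioms(1)[OF f.group_P] f.mark_closed] by simp
      have "ev H n x = ev H n y" if "r i x y" for i x y
        using arg_cong[OF r.ev_P_eq_iff[THEN iffD2, OF that], of "\<kappa> (Some i)"] by (simp only: evi)
      moreover have "n l [^]\<^bsub>H\<^esub> p = \<one>\<^bsub>H\<^esub>" "n l \<in> carrier H" for l
      proof -
        interpret k: group_hom f.P H "\<kappa> None"
          using f.group_P H k by (simp add: group_hom_def group_hom_axioms_def)
        have mu: "f.\<mu> l \<in> carrier f.P" using f.mark_closed by blast
        show "n l [^]\<^bsub>H\<^esub> p = \<one>\<^bsub>H\<^esub>" "n l \<in> carrier H"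
          using k.hom_nat_pow[OF mu, of p] f.mark_power[of l] k.hom_closed[OF mu] k.hom_one
          by (simp_all add: n_def)
      qed
      ultimately have mod: "model p (\<lambda>x y. \<exists>i. r i x y) H n"
        using H by (auto simp: model_def)
      obtain h where h: "h \<in> hom s.P H" "\<And>w. h (ev s.P s.\<mu> w) = ev H n w"
        using s.hom_from_P[of H n] model_implied[OF mod] unfolding model_def by meson
      have "h (q i x) = \<kappa> (Some i) x" if "x \<in> carrier (r.P i)" for i x
        using that q(2) h(2) evi unfolding r.carrier_P' by auto
      moreover have "h (q0 x) = \<kappa> None x" if "x \<in> carrier f.P" for x
        using that q0(2) h(2) evn unfolding f.carrier_P' by auto
      ultimately show ?thesis using h(1) by (intro bexI[of _ h]) (auto split: option.splits)
    qed
    show "\<forall>y\<in>carrier s.P. h y = h' y"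
      if H: "group H" "h \<in> hom s.P H" "h' \<in> hom s.P H"
        "\<And>i x. i \<in> UNIV \<Longrightarrow> x \<in> carrier (?D i) \<Longrightarrow> h (?\<iota> i x) = h' (?\<iota> i x)"
      for H :: "'u monoid" and h h'
    proof (rule s.hom_from_P_unique[OF H(1-3)])
      show "h (s.\<mu> l) = h' (s.\<mu> l)" for l
      proof -
        have mu: "f.\<mu> l \<in> carrier f.P" "s.\<mu> l \<in> carrier s.P"
          using f.mark_closed s.mark_closed by blast+
        have "q0 (f.\<mu> l) = s.\<mu> l"
          using q0(2)[of "[l]"] mu f.group_P s.group_P by (simp add: group.axioms(1) monoid.r_one)
        then show ?thesis using H(4)[of None "f.\<mu> l"] mu by simp
      qed
    qed
  qed (use r cellular_relation_free_product f.group_P r.group_P s.group_P t in \<open>auto simp: cellular_relation_def split: option.splits\<close>)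
  then show ?thesis
    using s.word_congruence_axioms by (simp add: cellular_relation_def)
qed

end

text \<open>By the preceding lemmas the cellular relations that hold in \<open>G\<close> have a largest element: for each of
the countably many pairs of words choose a cellular relation containing it, if there is one, and
take the union of the chosen ones. In the group \<open>E\<close> that it presents, two words with trivial
\<open>p\<close>-th powers that agree in \<open>G\<close> must already agree, for otherwise a coequalizer would yield a
larger relation. So \<open>E\<close> satisfies the assumptions of the hypothesis called \<open>rigid\<close>, and that
hypothesis says that \<open>E\<close> is \<open>G\<close>.\<close>

theorem cellular_if_rigid:
  fixes G :: "'g monoid" and g :: "'l::countable \<Rightarrow> 'g"
  assumes p: "1 < p" and inf: "infinite (UNIV :: 'u set)"
    and G: "group G" and gG: "range g \<subseteq> carrier G" and gen: "carrier G = range (ev G g)"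
    and tors: "\<And>l. g l [^]\<^bsub>G\<^esub> p = \<one>\<^bsub>G\<^esub>"
    and rigid: "\<And>(E :: 'u monoid) m u v. group E \<Longrightarrow> range m \<subseteq> carrier E \<Longrightarrow>
        (\<And>l. m l [^]\<^bsub>E\<^esub> p = \<one>\<^bsub>E\<^esub>) \<Longrightarrow>
        (\<And>u v. ev E m u = ev E m v \<Longrightarrow> ev G g u = ev G g v) \<Longrightarrow>
        (\<And>u v. ev E m u [^]\<^bsub>E\<^esub> p = \<one>\<^bsub>E\<^esub> \<Longrightarrow> ev E m v [^]\<^bsub>E\<^esub> p = \<one>\<^bsub>E\<^esub> \<Longrightarrow>
           ev G g u = ev G g v \<Longrightarrow> ev E m u = ev E m v) \<Longrightarrow>
        ev G g u = ev G g v \<Longrightarrow> ev E m u = ev E m v"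
  shows "cellular TYPE('u) (integer_mod_group p) G"
proof -
  have A: "cellular_in (integer_mod_group p) (cyc p :: 'u monoid)"
    by (rule cellular_in.base[OF group_cyc[OF p inf] is_isoI[OF cyc_iso[OF p inf]]])
  define K where "K = (\<lambda>u v. ev G g u = ev G g v)"
  have K: "word_congruence p K"
    unfolding K_def by (rule word_congruence_model) (use p G gG tors in \<open>simp_all add: model_def\<close>)
  note goodI = cellular_relation_free_product[OF p inf A] cellular_relation_coequalizer[OF p inf A] cellular_relation_union[OF p inf A]
  define ok where "ok = (\<lambda>r :: 'l list \<Rightarrow> _. cellular_relation TYPE('u) p (integer_mod_group p) r \<and> (\<forall>u v. r u v \<longrightarrow> K u v))"
  have weqK: "K u v" if "\<And>x y. R x y \<Longrightarrow> K x y" "implied TYPE('u) p R u v" for R u v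
    by (rule implied_least[OF p inf A K that])
  have ok0: "ok (implied TYPE('u) p (\<lambda>x y. False))"
    unfolding ok_def using goodI(1) weqK[of "\<lambda>x y. False"] by simp
  have "\<exists>s. ok s \<and> ((\<exists>t. ok t \<and> t (fst w) (snd w)) \<longrightarrow> s (fst w) (snd w))" for w
    using ok0 by meson
  \<comment> \<open>A cellular relation is chosen for every pair of words; there are countably many pairs.\<close>
  then obtain f where f: "\<And>w. ok (f w)" "\<And>w t. ok t \<Longrightarrow> t (fst w) (snd w) \<Longrightarrow> f w (fst w) (snd w)"
    by metis
  define r where "r = implied TYPE('u) p (\<lambda>x y. \<exists>w. f w x y)"
  have "cellular_relation TYPE('u) p (integer_mod_group p) r"
    unfolding r_def using f(1) by (intro goodI(3)) (simp add: ok_def)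
  moreover have rK: "K u v" if "r u v" for u v
    using f(1) weqK[OF _ that[unfolded r_def]] by (auto simp: ok_def)
  ultimately have ok: "ok r" by (simp add: ok_def)
  have max: "r u v" if "ok s" "s u v" for s u v
    unfolding r_def by (rule implied_incl, rule exI[of _ "(u, v)"]) (use f(2)[of s "(u, v)"] that in simp)
  have wc: "word_congruence p r" using ok by (simp add: ok_def cellular_relation_def)
  interpret r: word_congruence_in p r "TYPE('u)" by (rule wci[OF p inf A wc])
  interpret k: word_congruence_in p K "TYPE('u)" by (rule wci[OF p inf A K])
  have pw: "ev r.P r.\<mu> u [^]\<^bsub>r.P\<^esub> p = \<one>\<^bsub>r.P\<^esub> \<longleftrightarrow> r (concat (replicate p u)) []" for u
  proof -
    have "ev r.P r.\<mu> u [^]\<^bsub>r.P\<^esub> p = \<one>\<^bsub>r.P\<^esub> \<longleftrightarrow>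
        ev r.P r.\<mu> (concat (replicate p u)) = ev r.P r.\<mu> []"
      using r.group_P r.mark_closed by (simp add: monoid.ev_replicate group.axioms(1))
    then show ?thesis by (simp only: r.ev_P_eq_iff)
  qed
  have Kr: "r u v" if "K u v" for u v
  proof (rule r.ev_P_eq_iff[THEN iffD1], rule rigid[OF r.group_P r.mark_closed r.mark_power])
    show "ev G g u = ev G g v" if "ev r.P r.\<mu> u = ev r.P r.\<mu> v" for u v
      using that rK unfolding r.ev_P_eq_iff K_def by blast
    show "ev r.P r.\<mu> u = ev r.P r.\<mu> v"
      if "ev r.P r.\<mu> u [^]\<^bsub>r.P\<^esub> p = \<one>\<^bsub>r.P\<^esub>" "ev r.P r.\<mu> v [^]\<^bsub>r.P\<^esub> p = \<one>\<^bsub>r.P\<^esub>"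
        and uv: "ev G g u = ev G g v" for u v
    proof -
      let ?s = "implied TYPE('u) p (\<lambda>x y. r x y \<or> x = u \<and> y = v)"
      have "cellular_relation TYPE('u) p (integer_mod_group p) ?s"
        using that ok unfolding pw by (intro goodI(2)) (simp_all add: ok_def)
      moreover have "K x y" if "?s x y" for x y
        by (rule weqK[OF _ that]) (use rK uv in \<open>auto simp: K_def\<close>)
      ultimately have "ok ?s" by (simp add: ok_def)
      then show ?thesis
        unfolding r.ev_P_eq_iff by (rule max) (rule implied_incl, simp)
    qed
    show "ev G g u = ev G g v" using that by (simp add: K_def)
  qed
  then have "r = K" using rK by blast
  then have "cellular_in (integer_mod_group p) k.P"
    using ok by (simp add: ok_def cellular_relation_def)
  moreover have "G \<cong> k.P"
  proof -
    obtain h where h: "h \<in> hom k.P G" "\<And>w. h (ev k.P k.\<mu> w) = ev G g w"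
      using k.hom_from_P[OF G gG] by (auto simp: K_def)
    have "inj_on h (carrier k.P)"
    proof (rule inj_onI)
      fix x y assume x: "x \<in> carrier k.P" and y: "y \<in> carrier k.P" and e: "h x = h y"
      obtain u v where "x = ev k.P k.\<mu> u" "y = ev k.P k.\<mu> v"
        using x y unfolding k.carrier_P' by blast
      then show "x = y" using e h(2) k.ev_P_eq_iff[of u v] by (simp add: K_def)
    qed
    moreover have "h ` carrier k.P = carrier G"
      unfolding k.carrier_P' gen by (simp add: image_image h(2))
    ultimately have "h \<in> iso k.P G"
      using h(1) by (simp add: iso_def bij_betw_def)
    then show ?thesis
      using k.group_P group.iso_sym is_isoI by blast
  qed
  ultimately show ?thesis unfolding cellular_def by blast
qed

section \<open>Normal sets of words\<close>

definition winv :: "('x \<Rightarrow> 'x) \<Rightarrow> 'x list \<Rightarrow> 'x list" where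
  "winv bar w = rev (map bar w)"

lemma winv_simps [simp]:
  "winv bar [] = []" "winv bar (x # w) = winv bar w @ [bar x]" "winv bar (u @ v) = winv bar v @ winv bar u"
  by (simp_all add: winv_def)

text \<open>A set of words closed like a normal subgroup of the free group on letters with a formal inverse
\<open>bar\<close>, or of a free product of groups of order 2 when \<open>bar\<close> is the identity: \<open>cancel\<close> says that
membership depends only on the element of that group. Working with such sets of words replaces
arguments about generators of subgroups and quotients.\<close>

locale normal_words =
  fixes bar :: "'x \<Rightarrow> 'x" and N :: "'x list \<Rightarrow> bool"
  assumes bar_bar [simp]: "bar (bar x) = x"
    and empty: "N []"
    and app: "N u \<Longrightarrow> N v \<Longrightarrow> N (u @ v)"
    and winv: "N u \<Longrightarrow> N (winv bar u)"
    and conj: "N u \<Longrightarrow> N (x # u @ [bar x])"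
    and cancel: "N (u @ x # bar x # v) \<longleftrightarrow> N (u @ v)"
begin

lemma cancel_word: "N (u @ w @ winv bar w @ v) \<longleftrightarrow> N (u @ v)"
proof (induction w arbitrary: u v)
  case (Cons x w)
  have "N ((u @ [x]) @ w @ winv bar w @ (bar x # v)) \<longleftrightarrow> N ((u @ [x]) @ bar x # v)"
    by (rule Cons)
  then show ?case by (simp add: cancel)
qed simp

lemma cancel_word': "N (u @ winv bar w @ w @ v) \<longleftrightarrow> N (u @ v)"
proof (induction w arbitrary: u v)
  case (Cons x w)
  have "N (u @ winv bar w @ bar x # bar (bar x) # w @ v) \<longleftrightarrow> N ((u @ winv bar w) @ w @ v)"
    using cancel[of "u @ winv bar w" "bar x" "w @ v"] by simp
  then show ?case using Cons by simp
qed simp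

text \<open>Commutators of a letter with a word are products of conjugates of commutators of letters.\<close>

lemma commutator_word:
  assumes comm: "\<And>x y. N [x, y, bar x, bar y]"
  shows "N (x # u @ bar x # winv bar u)"
proof (induction u)
  case Nil
  show ?case using cancel[of "[]" x "[]"] empty by simp
next
  case (Cons y u)
  have "N ([x, y, bar x, bar y] @ (y # (x # u @ bar x # winv bar u) @ [bar y]))"
    by (intro app comm conj Cons)
  then have "N ([x, y] @ u @ bar x # winv bar u @ [bar y])"
    using cancel[of "[x, y, bar x]" "bar y"] cancel[of "[x, y]" "bar x"] by simp
  then show ?case by simp
qed

text \<open>Modulo a normal subgroup that contains the commutators of the generators the group is abelian, so
that words with zero exponent sums become trivial. A first letter \<open>x\<close> of such a word is moved to the
place of some later inverse of \<open>x\<close> at the cost of a commutator.\<close>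

lemma balanced_word:
  assumes comm: "\<And>x y. N [x, y, bar x, bar y]" and ne: "\<And>x. bar x \<noteq> x"
    and "\<And>x. count_list w x = count_list w (bar x)"
  shows "N w"
  using assms(3)
proof (induction "length w" arbitrary: w rule: less_induct)
  case less
  show ?case
  proof (cases w)
    case Nil
    then show ?thesis by (simp add: empty)
  next
    case (Cons x w')
    have "count_list w (bar x) > 0"
      using less.prems[of x] Cons by simp
    then have "bar x \<in> set w'"
      using Cons ne[of x] by (metis count_list.simps(2) count_notin less_numeral_extra(3))
    then obtain u v where w': "w' = u @ bar x # v"
      by (meson split_list)
    have inj: "bar x = bar y \<longleftrightarrow> x = y" for y
      by (metis bar_bar)
    have "count_list (u @ v) y = count_list (u @ v) (bar y)" for y
      using inj[of y] less.prems[of y] ne[of x] ne[of y] Cons w' by (auto split: if_splits)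
    then have "N (u @ v)"
      using less.hyps[of "u @ v"] Cons w' by simp
    then have "N ((x # u @ bar x # winv bar u) @ u @ v)"
      using app commutator_word[OF comm] by blast
    then show ?thesis
      using cancel_word'[of "x # u @ [bar x]" u v] Cons w' by simp
  qed
qed

end

lemma normal_words_hom:
  assumes N: "normal_words bar N" and bar: "\<And>x. bar' (bar' x) = x"
    and hom: "h [] = []" "\<And>u v. h (u @ v) = h u @ h v" "\<And>w. h (winv bar' w) = winv bar (h w)"
  shows "normal_words bar' (\<lambda>w. N (h w))"
proof -
  interpret normal_words bar N by fact
  have hb: "h [bar' x] = winv bar (h [x])" for x
    using hom(3)[of "[x]"] by simp
  have hc: "h (x # w) = h [x] @ h w" for x w
    using hom(2)[of "[x]" w] by simp
  have cw: "N (w @ v @ winv bar w)" if "N v" for w v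
    using that
  proof (induction w)
    case (Cons y w)
    then show ?case using conj[of "w @ v @ winv bar w" y] by simp
  qed simp
  show ?thesis
  proof
    show "N (h (x # u @ [bar' x]))" if "N (h u)" for x u
      using cw[OF that, of "h [x]"] by (simp only: hc[of x "u @ [bar' x]"] hom(2) hb)
    show "N (h (u @ x # bar' x # v)) = N (h (u @ v))" for u x v
      using cancel_word[of "h u" "h [x]" "h v"]
      by (simp only: hc[of x "bar' x # v"] hc[of "bar' x" v] hom(2) hb append_assoc)
  qed (use empty app winv hom bar in auto)
qed

subsection \<open>The dihedral group of order 8\<close>

text \<open>The two reflections that generate the symmetry group of a square, acting on its four vertices.\<close>

fun swap8 :: "bool \<times> bool \<Rightarrow> bool \<times> bool" where "swap8 (x, y) = (y, x)"
fun neg8 :: "bool \<times> bool \<Rightarrow> bool \<times> bool" where "neg8 (x, y) = (\<not> x, y)"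

lemma swap8_swap8 [simp]: "swap8 (swap8 z) = z" and neg8_neg8 [simp]: "neg8 (neg8 z) = z"
  by (cases z; simp)+

definition act_word :: "('x \<Rightarrow> 'y \<Rightarrow> 'y) \<Rightarrow> 'x list \<Rightarrow> 'y \<Rightarrow> 'y" where
  "act_word \<tau> w = foldr (\<lambda>x f. \<tau> x \<circ> f) w id"

lemma act_word_simps [simp]:
  "act_word \<tau> [] = id" "act_word \<tau> (x # w) = \<tau> x \<circ> act_word \<tau> w"
  by (simp_all add: act_word_def)

lemma act_word_append [simp]: "act_word \<tau> (u @ v) = act_word \<tau> u \<circ> act_word \<tau> v"
  by (induction u) (simp_all add: comp_assoc)

text \<open>If letters are trivial or equal to \<open>\<alpha>\<close> or \<open>\<delta>\<close> modulo \<open>N\<close>, the quotient by \<open>N\<close> is generated by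
two involutions, and by \<open>pow\<close> it is a quotient of the dihedral group of order 8. Hence every word
that is trivial in the dihedral group lies in \<open>N\<close>. The proof brings words into one of the eight
normal forms \<open>\<delta>\<^sup>i (\<alpha>\<delta>\<alpha>)\<^sup>j \<alpha>\<^sup>k\<close>.\<close>

lemma dihedral_words:
  assumes N: "normal_words (\<lambda>x. x) N"
    and \<tau>: "\<And>x. (\<tau> x = id \<and> N [x]) \<or> (\<tau> x = swap8 \<and> N [x, \<alpha>]) \<or> (\<tau> x = neg8 \<and> N [x, \<delta>])"
    and pow: "N [\<alpha>, \<delta>, \<alpha>, \<delta>, \<alpha>, \<delta>, \<alpha>, \<delta>]"
    and w: "act_word \<tau> w = id"
  shows "N w"
proof -
  interpret normal_words "\<lambda>x. x" N by fact
  have c0: "N (x # x # v) = N v" for x v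
    using cancel[of "[]" x v] by simp
  have c1: "N (y1 # x # x # v) = N (y1 # v)" for x v y1
    using cancel[of "[y1]" x v] by simp
  have c2: "N (y1 # y2 # x # x # v) = N (y1 # y2 # v)" for x v y1 y2
    using cancel[of "[y1, y2]" x v] by simp
  have c3: "N (y1 # y2 # y3 # x # x # v) = N (y1 # y2 # y3 # v)" for x v y1 y2 y3
    using cancel[of "[y1, y2, y3]" x v] by simp
  have c4: "N (y1 # y2 # y3 # y4 # x # x # v) = N (y1 # y2 # y3 # y4 # v)" for x v y1 y2 y3 y4
    using cancel[of "[y1, y2, y3, y4]" x v] by simp
  have c5: "N (y1 # y2 # y3 # y4 # y5 # x # x # v) = N (y1 # y2 # y3 # y4 # y5 # v)" for x v y1 y2 y3 y4 y5
    using cancel[of "[y1, y2, y3, y4, y5]" x v] by simp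
  define normal_form where "normal_form i j k = (if i then [\<delta>] else []) @ (if j then [\<alpha>, \<delta>, \<alpha>] else []) @
      (if k then [\<alpha>] else [])" for i j k
  define val where "val i j k = (if i then neg8 else id) \<circ> (if j then swap8 \<circ> neg8 \<circ> swap8 else id) \<circ>
      (if k then swap8 else id)" for i j k
  have rev: "winv (\<lambda>x. x) v = rev v" for v :: "'a list"
    by (simp add: winv_def)
  have trans: "N (u @ rev w)" if "N (u @ rev v)" "N (v @ rev w)" for u v w
    using app[OF that] cancel_word'[of u v "rev w"] by (simp add: rev)
  \<comment> \<open>Multiplication by a generator permutes the normal forms; only here the relation \<open>pow\<close> enters.\<close>
  have step\<delta>: "N ((\<delta> # normal_form i j k) @ rev (normal_form (\<not> i) j k))" for i j k
    using empty by (simp add: normal_form_def c0 c1 c2 c3 c4 c5)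
  have step\<alpha>: "N ((\<alpha> # normal_form i j k) @ rev (normal_form j i (\<not> k)))" for i j k
    using empty pow by (simp add: normal_form_def c0 c1 c2 c3 c4 c5)
  have val\<delta>: "neg8 \<circ> val i j k = val (\<not> i) j k" for i j k
    by (auto simp: val_def fun_eq_iff)
  have val\<alpha>: "swap8 \<circ> val i j k = val j i (\<not> k)" for i j k
    by (auto simp: val_def fun_eq_iff)
  have "\<exists>i j k. N (w @ rev (normal_form i j k)) \<and> act_word \<tau> w = val i j k" for w
  proof (induction w)
    case Nil
    show ?case
      by (intro exI[of _ False]) (simp add: normal_form_def val_def empty)
  next
    case (Cons x w)
    then obtain i j k where ijk: "N (w @ rev (normal_form i j k))" "act_word \<tau> w = val i j k"
      by blast
    have *: "N ((x # w) @ rev (x # normal_form i j k))"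
      using conj[OF ijk(1), of x] by simp
    have **: "N ((x # normal_form i j k) @ rev (y # normal_form i j k)) = N [x, y]" for y
      using cancel_word[of "[x]" "normal_form i j k" "[y]"] by (simp add: rev)
    from \<tau>[of x] show ?case
    proof (elim disjE conjE)
      assume "\<tau> x = id" "N [x]"
      moreover have "N ((x # normal_form i j k) @ rev (normal_form i j k)) = N [x]"
        using cancel_word[of "[x]" "normal_form i j k" "[]"] by (simp add: rev)
      ultimately show ?thesis
        using trans[OF *] ijk(2) by auto
    next
      assume "\<tau> x = swap8" "N [x, \<alpha>]"
      then show ?thesis
        using trans[OF trans[OF *] step\<alpha>] ** ijk(2) val\<alpha> by (metis act_word_simps(2))
    next
      assume "\<tau> x = neg8" "N [x, \<delta>]"
      then show ?thesis
        using trans[OF trans[OF *] step\<delta>] ** ijk(2) val\<delta> by (metis act_word_simps(2))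
    qed
  qed
  then obtain i j k where ijk: "N (w @ rev (normal_form i j k))" "val i j k = id"
    using w by metis
  \<comment> \<open>The images of two vertices distinguish the eight normal forms.\<close>
  have "val i j k (False, True) = (False, True)" "val i j k (False, False) = (False, False)"
    using ijk(2) by simp_all
  then have "\<not> i \<and> \<not> j \<and> \<not> k"
    by (auto simp: val_def split: if_splits)
  then show ?thesis using ijk(1) by (simp add: normal_form_def)
qed

subsection \<open>Evaluation in a group with inverse letters\<close>

text \<open>Generators of \<open>E\<close> marked by letters such that formal inverses go to inverses.\<close>

locale word_eval = group E for E (structure) +
  fixes bar :: "'l \<Rightarrow> 'l" and m :: "'l \<Rightarrow> 'e"
  assumes m_closed [simp]: "m x \<in> carrier E"
    and m_bar: "m (bar x) = inv m x"
begin

abbreviation e :: "'l list \<Rightarrow> 'e" where "e w \<equiv> ev E m w"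

lemma e_closed [simp]: "e w \<in> carrier E"
  by (rule ev_closed) auto

lemma e_append: "e (u @ v) = e u \<otimes> e v"
  by (rule ev_append) auto

lemma e_winv: "e (winv bar w) = inv e w"
  by (induction w) (simp_all add: e_append m_bar inv_mult_group)

end

lemma (in group) cancel_simps [simp]:
  "x \<in> carrier G \<Longrightarrow> y \<in> carrier G \<Longrightarrow> inv x \<otimes> (x \<otimes> y) = y"
  "x \<in> carrier G \<Longrightarrow> y \<in> carrier G \<Longrightarrow> x \<otimes> (inv x \<otimes> y) = y"
  by (simp_all flip: m_assoc)

context group
begin

lemma commute_conj:
  assumes "t \<in> carrier G" "x \<in> carrier G" "z \<in> carrier G"
    and "x \<otimes> (inv t \<otimes> (z \<otimes> t)) = (inv t \<otimes> (z \<otimes> t)) \<otimes> x"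
  shows "(t \<otimes> (x \<otimes> inv t)) \<otimes> z = z \<otimes> (t \<otimes> (x \<otimes> inv t))"
proof -
  have "t \<otimes> (x \<otimes> (inv t \<otimes> (z \<otimes> t))) \<otimes> inv t = t \<otimes> ((inv t \<otimes> (z \<otimes> t)) \<otimes> x) \<otimes> inv t"
    by (simp only: assms(4))
  then show ?thesis
    using assms(1-3) by (simp add: m_assoc)
qed

lemma commute_inv:
  assumes "x \<in> carrier G" "z \<in> carrier G" "x \<otimes> z = z \<otimes> x"
  shows "inv x \<otimes> z = z \<otimes> inv x"
proof -
  have "inv x \<otimes> (x \<otimes> z) \<otimes> inv x = inv x \<otimes> (z \<otimes> x) \<otimes> inv x"
    by (simp only: assms(3))
  then show ?thesis using assms(1,2) by (simp add: m_assoc)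
qed

end

text \<open>The centraliser of a set \<open>Z\<close> is normalised by every subgroup that normalises \<open>Z\<close>. Here that subgroup
is generated by the values of the words \<open>h [x]\<close>.\<close>

lemma (in word_eval) normal_centralizing:
  assumes bar': "\<And>x. bar' (bar' x) = x"
    and h: "h [] = []" "\<And>u v. h (u @ v) = h u @ h v" "\<And>w. h (winv bar' w) = winv bar (h w)"
    and Z: "Z \<subseteq> carrier E" "\<And>x z. z \<in> Z \<Longrightarrow> inv e (h [x]) \<otimes> (z \<otimes> e (h [x])) \<in> Z"
  shows "normal_words bar' (\<lambda>w. \<forall>z\<in>Z. e (h w) \<otimes> z = z \<otimes> e (h w))"
proof -
  have Zc [simp]: "z \<in> carrier E" if "z \<in> Z" for z using that Z(1) by blast
  have inv_h: "e (h (winv bar' w)) = inv e (h w)" for w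
    by (simp add: h(3) e_winv)
  have hx: "e (h (x # w)) = e (h [x]) \<otimes> e (h w)" for x w
    using h(2)[of "[x]" w] by (simp add: e_append)
  have hbar: "e (h [bar' x]) = inv e (h [x])" for x
    using inv_h[of "[x]"] by simp
  show ?thesis
  proof
    show "\<forall>z\<in>Z. e (h (u @ v)) \<otimes> z = z \<otimes> e (h (u @ v))"
      if uv: "\<forall>z\<in>Z. e (h u) \<otimes> z = z \<otimes> e (h u)" "\<forall>z\<in>Z. e (h v) \<otimes> z = z \<otimes> e (h v)" for u v
    proof
      fix z assume z: "z \<in> Z"
      have "e (h (u @ v)) \<otimes> z = (e (h u) \<otimes> z) \<otimes> e (h v)"
        using uv(2) z by (simp add: h(2) e_append m_assoc)
      then show "e (h (u @ v)) \<otimes> z = z \<otimes> e (h (u @ v))"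
        using uv(1) z by (simp add: h(2) e_append m_assoc)
    qed
    show "\<forall>z\<in>Z. e (h (x # u @ [bar' x])) \<otimes> z = z \<otimes> e (h (x # u @ [bar' x]))"
      if u: "\<forall>z\<in>Z. e (h u) \<otimes> z = z \<otimes> e (h u)" for x u
    proof
      fix z assume z: "z \<in> Z"
      have "e (h (x # u @ [bar' x])) = e (h [x]) \<otimes> (e (h u) \<otimes> inv e (h [x]))"
        by (simp only: hx[of x "u @ [bar' x]"] h(2) e_append hbar)
      then show "e (h (x # u @ [bar' x])) \<otimes> z = z \<otimes> e (h (x # u @ [bar' x]))"
        using commute_conj[of "e (h [x])" "e (h u)" z] u Z(2)[OF z, of x] z by simp
    qed
    show "(\<forall>z\<in>Z. e (h (u @ x # bar' x # v)) \<otimes> z = z \<otimes> e (h (u @ x # bar' x # v))) \<longleftrightarrow>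
        (\<forall>z\<in>Z. e (h (u @ v)) \<otimes> z = z \<otimes> e (h (u @ v)))" for u x v
      by (simp add: h(2) e_append hx[of x "bar' x # v"] hx[of "bar' x" v] hbar)
  qed (simp_all add: bar' h(1) inv_h commute_inv)
qed

text \<open>If elements with trivial \<open>p\<close>-th power are determined by their images under \<open>\<tau>\<close>, then a conjugate of
a generator by an element of the kernel of \<open>\<tau>\<close> is that generator. So the kernel is central.\<close>

lemma (in word_eval) relator_central:
  assumes p: "\<And>x. m x [^] (p::nat) = \<one>"
    and uniq: "\<And>u v. e u [^] p = \<one> \<Longrightarrow> e v [^] p = \<one> \<Longrightarrow> act_word \<tau> u = act_word \<tau> v \<Longrightarrow> e u = e v"
    and w: "act_word \<tau> w = id" "act_word \<tau> (winv bar w) = id"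
  shows "e w \<otimes> e v = e v \<otimes> e w"
proof -
  have cm: "e w \<otimes> m x = m x \<otimes> e w" for x
  proof -
    have conj: "e (winv bar w @ [x] @ w) = inv e w \<otimes> (m x \<otimes> e w)"
      by (simp add: e_append e_winv)
    have "(inv e w \<otimes> (m x \<otimes> e w)) [^] n = inv e w \<otimes> (m x [^] n \<otimes> e w)" for n :: nat
      by (induction n) (simp_all add: m_assoc)
    then have "e (winv bar w @ [x] @ w) = e [x]"
      using w p by (intro uniq) (simp_all add: conj del: append.simps)
    then have "e w \<otimes> (inv e w \<otimes> (m x \<otimes> e w)) = e w \<otimes> m x"
      by (simp only: conj) simp
    then show ?thesis by simp
  qed
  show ?thesis
  proof (induction v)
    case (Cons x v)
    have "e w \<otimes> (m x \<otimes> e v) = (m x \<otimes> e w) \<otimes> e v"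
      by (simp flip: m_assoc cm)
    then show ?case by (simp add: Cons m_assoc)
  qed simp
qed

lemma ev_subgroup_generated: "ev (subgroup_generated T H) g w = ev T g w"
  by (induction w) simp_all

lemma carrier_subgroup_generated_words:
  assumes "word_eval T bar g"
  shows "carrier (subgroup_generated T (range g)) = range (ev T g)"
proof -
  interpret word_eval T bar g by fact
  have "range g \<subseteq> carrier T" by auto
  then have incl: "range g \<subseteq> carrier (subgroup_generated T (range g))"
    by (rule subgroup_generated_subset_carrier_subset)
  have sub: "subgroup (range e) T"
  proof
    show "x \<otimes>\<^bsub>T\<^esub> y \<in> range e" if "x \<in> range e" "y \<in> range e" for x y
      using that by (auto simp flip: e_append)
    show "\<one>\<^bsub>T\<^esub> \<in> range e"
      by (rule range_eqI[of _ _ "[]"]) simp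
    show "inv\<^bsub>T\<^esub> x \<in> range e" if "x \<in> range e" for x
      using that by (auto simp flip: e_winv)
  qed auto
  have "g x \<in> range e" for x
    by (rule range_eqI[of _ _ "[x]"]) simp
  then have "carrier (subgroup_generated T (range g)) \<subseteq> range e"
    by (intro subgroup_generated_minimal[OF sub]) blast
  moreover have "range e \<subseteq> carrier (subgroup_generated T (range g))"
    using monoid.ev_closed[OF group.axioms(1)[OF group_subgroup_generated] incl]
    by (auto simp: ev_subgroup_generated)
  ultimately show ?thesis by blast
qed

section \<open>Relations of the first Grigorchuk group\<close>

text \<open>The constructor \<open>S\<close> collects the three letters that fix the first level of the tree. A pair \<open>(s, l)\<close>
stands for \<open>l\<close> if \<open>s\<close> is false and for the conjugate \<open>a l a\<close> if \<open>s\<close> is true; words in such pairs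
describe the stabiliser of the first level, and below they are denoted by Greek letters.\<close>

datatype bcd = B | C | D
datatype grig_letter = A | S bcd

fun grig_act :: "grig_letter \<Rightarrow> bool list \<Rightarrow> bool list" where
  "grig_act A = grig_a"
| "grig_act (S B) = grig_b"
| "grig_act (S C) = grig_c"
| "grig_act (S D) = grig_d"

text \<open>Relators are the words that act trivially on the tree, that is, the relations of the Grigorchuk
group.\<close>

definition grig_relator :: "grig_letter list \<Rightarrow> bool" where
  "grig_relator w \<longleftrightarrow> act_word grig_act w = id"

fun sec_same :: "bcd \<Rightarrow> grig_letter list" where
  "sec_same B = [A]" | "sec_same C = [A]" | "sec_same D = []"

fun sec_other :: "bcd \<Rightarrow> grig_letter list" where
  "sec_other B = [S C]" | "sec_other C = [S D]" | "sec_other D = [S B]"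

text \<open>The action of a word in conjugates on the subtree at \<open>x\<close>. The letter \<open>(s, l)\<close> acts on one of the two
subtrees by \<open>a\<close> or trivially, and on the other one by the letter that follows \<open>l\<close> in the cycle
\<open>b, c, d\<close>.\<close>

definition grig_section :: "bool \<Rightarrow> (bool \<times> bcd) list \<Rightarrow> grig_letter list" where
  "grig_section x \<xi> = concat (map (\<lambda>(s, l). if x = s then sec_same l else sec_other l) \<xi>)"

definition grig_expand :: "(bool \<times> bcd) list \<Rightarrow> grig_letter list" where
  "grig_expand \<xi> = concat (map (\<lambda>(s, l). if s then [A, S l, A] else [S l]) \<xi>)"

text \<open>Rewrites a word into conjugates by pushing all letters \<open>a\<close> to the right; \<open>s\<close> records the parity of the
letters \<open>a\<close> passed so far.\<close>

fun grig_collect :: "bool \<Rightarrow> grig_letter list \<Rightarrow> (bool \<times> bcd) list" where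
  "grig_collect s [] = []"
| "grig_collect s (A # w) = grig_collect (\<not> s) w"
| "grig_collect s (S l # w) = (s, l) # grig_collect s w"

text \<open>This is Lysenok's substitution \<open>a \<mapsto> aca, b \<mapsto> d, c \<mapsto> b, d \<mapsto> c\<close>. The resulting word has the section \<open>w\<close>
at the right subtree, literally as a word; its section at the left subtree, called the shadow of
\<open>w\<close>, is a word in \<open>a\<close> and \<open>d\<close> only, which generate a dihedral group of order 8.\<close>

fun grig_lift :: "grig_letter \<Rightarrow> (bool \<times> bcd) list" where
  "grig_lift A = [(True, C)]"
| "grig_lift (S B) = [(False, D)]"
| "grig_lift (S C) = [(False, B)]"
| "grig_lift (S D) = [(False, C)]"

definition grig_subst :: "grig_letter list \<Rightarrow> (bool \<times> bcd) list" where
  "grig_subst w = concat (map grig_lift w)"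

definition mirror :: "(bool \<times> bcd) list \<Rightarrow> (bool \<times> bcd) list" where
  "mirror = map (\<lambda>(s, l). (\<not> s, l))"

definition grig_shadow :: "grig_letter list \<Rightarrow> grig_letter list" where
  "grig_shadow w = grig_section False (grig_subst w)"

text \<open>The quotient of the Grigorchuk group by the normal closure of \<open>b\<close> is dihedral of order 8. The words
that become trivial in it are those whose shadow is a relator.\<close>

fun dihedral_act :: "grig_letter \<Rightarrow> bool \<times> bool \<Rightarrow> bool \<times> bool" where
  "dihedral_act A = swap8" | "dihedral_act (S B) = id" | "dihedral_act (S C) = neg8" | "dihedral_act (S D) = neg8"

definition dihedral_trivial :: "grig_letter list \<Rightarrow> bool" where
  "dihedral_trivial w \<longleftrightarrow> act_word dihedral_act w = id"

lemma grig_section_simps [simp]: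
  "grig_section x [] = []"
  "grig_section x ((s, l) # \<xi>) = (if x = s then sec_same l else sec_other l) @ grig_section x \<xi>"
  "grig_section x (\<xi> @ \<eta>) = grig_section x \<xi> @ grig_section x \<eta>"
  by (simp_all add: grig_section_def)

lemma grig_expand_simps [simp]:
  "grig_expand [] = []"
  "grig_expand ((s, l) # \<xi>) = (if s then [A, S l, A] else [S l]) @ grig_expand \<xi>"
  "grig_expand (\<xi> @ \<eta>) = grig_expand \<xi> @ grig_expand \<eta>"
  by (simp_all add: grig_expand_def)

lemma grig_subst_simps [simp]:
  "grig_subst [] = []" "grig_subst (x # w) = grig_lift x @ grig_subst w" "grig_subst (u @ v) = grig_subst u @ grig_subst v"
  by (simp_all add: grig_subst_def)

lemma mirror_simps [simp]:
  "mirror [] = []" "mirror ((s, l) # \<xi>) = (\<not> s, l) # mirror \<xi>"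
  "mirror (\<xi> @ \<eta>) = mirror \<xi> @ mirror \<eta>"
  by (simp_all add: mirror_def)

lemma grig_section_mirror [simp]: "grig_section x (mirror \<xi>) = grig_section (\<not> x) \<xi>"
  by (induction \<xi>) (auto split: prod.splits)

lemma mirror_mirror [simp]: "mirror (mirror \<xi>) = \<xi>"
  by (induction \<xi>) auto

lemma grig_section_subst [simp]: "grig_section True (grig_subst w) = w"
proof (induction w)
  case (Cons x w)
  then show ?case by (cases x rule: grig_act.cases) auto
qed simp

lemma grig_shadow_simps [simp]:
  "grig_shadow [] = []" "grig_shadow (u @ v) = grig_shadow u @ grig_shadow v"
  "grig_shadow (A # w) = S D # grig_shadow w"
  "grig_shadow (S B # w) = grig_shadow w"
  "grig_shadow (S C # w) = A # grig_shadow w"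
  "grig_shadow (S D # w) = A # grig_shadow w"
  by (simp_all add: grig_shadow_def)

lemma rev_sec [simp]: "rev (sec_same l) = sec_same l" "rev (sec_other l) = sec_other l"
  by (cases l; simp)+

lemma grig_section_rev [simp]: "grig_section x (rev \<xi>) = rev (grig_section x \<xi>)"
  by (induction \<xi>) auto

lemma grig_expand_rev [simp]: "grig_expand (rev \<xi>) = rev (grig_expand \<xi>)"
  by (induction \<xi>) auto

lemma grig_lift_rev [simp]: "rev (grig_lift x) = grig_lift x"
  by (cases x rule: grig_act.cases) auto

lemma grig_subst_rev [simp]: "grig_subst (rev w) = rev (grig_subst w)"
  by (induction w) auto

lemma mirror_rev [simp]: "mirror (rev \<xi>) = rev (mirror \<xi>)"
  by (simp add: mirror_def rev_map)

lemma grig_shadow_rev [simp]: "grig_shadow (rev w) = rev (grig_shadow w)"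
  by (simp add: grig_shadow_def)

lemma grig_act_invol [simp]: "grig_act x (grig_act x w) = w"
  by (cases x rule: grig_act.cases) (simp_all add: grig_a_invol grig_invol)

lemma act_grig_expand: "act_word grig_act (grig_expand \<xi>) (x # t) = x # act_word grig_act (grig_section x \<xi>) t"
proof (induction \<xi>)
  case (Cons y \<xi>)
  obtain s l where [simp]: "y = (s, l)" by (cases y)
  have "act_word grig_act (if s then [A, S l, A] else [S l]) (x # t) =
      x # act_word grig_act (if x = s then sec_same l else sec_other l) t" for t
    by (cases x; cases s; cases l) simp_all
  then show ?case using Cons by simp
qed simp

lemma act_grig_expand_Nil: "act_word grig_act w [] = []"
proof (induction w)
  case (Cons x w)
  then show ?case by (cases x rule: grig_act.cases) simp_all
qed simp

lemma relator_expand_iff: "grig_relator (grig_expand \<xi>) \<longleftrightarrow> grig_relator (grig_section False \<xi>) \<and> grig_relator (grig_section True \<xi>)"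
proof -
  have "grig_relator (grig_expand \<xi>) \<longleftrightarrow> (\<forall>x t. act_word grig_act (grig_expand \<xi>) (x # t) = x # t)"
    by (auto simp: grig_relator_def fun_eq_iff act_grig_expand_Nil) (metis act_grig_expand_Nil list.exhaust)
  also have "\<dots> \<longleftrightarrow> grig_relator (grig_section False \<xi>) \<and> grig_relator (grig_section True \<xi>)"
    by (auto simp: act_grig_expand grig_relator_def fun_eq_iff all_bool_eq)
  finally show ?thesis .
qed

definition odd_a :: "grig_letter list \<Rightarrow> bool" where
  "odd_a w \<longleftrightarrow> odd (count_list w A)"

text \<open>The parity of the letters \<open>a\<close> decides whether the subtrees are exchanged, and the collected word
acts inside them.\<close>

lemma act_grig_collect:
  "act_word grig_act w (x # t) = (x \<noteq> odd_a w) # act_word grig_act (grig_section (x \<noteq> (odd_a w \<noteq> s)) (grig_collect s w)) t"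
proof (induction w arbitrary: s)
  case Nil
  then show ?case by (simp add: odd_a_def)
next
  case (Cons y w)
  show ?case
  proof (cases y)
    case A
    then show ?thesis using Cons[of "\<not> s"] by (auto simp: odd_a_def)
  next
    case (S l)
    show ?thesis
      using Cons[of s] unfolding S by (cases "x \<noteq> odd_a w"; cases s; cases l) (auto simp: odd_a_def)
  qed
qed

lemma grig_relator_not_odd_a: "grig_relator w \<Longrightarrow> \<not> odd_a w"
  using act_grig_collect[of w True "[]" False] by (auto simp: grig_relator_def)

lemma section_of_relator: "grig_relator w \<Longrightarrow> grig_relator (grig_section x (grig_collect False w))"
  using act_grig_collect[of w x _ False] grig_relator_not_odd_a[of w] by (auto simp: grig_relator_def fun_eq_iff)

lemma normal_grig_relator: "normal_words (\<lambda>x. x) grig_relator"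
proof
  show "grig_relator (winv (\<lambda>x. x) w)" if "grig_relator w" for w
  proof -
    have "act_word grig_act (rev w) (act_word grig_act w t) = t" for t
      by (induction w arbitrary: t) simp_all
    then show ?thesis using that by (simp add: grig_relator_def winv_def fun_eq_iff)
  qed
qed (auto simp: grig_relator_def fun_eq_iff)

lemma grig_section_counts:
  "count_list (grig_section x \<xi>) A = count_list \<xi> (x, B) + count_list \<xi> (x, C)"
  "count_list (grig_section x \<xi>) (S B) = count_list \<xi> (\<not> x, D)"
  "count_list (grig_section x \<xi>) (S C) = count_list \<xi> (\<not> x, B)"
proof (induction \<xi>)
  case (Cons y \<xi>)
  obtain s l where y: "y = (s, l)" by (cases y)
  { case 1 show ?case using Cons by (cases l) (auto simp: y) }
  { case 2 show ?case using Cons by (cases l) (auto simp: y) }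
  { case 3 show ?case using Cons by (cases l) (auto simp: y) }
qed simp_all

lemma grig_collect_counts:
  "count_list (grig_collect s w) (False, l) + count_list (grig_collect s w) (True, l) = count_list w (S l)"
  by (induction s w rule: grig_collect.induct) auto

lemma grig_collect_flip: "grig_collect (\<not> s) w = mirror (grig_collect s w)"
  by (induction s w rule: grig_collect.induct) auto

lemma count_mirror: "count_list (mirror \<xi>) (s, l) = count_list \<xi> (\<not> s, l)"
  by (cases s; induction \<xi>) (auto split: if_splits)

text \<open>The dihedral group of order 8 is the semidirect product of the Klein group of sign changes with the
swap, so that triviality in it is a matter of three parities.\<close>

lemma dihedral_act_parity:
  "act_word dihedral_act w (x, y) =
     (let \<xi> = grig_collect False w; q = (\<lambda>s. odd (count_list \<xi> (s, C) + count_list \<xi> (s, D)));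
          (x', y') = (if odd_a w then (y, x) else (x, y))
      in (x' \<noteq> q False, y' \<noteq> q True))"
proof (induction w)
  case Nil
  then show ?case by (simp add: odd_a_def)
next
  case (Cons z w)
  show ?case
  proof (cases z rule: grig_act.cases)
    case 1
    have "grig_collect False (A # w) = mirror (grig_collect False w)"
      using grig_collect_flip[of False w] by simp
    then show ?thesis using Cons 1 by (auto simp: Let_def odd_a_def count_mirror)
  qed (use Cons in \<open>auto simp: Let_def odd_a_def\<close>)
qed

text \<open>The sections of a relator and the sections of these are relators, hence contain an even number of
letters \<open>a\<close>. Letters \<open>a\<close> in sections come from \<open>b\<close> and \<open>c\<close>; letters \<open>b\<close> and \<open>c\<close> in sections come from
\<open>d\<close> and \<open>b\<close>. So in each of the two positions the letters \<open>b\<close>, \<open>c\<close> and \<open>d\<close> occur equally often modulo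
2, which yields the parities for triviality in the dihedral group.\<close>

lemma relator_dihedral_trivial:
  assumes "grig_relator w"
  shows "dihedral_trivial w"
proof -
  define \<xi> where "\<xi> = grig_collect False w"
  have sec: "grig_relator (grig_section x \<xi>)" for x
    unfolding \<xi>_def by (rule section_of_relator[OF assms])
  have a: "even (count_list \<xi> (x, B) + count_list \<xi> (x, C))" for x
    using grig_relator_not_odd_a[OF sec[of x]] by (simp add: odd_a_def grig_section_counts)
  have b: "even (count_list \<xi> (x, D) + count_list \<xi> (x, B))" for x
  proof -
    let ?\<eta> = "grig_collect False (grig_section (\<not> x) \<xi>)"
    have "even (count_list ?\<eta> (y, B) + count_list ?\<eta> (y, C))" for y
      using grig_relator_not_odd_a[OF section_of_relator[OF sec[of "\<not> x"], of y]] by (simp add: odd_a_def grig_section_counts)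
    from this[of False] this[of True]
    have "even (count_list (grig_section (\<not> x) \<xi>) (S B) + count_list (grig_section (\<not> x) \<xi>) (S C))"
      using grig_collect_counts[of False "grig_section (\<not> x) \<xi>" B] grig_collect_counts[of False "grig_section (\<not> x) \<xi>" C]
      by presburger
    then show ?thesis by (simp add: grig_section_counts)
  qed
  have "even (count_list \<xi> (x, C) + count_list \<xi> (x, D))" for x
    using a[of x] b[of x] by presburger
  then show ?thesis
    using grig_relator_not_odd_a[OF assms] by (auto simp: dihedral_trivial_def fun_eq_iff dihedral_act_parity \<xi>_def Let_def)
qed

lemma grig_relator_square: "grig_relator [x, x]"
  by (simp add: grig_relator_def fun_eq_iff)

lemma grig_relator_ad4: "grig_relator [A, S D, A, S D, A, S D, A, S D]"
proof -
  have "grig_relator (grig_expand [(True, D), (False, D), (True, D), (False, D)])"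
    unfolding relator_expand_iff by (simp add: grig_relator_square)
  then show ?thesis by simp
qed

lemma grig_relator_da4: "grig_relator [S D, A, S D, A, S D, A, S D, A]"
proof -
  have "grig_relator (grig_expand [(False, D), (True, D), (False, D), (True, D)])"
    unfolding relator_expand_iff by (simp add: grig_relator_square)
  then show ?thesis by simp
qed

text \<open>The shadow sends \<open>b\<close> to the empty word and identifies \<open>c\<close> with \<open>d\<close>, and \<open>(ad)\<^sup>4\<close> is a relation of the
Grigorchuk group. So the shadow is a homomorphism from the dihedral group of order 8.\<close>

lemma shadow_relator:
  assumes "dihedral_trivial w"
  shows "grig_relator (grig_shadow w)"
proof (rule dihedral_words[where N = "\<lambda>w. grig_relator (grig_shadow w)" and \<tau> = dihedral_act and \<alpha> = A and \<delta> = "S D"])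
  show "normal_words (\<lambda>x. x) (\<lambda>w. grig_relator (grig_shadow w))"
    by (rule normal_words_hom[OF normal_grig_relator]) (simp_all add: winv_def)
  show "(dihedral_act x = id \<and> grig_relator (grig_shadow [x])) \<or> (dihedral_act x = swap8 \<and> grig_relator (grig_shadow [x, A])) \<or>
      (dihedral_act x = neg8 \<and> grig_relator (grig_shadow [x, S D]))" for x
    by (cases x rule: grig_act.cases) (auto simp: grig_relator_def fun_eq_iff grig_a_invol grig_invol)
  show "grig_relator (grig_shadow [A, S D, A, S D, A, S D, A, S D])"
    by (simp add: grig_relator_da4)
qed (use assms in \<open>simp add: dihedral_trivial_def\<close>)

text \<open>Markings by involutions for which values of relators commute with values of words and are not of
order 2. The marked elements need not generate \<open>E\<close>: the same \<open>E\<close> carries many markings, and an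
induction over all of them replaces the construction of new central extensions.\<close>

locale grig_marking = group E for E (structure) +
  fixes m :: "grig_letter \<Rightarrow> 'e"
  assumes m_closed [simp]: "m x \<in> carrier E"
    and m_square [simp]: "m x \<otimes> m x = \<one>"
    and m_bcd: "m (S B) \<otimes> (m (S C) \<otimes> m (S D)) = \<one>"
    and central: "grig_relator w \<Longrightarrow> ev E m w \<otimes> ev E m v = ev E m v \<otimes> ev E m w"
    and no_2_torsion: "grig_relator w \<Longrightarrow> ev E m w \<otimes> ev E m w = \<one> \<Longrightarrow> ev E m w = \<one>"
begin

sublocale word_eval E "\<lambda>x. x" m
  by unfold_locales (simp, rule inv_equality[symmetric], simp_all)

lemma inv_m [simp]: "inv (m x) = m x"
  by (simp add: inv_equality)

lemma m_square' [simp]: "y \<in> carrier E \<Longrightarrow> m x \<otimes> (m x \<otimes> y) = y"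
  by (simp flip: m_assoc)

lemma e_rev: "e (rev w) = inv (e w)"
  using e_winv[of w] by (simp add: winv_def)

lemma m_klein:
  "m (S B) \<otimes> m (S C) = m (S D)" "m (S C) \<otimes> m (S B) = m (S D)"
  "m (S C) \<otimes> m (S D) = m (S B)" "m (S D) \<otimes> m (S C) = m (S B)"
  "m (S B) \<otimes> m (S D) = m (S C)" "m (S D) \<otimes> m (S B) = m (S C)"
proof -
  have 1: "m (S C) \<otimes> m (S D) = m (S B)"
    using arg_cong[OF m_bcd, of "\<lambda>y. m (S B) \<otimes> y"] by simp
  have 2: "m (S D) \<otimes> m (S C) = m (S B)"
    using arg_cong[OF 1, of "\<lambda>y. inv y"] by (simp add: inv_mult_group)
  have 3: "m (S C) \<otimes> m (S B) = m (S D)"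
    by (simp flip: 1)
  have 4: "m (S B) \<otimes> m (S C) = m (S D)"
    using arg_cong[OF 3, of "\<lambda>y. inv y"] by (simp add: inv_mult_group)
  have 5: "m (S D) \<otimes> m (S B) = m (S C)"
    by (simp flip: 2)
  have 6: "m (S B) \<otimes> m (S D) = m (S C)"
    using arg_cong[OF 5, of "\<lambda>y. inv y"] by (simp add: inv_mult_group)
  show "m (S B) \<otimes> m (S C) = m (S D)" "m (S C) \<otimes> m (S B) = m (S D)"
  "m (S C) \<otimes> m (S D) = m (S B)" "m (S D) \<otimes> m (S C) = m (S B)"
  "m (S B) \<otimes> m (S D) = m (S C)" "m (S D) \<otimes> m (S B) = m (S C)"
    using 1 2 3 4 5 6 by simp_all
qed

abbreviation ex where "ex \<xi> \<equiv> e (grig_expand \<xi>)"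

lemma ex_append: "ex (\<xi> @ \<eta>) = ex \<xi> \<otimes> ex \<eta>"
  by (simp add: e_append)

lemma ex_rev: "ex (rev \<xi>) = inv (ex \<xi>)"
  by (simp add: e_rev)

lemma ex_mirror: "ex (mirror \<xi>) = m A \<otimes> (ex \<xi> \<otimes> m A)"
proof (induction \<xi>)
  case (Cons y \<xi>)
  obtain s l where "y = (s, l)" by (cases y)
  then show ?case using Cons by (cases s) (simp_all add: e_append m_assoc)
qed simp

text \<open>The substitution sends relators to relators, so a marking composed with it is again a marking.\<close>

lemma grig_marking_subst: "grig_marking E (\<lambda>x. ex (grig_lift x))"
proof -
  have ev: "ev E (\<lambda>x. ex (grig_lift x)) w = ex (grig_subst w)" for w
    by (induction w) (simp_all add: e_append)
  have rel: "grig_relator (grig_expand (grig_subst w))" if "grig_relator w" for w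
    using shadow_relator[OF relator_dihedral_trivial[OF that]] that by (simp add: relator_expand_iff flip: grig_shadow_def)
  show ?thesis
  proof unfold_locales
    show "ex (grig_lift x) \<otimes> ex (grig_lift x) = \<one>" for x
      by (cases x rule: grig_act.cases) (simp_all add: m_assoc)
    show "ex (grig_lift (S B)) \<otimes> (ex (grig_lift (S C)) \<otimes> ex (grig_lift (S D))) = \<one>"
      by (simp add: m_klein)
    show "ev E (\<lambda>x. ex (grig_lift x)) w \<otimes> ev E (\<lambda>x. ex (grig_lift x)) v =
        ev E (\<lambda>x. ex (grig_lift x)) v \<otimes> ev E (\<lambda>x. ex (grig_lift x)) w" if "grig_relator w" for w v
      unfolding ev by (rule central[OF rel[OF that]])
    show "ev E (\<lambda>x. ex (grig_lift x)) w = \<one>"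
      if "grig_relator w" "ev E (\<lambda>x. ex (grig_lift x)) w \<otimes> ev E (\<lambda>x. ex (grig_lift x)) w = \<one>" for w
      using that no_2_torsion[OF rel] unfolding ev by blast
  qed simp_all
qed

lemma ev_subst: "ev E (\<lambda>x. ex (grig_lift x)) w = ex (grig_subst w)"
  by (induction w) (simp_all add: e_append)

lemma grig_relator_conj_involution: "grig_relator (grig_expand \<zeta> @ [S D] @ rev (grig_expand \<zeta>) @ [S D])"
  if "grig_relator (grig_section True \<zeta>)"
proof -
  interpret normal_words "\<lambda>x. x" grig_relator by (rule normal_grig_relator)
  have w: "winv (\<lambda>x. x) v = rev v" for v :: "grig_letter list" by (simp add: winv_def)
  let ?\<xi> = "\<zeta> @ [(False, D)] @ rev \<zeta> @ [(False, D)]"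
  have "grig_relator (grig_section False ?\<xi>)"
    using cancel_word[of "[]" "grig_section False \<zeta>" "[]"] empty by (simp add: w)
  moreover have "grig_relator (grig_section True ?\<xi>)"
    using app[OF that conj[OF winv[OF that], of "S B"]] by (simp add: w)
  ultimately have "grig_relator (grig_expand ?\<xi>)"
    by (simp only: relator_expand_iff)
  then show ?thesis by simp
qed

text \<open>The letter \<open>d\<close> acts on the right subtree only, so in the tree it commutes with every element that
fixes the right subtree. In \<open>E\<close> the commutator \<open>k\<close> is therefore central. Since \<open>k d\<close> is a conjugate of
the involution \<open>d\<close>, we get \<open>k\<^sup>2 = 1\<close> and thus \<open>k = 1\<close>.\<close>

lemma rigid_commutes_D:
  assumes "grig_relator (grig_section True \<zeta>)"
  shows "m (S D) \<otimes> ex \<zeta> = ex \<zeta> \<otimes> m (S D)"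
proof -
  define z where "z = ex \<zeta>"
  have [simp]: "z \<in> carrier E" by (simp add: z_def)
  define k where "k = z \<otimes> (m (S D) \<otimes> (inv z \<otimes> m (S D)))"
  have [simp]: "k \<in> carrier E" by (simp add: k_def)
  have k: "k = e (grig_expand \<zeta> @ [S D] @ rev (grig_expand \<zeta>) @ [S D])"
    by (simp add: k_def z_def e_append e_rev)
  have kD: "k \<otimes> m (S D) = m (S D) \<otimes> k"
    using central[OF grig_relator_conj_involution[OF assms], of "[S D]"] unfolding k by simp
  have "k \<otimes> m (S D) = z \<otimes> (m (S D) \<otimes> inv z)"
    by (simp add: k_def m_assoc)
  then have "(k \<otimes> m (S D)) \<otimes> (k \<otimes> m (S D)) = \<one>"
    by (simp add: m_assoc)
  moreover have "(k \<otimes> m (S D)) \<otimes> (k \<otimes> m (S D)) = k \<otimes> (m (S D) \<otimes> k) \<otimes> m (S D)"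
    by (simp add: m_assoc)
  moreover have "\<dots> = k \<otimes> k"
    by (simp add: m_assoc flip: kD)
  ultimately have "k \<otimes> k = \<one>" by simp
  then have "k = \<one>"
    using no_2_torsion[OF grig_relator_conj_involution[OF assms]] unfolding k by blast
  then have "z \<otimes> m (S D) \<otimes> inv z = m (S D)"
    using \<open>k \<otimes> m (S D) = z \<otimes> (m (S D) \<otimes> inv z)\<close> by (simp add: m_assoc)
  then have "z \<otimes> m (S D) \<otimes> inv z \<otimes> z = m (S D) \<otimes> z" by simp
  then show ?thesis by (simp add: m_assoc z_def)
qed

text \<open>The values of the words that act trivially on the right subtree.\<close>

definition half where "half = {ex \<zeta> |\<zeta>. grig_relator (grig_section True \<zeta>)}"

lemma normal_commuting:
  "normal_words (\<lambda>x. x) (\<lambda>w. \<forall>z\<in>half. ex (grig_subst w) \<otimes> z = z \<otimes> ex (grig_subst w))"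
proof (rule normal_centralizing)
  show "inv ex (grig_subst [x]) \<otimes> (z \<otimes> ex (grig_subst [x])) \<in> half" if z: "z \<in> half" for x z
  proof -
    interpret normal_words "\<lambda>x. x" grig_relator by (rule normal_grig_relator)
    obtain \<zeta> where \<zeta>: "z = ex \<zeta>" "grig_relator (grig_section True \<zeta>)"
      using z by (auto simp: half_def)
    let ?\<zeta> = "rev (grig_subst [x]) @ \<zeta> @ grig_subst [x]"
    have "grig_relator (grig_section True ?\<zeta>)"
      using conj[OF \<zeta>(2), of x] by (simp only: grig_section_simps grig_section_rev grig_section_subst) simp
    moreover have "inv ex (grig_subst [x]) \<otimes> (z \<otimes> ex (grig_subst [x])) = ex ?\<zeta>"
      by (simp only: \<zeta> ex_append ex_rev)
    ultimately show ?thesis unfolding half_def by blast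
  qed
qed (auto simp: winv_def half_def)

text \<open>If \<open>v\<close> is trivial in the dihedral group, then \<open>grig_subst v\<close> acts trivially on the left subtree, and in
the tree it commutes with whatever acts trivially on the right one. The words \<open>v\<close> for which this
persists in \<open>E\<close> form a normal set. It contains \<open>b\<close> and \<open>cd\<close>, which are mapped to \<open>d\<close>, and \<open>(ad)\<^sup>4\<close>,
which is a relator and becomes central.\<close>

lemma rigid_commutes:
  assumes v: "dihedral_trivial v" and \<zeta>: "grig_relator (grig_section True \<zeta>)"
  shows "ex (grig_subst v) \<otimes> ex \<zeta> = ex \<zeta> \<otimes> ex (grig_subst v)"
proof -
  have D: "m (S D) \<otimes> z = z \<otimes> m (S D)" if "z \<in> half" for z
    using that rigid_commutes_D by (auto simp: half_def)
  have [simp]: "z \<in> carrier E" if "z \<in> half" for z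
    using that by (auto simp: half_def)
  have "\<forall>z\<in>half. ex (grig_subst v) \<otimes> z = z \<otimes> ex (grig_subst v)"
  proof (rule dihedral_words[OF normal_commuting, where \<tau> = dihedral_act and \<alpha> = A and \<delta> = "S D"])
    show "dihedral_act x = id \<and> (\<forall>z\<in>half. ex (grig_subst [x]) \<otimes> z = z \<otimes> ex (grig_subst [x])) \<or>
        dihedral_act x = swap8 \<and> (\<forall>z\<in>half. ex (grig_subst [x, A]) \<otimes> z = z \<otimes> ex (grig_subst [x, A])) \<or>
        dihedral_act x = neg8 \<and> (\<forall>z\<in>half. ex (grig_subst [x, S D]) \<otimes> z = z \<otimes> ex (grig_subst [x, S D]))" for x
      by (cases x rule: grig_act.cases) (simp_all add: m_assoc m_klein D)
    have "grig_relator (grig_expand (grig_subst [A, S D, A, S D, A, S D, A, S D]))"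
      unfolding relator_expand_iff grig_section_subst using grig_relator_ad4 grig_relator_da4 by simp
    then show "\<forall>z\<in>half. ex (grig_subst [A, S D, A, S D, A, S D, A, S D]) \<otimes> z =
        z \<otimes> ex (grig_subst [A, S D, A, S D, A, S D, A, S D])"
      using central unfolding half_def by blast
  qed (use v in \<open>simp add: dihedral_trivial_def\<close>)
  then show ?thesis using \<zeta> unfolding half_def by blast
qed

subsection \<open>Splitting a word along the two subtrees\<close>

text \<open>The lifts of the two sections of \<open>\<xi>\<close> to elements supported on the right and on the left subtree.\<close>

definition right_part where "right_part \<xi> = ex (grig_subst (grig_section True \<xi>))"
definition left_part where "left_part \<xi> = ex (mirror (grig_subst (grig_section False \<xi>)))"

lemma s_closed [simp]: "right_part \<xi> \<in> carrier E" "left_part \<xi> \<in> carrier E"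
  by (simp_all add: right_part_def left_part_def)

lemma s_append: "right_part (\<xi> @ \<eta>) = right_part \<xi> \<otimes> right_part \<eta>" "left_part (\<xi> @ \<eta>) = left_part \<xi> \<otimes> left_part \<eta>"
  by (simp_all add: right_part_def left_part_def e_append)

lemma s_rev: "right_part (rev \<xi>) = inv (right_part \<xi>)" "left_part (rev \<xi>) = inv (left_part \<xi>)"
  by (simp_all add: right_part_def left_part_def e_rev)

lemma s_Nil: "right_part [] = \<one>" "left_part [] = \<one>"
  by (simp_all add: right_part_def left_part_def)

lemma left_part_mirror: "left_part \<xi> = m A \<otimes> (right_part (mirror \<xi>) \<otimes> m A)"
  by (simp add: right_part_def left_part_def ex_mirror)

text \<open>Under this condition the two parts do not interfere: each of them acts trivially on the subtree of
the other one.\<close>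

definition liftable where "liftable \<xi> \<longleftrightarrow> dihedral_trivial (grig_section True \<xi>) \<and> dihedral_trivial (grig_section False \<xi>)"

lemma right_part_left_part_commute:
  assumes "dihedral_trivial (grig_section True \<xi>)" "dihedral_trivial (grig_section False \<eta>)"
  shows "right_part \<xi> \<otimes> left_part \<eta> = left_part \<eta> \<otimes> right_part \<xi>"
  unfolding right_part_def left_part_def
  by (rule rigid_commutes[OF assms(1)]) (use shadow_relator[OF assms(2)] in \<open>simp add: grig_shadow_def\<close>)

lemma letter_involution [simp]: "ex [g] \<otimes> ex [g] = \<one>"
proof -
  obtain s l where "g = (s, l)" by (cases g)
  then show ?thesis by (cases s) (simp_all add: m_assoc)
qed

text \<open>On the right subtree, conjugation by \<open>g\<close> and by the lift \<open>t\<close> of its right section have the same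
effect. Their quotient acts trivially there, so it commutes with the right part of \<open>\<xi>\<close>.\<close>

lemma right_part_conj:
  assumes "dihedral_trivial (grig_section True \<xi>)"
  shows "right_part ([g] @ \<xi> @ [g]) = ex [g] \<otimes> (right_part \<xi> \<otimes> ex [g])"
proof -
  define t where "t = right_part [g]"
  define x where "x = ex [g]"
  obtain s l where g: "g = (s, l)" by (cases g)
  have tt: "t \<otimes> t = \<one>"
    using s_rev(1)[of "[g]"] by (simp add: t_def) (metis r_inv s_closed(1))
  have [simp]: "t \<in> carrier E" "x \<in> carrier E" by (simp_all add: t_def x_def)
  have xx: "x \<otimes> (x \<otimes> y) = y" if "y \<in> carrier E" for y
    using that letter_involution[of g] by (simp add: x_def flip: m_assoc)
  have tt': "t \<otimes> (t \<otimes> y) = y" if "y \<in> carrier E" for y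
    using that tt by (simp flip: m_assoc)
  have "grig_section True ([g] @ grig_subst (grig_section True [g])) = grig_section True [g] @ grig_section True [g]"
    by (simp only: grig_section_simps(3) grig_section_subst)
  also have "grig_relator \<dots>"
    by (cases s; cases l) (simp_all add: g grig_relator_def fun_eq_iff grig_a_invol grig_invol)
  finally have "right_part \<xi> \<otimes> (x \<otimes> t) = (x \<otimes> t) \<otimes> right_part \<xi>"
    using rigid_commutes[OF assms, of "[g] @ grig_subst (grig_section True [g])"]
    by (simp only: ex_append right_part_def t_def x_def)
  then have "x \<otimes> (right_part \<xi> \<otimes> (x \<otimes> t)) \<otimes> t = x \<otimes> ((x \<otimes> t) \<otimes> right_part \<xi>) \<otimes> t"
    by (simp only:)
  then show ?thesis
    unfolding s_append using tt
    by (simp add: m_assoc xx flip: t_def x_def)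
qed

lemma left_part_conj:
  assumes "dihedral_trivial (grig_section False \<xi>)"
  shows "left_part ([g] @ \<xi> @ [g]) = ex [g] \<otimes> (left_part \<xi> \<otimes> ex [g])"
proof -
  obtain g' where g': "mirror [g] = [g']" by (cases g) simp
  have "mirror ([g] @ \<xi> @ [g]) = [g'] @ mirror \<xi> @ [g']"
    by (simp only: mirror_simps g')
  moreover have "ex [g'] = m A \<otimes> (ex [g] \<otimes> m A)"
    by (simp only: ex_mirror flip: g')
  moreover have "right_part ([g'] @ mirror \<xi> @ [g']) = ex [g'] \<otimes> (right_part (mirror \<xi>) \<otimes> ex [g'])"
    by (rule right_part_conj) (use assms in simp)
  ultimately show ?thesis
    unfolding left_part_mirror by (simp only:) (simp add: m_assoc del: grig_expand_simps)
qed

text \<open>The words whose value in \<open>E\<close> is the product of their two parts. Both sides lift the same element of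
the Grigorchuk group, so the quotient of the two sides is a homomorphism from liftable words to the
values of relators that is invariant under conjugation; the words that split form its kernel.\<close>

definition splits where "splits \<xi> \<longleftrightarrow> liftable \<xi> \<and> ex \<xi> = right_part \<xi> \<otimes> left_part \<xi>"

lemma liftable_simps:
  "liftable []" "liftable u \<Longrightarrow> liftable v \<Longrightarrow> liftable (u @ v)" "liftable u \<Longrightarrow> liftable (rev u)" "liftable u \<Longrightarrow> liftable (x # u @ [x])"
  "liftable (u @ x # x # v) \<longleftrightarrow> liftable (u @ v)"
proof -
  have inv: "dihedral_act y (dihedral_act y z) = z" for y z
    by (cases y rule: grig_act.cases; cases z) simp_all
  have r: "dihedral_trivial (rev w)" if "dihedral_trivial w" for w
  proof -
    have "act_word dihedral_act (rev w) (act_word dihedral_act w t) = t" for t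
      by (induction w arbitrary: t) (simp_all add: inv)
    then have "act_word dihedral_act (rev w) t = id t" for t
      using that by (simp add: dihedral_trivial_def)
    then show ?thesis unfolding dihedral_trivial_def by (rule ext)
  qed
  have c: "dihedral_trivial (grig_section b [x] @ grig_section b w @ grig_section b [x])" if "dihedral_trivial (grig_section b w)" for b w
    using that by (cases x; cases "snd x"; cases "fst x"; cases b) (simp_all add: dihedral_trivial_def fun_eq_iff inv del: split_paired_All)
  have d: "act_word dihedral_act (grig_section b [x]) \<circ> (act_word dihedral_act (grig_section b [x]) \<circ> f) = f" for b f
    by (cases x; cases "snd x"; cases "fst x"; cases b) (simp_all add: fun_eq_iff inv del: split_paired_All)
  show "liftable []" by (simp add: liftable_def dihedral_trivial_def)
  show "liftable u \<Longrightarrow> liftable v \<Longrightarrow> liftable (u @ v)" by (simp add: liftable_def dihedral_trivial_def)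
  show "liftable u \<Longrightarrow> liftable (rev u)" by (simp add: liftable_def r)
  show "liftable u \<Longrightarrow> liftable (x # u @ [x])"
    using c[of _ u] unfolding liftable_def by (metis append_Cons append_Nil grig_section_simps(3))
  show "liftable (u @ x # x # v) \<longleftrightarrow> liftable (u @ v)"
  proof -
    have "grig_section b (u @ x # x # v) = grig_section b u @ grig_section b [x] @ grig_section b [x] @ grig_section b v" for b
      by (metis append_Cons append_Nil grig_section_simps(3))
    note this [simp]
    show ?thesis by (simp add: liftable_def dihedral_trivial_def d del: grig_section_simps(2,3)) (simp add: comp_assoc)
  qed
qed

lemma normal_splits: "normal_words (\<lambda>x. x) splits"
proof
  show "splits (u @ v)" if "splits u" "splits v" for u v
  proof -
    have "right_part v \<otimes> left_part u = left_part u \<otimes> right_part v"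
      using that by (intro right_part_left_part_commute) (simp_all add: splits_def liftable_def)
    then have "right_part u \<otimes> (left_part u \<otimes> right_part v) \<otimes> left_part v = right_part u \<otimes> (right_part v \<otimes> left_part u) \<otimes> left_part v" by (simp only:)
    then show ?thesis
      using that by (simp add: splits_def liftable_simps s_append e_append m_assoc)
  qed
  show "splits (winv (\<lambda>x. x) u)" if "splits u" for u
  proof -
    have "right_part u \<otimes> left_part u = left_part u \<otimes> right_part u"
      using that by (intro right_part_left_part_commute) (simp_all add: splits_def liftable_def)
    then show ?thesis
      using that by (simp add: splits_def liftable_simps winv_def s_rev e_rev flip: inv_mult_group)
  qed
  show "splits (x # u @ [x])" if "splits u" for x u
  proof -
    have "right_part ([x] @ u @ [x]) \<otimes> left_part ([x] @ u @ [x]) =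
        (ex [x] \<otimes> (right_part u \<otimes> ex [x])) \<otimes> (ex [x] \<otimes> (left_part u \<otimes> ex [x]))"
      using that right_part_conj left_part_conj by (simp only: splits_def liftable_def)
    also have "\<dots> = ex [x] \<otimes> (right_part u \<otimes> ((ex [x] \<otimes> ex [x]) \<otimes> (left_part u \<otimes> ex [x])))"
      by (simp add: m_assoc del: grig_expand_simps letter_involution)
    also have "\<dots> = ex ([x] @ u @ [x])"
      using that unfolding letter_involution ex_append
      by (simp add: splits_def m_assoc del: grig_expand_simps)
    finally show ?thesis
      using that liftable_simps(4)[of u x] by (simp add: splits_def)
  qed
  show "splits (u @ x # x # v) \<longleftrightarrow> splits (u @ v)" for u x v
  proof -
    have w: "u @ x # x # v = u @ [x] @ [x] @ v" by simp
    have x: "right_part [x] \<otimes> (right_part [x] \<otimes> y) = y" "left_part [x] \<otimes> (left_part [x] \<otimes> y) = y" "ex [x] \<otimes> (ex [x] \<otimes> y) = y"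
      if "y \<in> carrier E" for y
      using that s_rev[of "[x]"] ex_rev[of "[x]"]
      by (simp_all del: grig_expand_simps) (metis cancel_simps(1) s_closed e_closed)+
    show ?thesis
      unfolding splits_def liftable_simps(5) unfolding w s_append ex_append
      by (simp add: x del: grig_expand_simps)
  qed
qed (simp_all add: splits_def liftable_simps s_Nil)

text \<open>Modulo the words that split, the conjugates of \<open>d\<close> are trivial and \<open>c\<close> equals \<open>b\<close>, so that two
involutions \<open>\<alpha> = aba\<close> and \<open>\<delta> = b\<close> remain, and it suffices to consider \<open>\<rho> = (\<alpha>\<delta>)\<^sup>4\<close>. Conjugation by
\<open>\<alpha>\<close> inverts \<open>\<rho>\<close> as well as its parts, hence it inverts the central error term \<open>k\<close>; so \<open>k\<^sup>2 = 1\<close> and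
\<open>k = 1\<close>.\<close>

lemma splits_if_dihedral_trivial:
  assumes "dihedral_trivial (grig_section True \<xi>)"
  shows "splits \<xi>"
proof -
  interpret normal_words "\<lambda>x. x" splits by (rule normal_splits)
  define \<tau> where "\<tau> g = act_word dihedral_act (grig_section True [g])" for g
  have act: "act_word \<tau> \<xi> = act_word dihedral_act (grig_section True \<xi>)" for \<xi>
  proof (induction \<xi>)
    case (Cons g \<xi>)
    then show ?case by (cases g) (simp add: \<tau>_def)
  qed simp
  have base: "splits [(True, D)]" "splits [(False, D)]" "splits [(True, C), (True, B)]"
    "splits [(False, C), (False, B)]" "splits [(True, B), (True, B)]" "splits [(False, B), (False, B)]"
    by (simp_all add: splits_def liftable_def dihedral_trivial_def right_part_def left_part_def m_klein m_assoc fun_eq_iff)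
  let ?\<rho> = "[(True, B), (False, B), (True, B), (False, B), (True, B), (False, B), (True, B), (False, B)]"
  have pow: "splits ?\<rho>"
  proof -
    let ?\<alpha> = "(True, B)"
    have dihedral_trivial: "dihedral_trivial (grig_section True ?\<rho>)" "dihedral_trivial (grig_section False ?\<rho>)"
      by (simp_all add: dihedral_trivial_def fun_eq_iff)
    define t where "t = ex [?\<alpha>]"
    define R where "R = ex ?\<rho>"
    define P where "P = right_part ?\<rho> \<otimes> left_part ?\<rho>"
    define k where "k = inv R \<otimes> P"
    have [simp]: "t \<in> carrier E" "R \<in> carrier E" "P \<in> carrier E" "k \<in> carrier E"
      by (simp_all add: t_def R_def P_def k_def del: grig_expand_simps)
    have tt: "t \<otimes> t = \<one>" unfolding t_def by (rule letter_involution)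
    have tt': "t \<otimes> (t \<otimes> y) = y" if "y \<in> carrier E" for y
      using tt that by (simp flip: m_assoc)
    have comm: "right_part ?\<rho> \<otimes> left_part ?\<rho> = left_part ?\<rho> \<otimes> right_part ?\<rho>"
      by (rule right_part_left_part_commute[OF dihedral_trivial])
    \<comment> \<open>The common reason why conjugation by \<open>\<alpha>\<close> inverts the value and both parts of \<open>\<rho>\<close>.\<close>
    have red: "f ([?\<alpha>] @ ?\<rho> @ [?\<alpha>]) = f (rev ?\<rho>)"
      if "\<And>u v. f (u @ v) = f u \<otimes> f v" "\<And>u. f (rev u) = inv (f u)" "\<And>u. f u \<in> carrier E"
      for f :: "(bool \<times> bcd) list \<Rightarrow> 'e"
    proof -
      have f: "f (x # y # v) = f [x] \<otimes> f (y # v)" for x y v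
        using that(1)[of "[x]" "y # v"] by simp
      have i: "f [x] \<otimes> f [x] = \<one>" "z \<in> carrier E \<Longrightarrow> f [x] \<otimes> (f [x] \<otimes> z) = z" for x z
        using that(2)[of "[x]"] that(3)[of "[x]"] r_inv[of "f [x]"] by (simp_all flip: m_assoc)
      show ?thesis by (simp add: f i that(3))
    qed
    have "t \<otimes> (R \<otimes> t) = inv R"
      using red[of ex, OF ex_append ex_rev e_closed]
      by (simp only: t_def R_def ex_rev ex_append)
    moreover have "t \<otimes> (right_part ?\<rho> \<otimes> t) = inv (right_part ?\<rho>)"
      using red[of right_part, OF s_append(1) s_rev(1) s_closed(1)] right_part_conj[OF dihedral_trivial(1), of ?\<alpha>]
      by (simp only: t_def s_rev)
    moreover have "t \<otimes> (left_part ?\<rho> \<otimes> t) = inv (left_part ?\<rho>)"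
      using red[of left_part, OF s_append(2) s_rev(2) s_closed(2)] left_part_conj[OF dihedral_trivial(2), of ?\<alpha>]
      by (simp only: t_def s_rev)
    ultimately have "t \<otimes> (k \<otimes> t) = R \<otimes> inv P"
    proof -
      assume a: "t \<otimes> (R \<otimes> t) = inv R" "t \<otimes> (right_part ?\<rho> \<otimes> t) = inv (right_part ?\<rho>)"
        "t \<otimes> (left_part ?\<rho> \<otimes> t) = inv (left_part ?\<rho>)"
      have "t \<otimes> (inv R \<otimes> t) = R"
        by (simp flip: a(1)) (simp add: m_assoc tt tt')
      moreover have "t \<otimes> (P \<otimes> t) = inv P"
      proof -
        have "t \<otimes> (P \<otimes> t) = (t \<otimes> (right_part ?\<rho> \<otimes> t)) \<otimes> (t \<otimes> (left_part ?\<rho> \<otimes> t))"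
          by (simp add: P_def m_assoc tt')
        also have "\<dots> = inv (left_part ?\<rho> \<otimes> right_part ?\<rho>)"
          unfolding a by (simp add: inv_mult_group)
        finally show ?thesis by (simp only: P_def comm)
      qed
      moreover have "t \<otimes> (k \<otimes> t) = (t \<otimes> (inv R \<otimes> t)) \<otimes> (t \<otimes> (P \<otimes> t))"
        by (simp add: k_def m_assoc tt')
      ultimately show ?thesis by simp
    qed
    moreover define W where "W = grig_expand (rev ?\<rho> @ grig_subst (grig_section True ?\<rho>) @ mirror (grig_subst (grig_section False ?\<rho>)))"
    have kW: "k = e W"
      unfolding W_def k_def P_def R_def right_part_def left_part_def by (simp only: ex_append ex_rev m_assoc e_closed)
    have W: "grig_relator W"
    proof -
      interpret g: normal_words "\<lambda>x. x" grig_relator by (rule normal_grig_relator)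
      have sh: "grig_relator (grig_shadow (grig_section b ?\<rho>))" for b
        using shadow_relator[OF dihedral_trivial(1)] shadow_relator[OF dihedral_trivial(2)] by (cases b) simp_all
      have c: "grig_relator (rev w @ w @ v) \<longleftrightarrow> grig_relator v" for w v
        using g.cancel_word'[of "[]" w v] by (simp add: winv_def)
      have c': "grig_relator (rev w @ v @ w) \<longleftrightarrow> grig_relator v" if "grig_relator v" for w v
        using that
      proof (induction w rule: rev_induct)
        case (snoc x w)
        then show ?case using g.conj[of "rev w @ v @ w" x] by simp
      qed simp
      show ?thesis
        unfolding W_def relator_expand_iff grig_section_simps(3) grig_section_rev grig_section_mirror grig_section_subst
        using c[of "grig_section True ?\<rho>"] c'[OF sh[of True], of "grig_section False ?\<rho>"] sh[of False] sh[of True]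
        by (simp only: not_True_eq_False not_False_eq_True grig_section_subst grig_shadow_def simp_thms)
    qed
    have central': "k \<otimes> e v = e v \<otimes> k" for v
      unfolding kW by (rule central[OF W])
    have "t \<otimes> (k \<otimes> t) = k"
      using central'[of "grig_expand [?\<alpha>]"] unfolding t_def[symmetric] by (simp add: tt')
    ultimately have "k = R \<otimes> inv P" by simp
    moreover have "P = R \<otimes> k" by (simp add: k_def)
    moreover have "R \<otimes> k = k \<otimes> R"
      using central'[of "grig_expand ?\<rho>"] by (simp only: R_def)
    ultimately have "k \<otimes> k = \<one>"
      by (metis \<open>P \<in> carrier E\<close> \<open>R \<in> carrier E\<close> \<open>k \<in> carrier E\<close> inv_closed l_inv m_assoc r_inv inv_mult_group)
    then have "k = \<one>" using no_2_torsion[OF W] unfolding kW by blast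
    then have "R = P" using \<open>P = R \<otimes> k\<close> by simp
    then show ?thesis
      using dihedral_trivial by (simp only: splits_def liftable_def R_def P_def)
  qed
  show ?thesis
  proof (rule dihedral_words[OF normal_splits, where \<tau> = \<tau> and \<alpha> = "(True, B)" and \<delta> = "(False, B)"])
    show "\<tau> x = id \<and> splits [x] \<or> \<tau> x = swap8 \<and> splits [x, (True, B)] \<or> \<tau> x = neg8 \<and> splits [x, (False, B)]" for x
    proof -
      obtain s l where "x = (s, l)" by (cases x)
      then show ?thesis using base by (cases s; cases l) (simp_all add: \<tau>_def)
    qed
  qed (use assms pow act in \<open>simp_all add: dihedral_trivial_def\<close>)
qed

end

text \<open>A letter other than \<open>a\<close> contributes exactly one such letter to the two sections together. Hence both
sections have smaller weight than the word, unless all these letters are conjugated in the same way.\<close>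

definition grig_weight :: "grig_letter list \<Rightarrow> nat" where
  "grig_weight w = length (filter (\<lambda>x. x \<noteq> A) w)"

lemma grig_weight_grig_section:
  "grig_weight (grig_section x \<xi>) = length (filter (\<lambda>(s, l). s \<noteq> x) \<xi>)"
proof (induction \<xi>)
  case (Cons g \<xi>)
  obtain s l where "g = (s, l)" by (cases g)
  then show ?case using Cons by (cases l) (auto simp: grig_weight_def)
qed (simp add: grig_weight_def)

lemma length_grig_collect: "length (grig_collect s w) = grig_weight w"
  by (induction s w rule: grig_collect.induct) (simp_all add: grig_weight_def)

context grig_marking
begin

lemma e_grig_collect:
  "(if s then m A else \<one>) \<otimes> e w = ex (grig_collect s w) \<otimes> (if s \<noteq> odd_a w then m A else \<one>)"
proof (induction w arbitrary: s)
  case (Cons x w)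
  show ?case
  proof (cases x)
    case A
    then show ?thesis
      using Cons[of "\<not> s"] by (auto simp: odd_a_def split: if_splits)
  next
    case (S l)
    have *: "e w = m A \<otimes> (ex (grig_collect True w) \<otimes> (if True \<noteq> odd_a w then m A else \<one>))"
      using arg_cong[OF Cons[of True], of "\<lambda>y. m A \<otimes> y"] by simp
    show ?thesis
    proof (cases s)
      case True
      have "odd_a (x # w) = odd_a w" by (simp add: odd_a_def S)
      then show ?thesis
        using * by (cases "odd_a w") (simp_all add: S True m_assoc)
    next
      case False
      then show ?thesis
        using Cons[of False] by (auto simp: S odd_a_def m_assoc)
    qed
  qed
qed (simp add: odd_a_def)

lemma e_grig_relator: "grig_relator w \<Longrightarrow> e w = ex (grig_collect False w)"
  using e_grig_collect[of False w] grig_relator_not_odd_a[of w] by simp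

end

lemma grig_klein:
  "grig_b (grig_c w) = grig_d w" "grig_c (grig_d w) = grig_b w" "grig_d (grig_b w) = grig_c w"
  "grig_c (grig_b w) = grig_d w" "grig_d (grig_c w) = grig_b w" "grig_b (grig_d w) = grig_c w"
proof -
  have 1: "grig_b (grig_c w) = grig_d w \<and> grig_c (grig_d w) = grig_b w \<and> grig_d (grig_b w) = grig_c w" for w
  proof (induction w)
    case (Cons x w)
    then show ?case by (cases x) (auto simp: grig_a_invol)
  qed simp
  then show "grig_b (grig_c w) = grig_d w" "grig_c (grig_d w) = grig_b w" "grig_d (grig_b w) = grig_c w"
    by blast+
  show "grig_c (grig_b w) = grig_d w" "grig_d (grig_c w) = grig_b w" "grig_b (grig_d w) = grig_c w"
    using 1 grig_invol by metis+
qed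

context grig_marking
begin

text \<open>Words in \<open>b\<close>, \<open>c\<close> and \<open>d\<close> can be evaluated in the Klein group, and simultaneously in \<open>E\<close> and in the
tree.\<close>

lemma klein_word:
  "\<exists>r\<in>{[], [B], [C], [D]}. e (map S v) = e (map S r) \<and>
     (\<forall>t. act_word grig_act (map S v) t = act_word grig_act (map S r) t)"
proof (induction v)
  case (Cons l v)
  then obtain r where r: "r \<in> {[], [B], [C], [D]}" "e (map S v) = e (map S r)"
    "\<And>t. act_word grig_act (map S v) t = act_word grig_act (map S r) t" by blast
  \<comment> \<open>The product in the Klein group: the third letter, if \<open>l\<close> and the letter of \<open>r\<close> differ.\<close>
  define q where "q = (if r = [] then [l] else if r = [l] then [] else
      if B \<notin> {l, hd r} then [B] else if C \<notin> {l, hd r} then [C] else [D])"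
  have "q \<in> {[], [B], [C], [D]}"
    by (cases l) (simp_all add: q_def)
  moreover have "e (map S (l # v)) = e (map S q)"
    using r(1) by (cases l) (auto simp: q_def r(2) m_klein)
  moreover have "act_word grig_act (map S (l # v)) t = act_word grig_act (map S q) t" for t
    using r(1) by (cases l) (auto simp: q_def r(3) grig_invol grig_klein)
  ultimately show ?case by blast
qed simp

lemma klein_word_trivial:
  assumes "grig_relator (map S v)"
  shows "e (map S v) = \<one>"
proof -
  obtain r where r: "r \<in> {[], [B], [C], [D]}" "e (map S v) = e (map S r)"
    "\<And>t. act_word grig_act (map S v) t = act_word grig_act (map S r) t" using klein_word by blast
  have "act_word grig_act (map S r) w = w" for w
    using assms by (simp add: grig_relator_def flip: r(3))
  \<comment> \<open>On the first word \<open>b\<close> and \<open>c\<close> act nontrivially, on the second one \<open>d\<close>.\<close>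
  from this[of "[False, False]"] this[of "[True, False, False]"] have "r = []"
    using r(1) by auto
  then show ?thesis using r(2) by simp
qed

end

text \<open>Induction on the weight, for all markings of \<open>E\<close> at once. If both sections have smaller weight, the
relator splits into lifts of its sections, and these are the values of shorter relators under the
marking composed with the substitution. Otherwise the relator is, up to conjugation, a word in
\<open>b\<close>, \<open>c\<close>, \<open>d\<close>.\<close>

theorem grig_relation_trivial:
  assumes "grig_marking E m" "grig_relator w"
  shows "ev E m w = \<one>\<^bsub>E\<^esub>"
  using assms
proof (induction "grig_weight w" arbitrary: w m rule: less_induct)
  case less
  interpret grig_marking E m by fact
  define \<xi> where "\<xi> = grig_collect False w"
  have w: "e w = ex \<xi>"
    unfolding \<xi>_def by (rule e_grig_relator[OF less.prems(2)])
  have sec: "grig_relator (grig_section x \<xi>)" for x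
    unfolding \<xi>_def by (rule section_of_relator[OF less.prems(2)])
  show ?case
  proof (cases "\<exists>s. \<forall>g\<in>set \<xi>. fst g = s")
    case True
    then obtain s where s: "\<forall>g\<in>set \<xi>. fst g = s" by blast
    define \<eta> where "\<eta> = (if s then mirror \<xi> else \<xi>)"
    have "grig_expand \<eta> = map S (map snd \<xi>)"
      using s unfolding \<eta>_def by (induction \<xi>) auto
    moreover have "grig_relator (grig_expand \<eta>)"
      using sec by (simp add: \<eta>_def relator_expand_iff)
    ultimately have "ex \<eta> = \<one>\<^bsub>E\<^esub>"
      using klein_word_trivial by metis
    then have "ex (mirror \<eta>) = \<one>\<^bsub>E\<^esub>" by (simp add: ex_mirror)
    then show ?thesis using \<open>ex \<eta> = \<one>\<^bsub>E\<^esub>\<close> w by (auto simp: \<eta>_def split: if_splits)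
  next
    case False
    have "grig_weight (grig_section x \<xi>) < grig_weight w" for x
    proof -
      obtain g where "g \<in> set \<xi>" "fst g = x" using False by (metis (full_types))
      then have "length (filter (\<lambda>(s, l). s \<noteq> x) \<xi>) < length \<xi>"
        by (intro length_filter_less) auto
      then show ?thesis
        by (simp only: grig_weight_grig_section) (simp add: \<xi>_def length_grig_collect)
    qed
    from less.hyps[OF this grig_marking_subst sec] have "ex (grig_subst (grig_section x \<xi>)) = \<one>\<^bsub>E\<^esub>" for x
      by (simp add: ev_subst)
    then have "right_part \<xi> = \<one>\<^bsub>E\<^esub>" "left_part \<xi> = \<one>\<^bsub>E\<^esub>"
      by (simp_all add: right_part_def left_part_def ex_mirror)
    moreover have "splits \<xi>"
      by (rule splits_if_dihedral_trivial[OF relator_dihedral_trivial[OF sec]])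
    ultimately show ?thesis by (simp add: w splits_def)
  qed
qed

lemma range_S: "range f = insert (f A) (range (\<lambda>l. f (S l)))"
  by (auto simp: image_iff) (metis grig_letter.exhaust)

lemma range_bcd: "range f = {f B, f C, f D}"
  by (auto simp: image_iff) (metis bcd.exhaust)

instance bcd :: countable by countable_datatype
instance grig_letter :: countable by countable_datatype

lemma ev_grigorchuk: "ev grigorchuk_group grig_act w = act_word grig_act w"
  by (induction w) (simp_all add: grigorchuk_group_def tree_aut_def)

lemma word_eval_grig_act: "word_eval tree_aut (\<lambda>x. x) grig_act"
proof -
  interpret T: group "tree_aut :: (bool list \<Rightarrow> bool list) monoid" by (rule group_tree_aut)
  show ?thesis
  proof
    show "grig_act x \<in> carrier tree_aut" for x
      using grig_in_tree_aut by (cases x rule: grig_act.cases) simp_all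
    then show "grig_act x = inv\<^bsub>tree_aut\<^esub> grig_act x" for x
      by (intro T.inv_equality[symmetric]) (simp_all add: tree_aut_def fun_eq_iff)
  qed
qed

lemma grigorchuk_group_words:
  "grigorchuk_group = subgroup_generated tree_aut (range grig_act)"
proof -
  have "range grig_act = {grig_a, grig_b, grig_c, grig_d}"
    by (simp add: range_S range_bcd)
  then show ?thesis by (simp add: grigorchuk_group_def)
qed

text \<open>In the rigid group \<open>E\<close> the relation \<open>bcd = 1\<close> is obtained from comparisons of involutions: \<open>cbc = b\<close>,
so \<open>b\<close> and \<open>c\<close> commute, and then \<open>bc\<close> is an involution that agrees with \<open>d\<close> in the tree.\<close>

theorem cellular_grigorchuk:
  assumes inf: "infinite (UNIV :: 'u set)"
  shows "cellular TYPE('u) (integer_mod_group 2) grigorchuk_group"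
proof (rule cellular_if_rigid[where g = grig_act, OF _ inf])
  interpret T: word_eval tree_aut "\<lambda>x. x" grig_act by (rule word_eval_grig_act)
  show G: "group grigorchuk_group"
    by (simp add: grigorchuk_group_words)
  show c: "carrier grigorchuk_group = range (ev grigorchuk_group grig_act)"
    using carrier_subgroup_generated_words[OF word_eval_grig_act]
    by (simp add: grigorchuk_group_words ev_subgroup_generated)
  show "range grig_act \<subseteq> carrier grigorchuk_group"
    unfolding grigorchuk_group_words by (rule T.subgroup_generated_subset_carrier_subset) auto
  show "grig_act l [^]\<^bsub>grigorchuk_group\<^esub> (2::nat) = \<one>\<^bsub>grigorchuk_group\<^esub>" for l
    by (simp add: numeral_2_eq_2 grigorchuk_group_def tree_aut_def fun_eq_iff)
  fix E :: "'u monoid" and m u v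
  assume E: "group E" "range m \<subseteq> carrier E" "\<And>l. m l [^]\<^bsub>E\<^esub> (2::nat) = \<one>\<^bsub>E\<^esub>"
    and EG: "\<And>u v. ev E m u = ev E m v \<Longrightarrow> ev grigorchuk_group grig_act u = ev grigorchuk_group grig_act v"
    and uniq: "\<And>u v. ev E m u [^]\<^bsub>E\<^esub> (2::nat) = \<one>\<^bsub>E\<^esub> \<Longrightarrow> ev E m v [^]\<^bsub>E\<^esub> (2::nat) = \<one>\<^bsub>E\<^esub> \<Longrightarrow>
        ev grigorchuk_group grig_act u = ev grigorchuk_group grig_act v \<Longrightarrow> ev E m u = ev E m v"
    and uv: "ev grigorchuk_group grig_act u = ev grigorchuk_group grig_act v"
  interpret E: group E by fact
  have mc [simp]: "m x \<in> carrier E" for x using E(2) by blast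
  have mm [simp]: "m x \<otimes>\<^bsub>E\<^esub> m x = \<one>\<^bsub>E\<^esub>" for x
    using E(3)[of x] by (simp add: numeral_2_eq_2)
  interpret E: word_eval E "\<lambda>x. x" m
    by unfold_locales (simp, rule E.inv_equality[symmetric], simp_all)
  have uniq': "E.e u = E.e v"
    if "E.e u \<otimes>\<^bsub>E\<^esub> E.e u = \<one>\<^bsub>E\<^esub>" "E.e v \<otimes>\<^bsub>E\<^esub> E.e v = \<one>\<^bsub>E\<^esub>" "act_word grig_act u = act_word grig_act v" for u v
    using uniq[of u v] that by (simp add: numeral_2_eq_2 ev_grigorchuk)
  have marking: "grig_marking E m"
  proof
    show "m x \<otimes>\<^bsub>E\<^esub> m x = \<one>\<^bsub>E\<^esub>" for x by simp
    show no_torsion: "E.e w = \<one>\<^bsub>E\<^esub>" if "grig_relator w" "E.e w \<otimes>\<^bsub>E\<^esub> E.e w = \<one>\<^bsub>E\<^esub>" for w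
      using uniq'[of w "[]"] that by (simp add: grig_relator_def)
    show "E.e w \<otimes>\<^bsub>E\<^esub> E.e v = E.e v \<otimes>\<^bsub>E\<^esub> E.e w" if "grig_relator w" for w v
    proof (rule E.relator_central)
      show "m x [^]\<^bsub>E\<^esub> (2::nat) = \<one>\<^bsub>E\<^esub>" for x by (rule E(3))
      show "E.e u = E.e v" if "E.e u [^]\<^bsub>E\<^esub> (2::nat) = \<one>\<^bsub>E\<^esub>"
        "E.e v [^]\<^bsub>E\<^esub> (2::nat) = \<one>\<^bsub>E\<^esub>" "act_word grig_act u = act_word grig_act v" for u v
        using uniq[of u v] that by (simp only: ev_grigorchuk)
      show "act_word grig_act w = id" "act_word grig_act (winv (\<lambda>x. x) w) = id"
        using that normal_words.winv[OF normal_grig_relator that] by (simp_all only: grig_relator_def)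
    qed
    show "m (S B) \<otimes>\<^bsub>E\<^esub> (m (S C) \<otimes>\<^bsub>E\<^esub> m (S D)) = \<one>\<^bsub>E\<^esub>"
    proof -
      have m': "m x \<otimes>\<^bsub>E\<^esub> (m x \<otimes>\<^bsub>E\<^esub> y) = y" if "y \<in> carrier E" for x y
        using that by (simp flip: E.m_assoc)
      have "E.e [S C, S B, S C] = E.e [S B]"
        by (rule uniq') (simp_all add: E.m_assoc m' fun_eq_iff grig_klein)
      then have "m (S C) \<otimes>\<^bsub>E\<^esub> (m (S C) \<otimes>\<^bsub>E\<^esub> (m (S B) \<otimes>\<^bsub>E\<^esub> m (S C))) = m (S C) \<otimes>\<^bsub>E\<^esub> m (S B)"
        by simp
      then have bc: "m (S B) \<otimes>\<^bsub>E\<^esub> m (S C) = m (S C) \<otimes>\<^bsub>E\<^esub> m (S B)"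
        by (simp add: m')
      have "E.e [S B, S C] \<otimes>\<^bsub>E\<^esub> E.e [S B, S C] = m (S B) \<otimes>\<^bsub>E\<^esub> (m (S C) \<otimes>\<^bsub>E\<^esub> m (S B)) \<otimes>\<^bsub>E\<^esub> m (S C)"
        by (simp add: E.m_assoc)
      also have "\<dots> = \<one>\<^bsub>E\<^esub>"
        by (simp add: E.m_assoc m' flip: bc)
      finally have "E.e [S B, S C] = E.e [S D]"
        by (intro uniq') (simp_all add: fun_eq_iff grig_klein)
      then have "m (S B) \<otimes>\<^bsub>E\<^esub> m (S C) \<otimes>\<^bsub>E\<^esub> m (S D) = \<one>\<^bsub>E\<^esub>" by simp
      then show ?thesis by (simp add: E.m_assoc)
    qed
  qed simp
  have "grig_relator (u @ rev v)"
  proof -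
    have "act_word grig_act (v @ rev v) = id"
      using normal_words.cancel_word[OF normal_grig_relator, of "[]" v "[]"] normal_words.empty[OF normal_grig_relator]
      by (simp add: winv_def grig_relator_def)
    then show ?thesis using uv by (simp add: grig_relator_def ev_grigorchuk)
  qed
  from grig_relation_trivial[OF marking this]
  have "E.e u \<otimes>\<^bsub>E\<^esub> inv\<^bsub>E\<^esub> E.e v = \<one>\<^bsub>E\<^esub>"
    using E.e_winv[of v] by (simp add: E.e_append winv_def)
  then show "E.e u = E.e v"
    by (metis E.e_closed E.inv_equality E.inv_inv E.inv_closed)
qed simp

section \<open>Relations of the Gupta--Sidki group\<close>

text \<open>Words with formal inverses: a letter is a pair of a generator and a sign. Unlike in the Grigorchuk
case, inverses cannot be eliminated, because the lifts used below have order 9 instead of 3.\<close>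

definition expsum :: "'g \<Rightarrow> ('g \<times> bool) list \<Rightarrow> int" where
  "expsum g w = int (count_list w (g, True)) - int (count_list w (g, False))"

definition flip :: "'g \<times> bool \<Rightarrow> 'g \<times> bool" where
  "flip x = (fst x, \<not> snd x)"

lemma flip_simps [simp]: "flip (g, s) = (g, \<not> s)" "flip (flip x) = x" "flip x \<noteq> x"
  by (auto simp: flip_def prod_eq_iff)

lemma expsum_simps [simp]:
  "expsum g [] = 0"
  "expsum g ((h, s) # w) = (if g = h then if s then 1 else -1 else 0) + expsum g w"
  "expsum g (u @ v) = expsum g u + expsum g v"
  by (auto simp: expsum_def)

lemma expsum_winv [simp]: "expsum g (winv flip w) = - expsum g w"
  by (induction w) auto

lemma expsum_balanced:
  assumes "\<And>g. expsum g w = 0"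
  shows "count_list w x = count_list w (flip x)"
proof -
  obtain g s where "x = (g, s)" by (cases x)
  then show ?thesis using assms[of g] by (cases s) (auto simp: expsum_def)
qed

text \<open>Apart from the generators \<open>a\<close> and \<open>t\<close>, the conjugates \<open>t\<^sub>k = a\<^sup>k t a\<^sup>-\<^sup>k\<close> are used, which fix the first
level; the letter \<open>(k, s)\<close> stands for \<open>t\<^sub>k\<close> or its inverse, depending on the sign \<open>s\<close>.\<close>

datatype gsgen = GA | GT

fun gs_act :: "gsgen \<times> bool \<Rightarrow> letter3 list \<Rightarrow> letter3 list" where
  "gs_act (GA, True) = gs_a"
| "gs_act (GA, False) = gs_a \<circ> gs_a"
| "gs_act (GT, True) = gs_t"
| "gs_act (GT, False) = gs_t \<circ> gs_t"

definition gs_relator :: "(gsgen \<times> bool) list \<Rightarrow> bool" where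
  "gs_relator w \<longleftrightarrow> act_word gs_act w = id"

fun root_rot :: "gsgen \<times> bool \<Rightarrow> letter3 \<Rightarrow> letter3" where
  "root_rot (GA, True) = rot"
| "root_rot (GA, False) = rot \<circ> rot"
| "root_rot (GT, s) = id"

text \<open>Addition modulo 3, with \<^const>\<open>L0\<close>, \<^const>\<open>L1\<close>, \<^const>\<open>L2\<close> for the residues.\<close>

fun radd :: "letter3 \<Rightarrow> letter3 \<Rightarrow> letter3" where
  "radd L0 x = x" | "radd L1 x = rot x" | "radd L2 x = rot (rot x)"

fun gs_section_letter :: "letter3 \<Rightarrow> letter3 \<times> bool \<Rightarrow> gsgen \<times> bool" where
  "gs_section_letter x (k, s) = (if x = k then (GA, s) else if x = rot k then (GA, \<not> s) else (GT, s))"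

definition gs_section :: "letter3 \<Rightarrow> (letter3 \<times> bool) list \<Rightarrow> (gsgen \<times> bool) list" where
  "gs_section x = map (gs_section_letter x)"

fun gs_expand_letter :: "letter3 \<times> bool \<Rightarrow> (gsgen \<times> bool) list" where
  "gs_expand_letter (L0, s) = [(GT, s)]"
| "gs_expand_letter (L1, s) = [(GA, True), (GT, s), (GA, False)]"
| "gs_expand_letter (L2, s) = [(GA, True), (GA, True), (GT, s), (GA, False), (GA, False)]"

definition gs_expand :: "(letter3 \<times> bool) list \<Rightarrow> (gsgen \<times> bool) list" where
  "gs_expand \<xi> = concat (map gs_expand_letter \<xi>)"

text \<open>Rewrites a word into conjugates of \<open>t\<close> by pushing powers of \<open>a\<close> to the right; \<open>k\<close> is the exponent
modulo 3 of the power passed so far.\<close>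

fun gs_collect :: "letter3 \<Rightarrow> (gsgen \<times> bool) list \<Rightarrow> (letter3 \<times> bool) list" where
  "gs_collect k [] = []"
| "gs_collect k ((GA, s) # w) = gs_collect (if s then rot k else rot (rot k)) w"
| "gs_collect k ((GT, s) # w) = (k, s) # gs_collect k w"

text \<open>The substitution \<open>a \<mapsto> t\<^sub>0\<^sup>-\<^sup>1 t\<^sub>2, t \<mapsto> t\<^sub>1 t\<^sub>0 t\<^sub>2\<^sup>-\<^sup>1 t\<^sub>0\<close>. Its images have the sections
\<open>(a, x, y)\<close> and \<open>(t, x\<^sup>-\<^sup>1, y\<^sup>-\<^sup>2)\<close> with \<open>x = at\<close> and \<open>y = t\<^sup>-\<^sup>1a\<close>. So it lifts an element to the
first subtree while on the other two subtrees only the cyclic groups generated by \<open>x\<close> and by \<open>y\<close>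
appear. Both have order 9.\<close>

fun gs_lift :: "gsgen \<times> bool \<Rightarrow> (letter3 \<times> bool) list" where
  "gs_lift (GA, True) = [(L0, False), (L2, True)]"
| "gs_lift (GA, False) = [(L2, False), (L0, True)]"
| "gs_lift (GT, True) = [(L1, True), (L0, True), (L2, False), (L0, True)]"
| "gs_lift (GT, False) = [(L0, False), (L2, True), (L0, False), (L1, False)]"

definition gs_subst :: "(gsgen \<times> bool) list \<Rightarrow> (letter3 \<times> bool) list" where
  "gs_subst w = concat (map gs_lift w)"

definition turn :: "(letter3 \<times> bool) list \<Rightarrow> (letter3 \<times> bool) list" where
  "turn = map (\<lambda>(k, s). (rot k, s))"

lemma gs_section_simps [simp]: "gs_section x [] = []" "gs_section x (y # \<xi>) = gs_section_letter x y # gs_section x \<xi>"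
  "gs_section x (\<xi> @ \<eta>) = gs_section x \<xi> @ gs_section x \<eta>"
  by (simp_all add: gs_section_def)

lemma gs_expand_simps [simp]: "gs_expand [] = []" "gs_expand (y # \<xi>) = gs_expand_letter y @ gs_expand \<xi>"
  "gs_expand (\<xi> @ \<eta>) = gs_expand \<xi> @ gs_expand \<eta>"
  by (simp_all add: gs_expand_def)

lemma gs_subst_simps [simp]: "gs_subst [] = []" "gs_subst (x # w) = gs_lift x @ gs_subst w"
  "gs_subst (u @ v) = gs_subst u @ gs_subst v"
  by (simp_all add: gs_subst_def)

lemma turn_simps [simp]: "turn [] = []" "turn ((k, s) # \<xi>) = (rot k, s) # turn \<xi>"
  "turn (\<xi> @ \<eta>) = turn \<xi> @ turn \<eta>"
  by (simp_all add: turn_def)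

lemmas letter_cases = gs_act.cases

lemma rot_simps [simp]: "rot (rot (rot x)) = x" "rot x = rot y \<longleftrightarrow> x = y" "rot x \<noteq> x" "x \<noteq> rot x"
    "rot (rot x) \<noteq> x" "x \<noteq> rot (rot x)" "rot (rot x) = y \<longleftrightarrow> x = rot y"
  by (cases x; cases y; simp)+

lemma gs_act_bar [simp]: "gs_act x (gs_act (flip x) w) = w" "gs_act (flip x) (gs_act x w) = w"
  by (cases x rule: letter_cases; simp add: gs_a3 gs_t3)+

lemma gs_section_winv [simp]: "gs_section x (winv flip \<xi>) = winv flip (gs_section x \<xi>)"
proof (induction \<xi>)
  case (Cons y \<xi>)
  then show ?case by (cases y) simp
qed simp

lemma gs_expand_winv [simp]: "gs_expand (winv flip \<xi>) = winv flip (gs_expand \<xi>)"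
proof (induction \<xi>)
  case (Cons y \<xi>)
  then show ?case by (cases y rule: gs_expand_letter.cases) simp_all
qed simp

lemma gs_lift_bar: "gs_lift (flip x) = winv flip (gs_lift x)"
  by (cases x rule: letter_cases) simp_all

lemma gs_subst_winv [simp]: "gs_subst (winv flip w) = winv flip (gs_subst w)"
  by (induction w) (simp_all add: gs_lift_bar)

lemma gs_section_turn [simp]: "gs_section (rot x) (turn \<xi>) = gs_section x \<xi>"
proof (induction \<xi>)
  case (Cons y \<xi>)
  then show ?case by (cases y) simp
qed simp

lemma gs_section_turn': "gs_section x (turn \<xi>) = gs_section (rot (rot x)) \<xi>"
  using gs_section_turn[of "rot (rot x)" \<xi>] by (simp del: gs_section_turn)

lemma turn_winv [simp]: "turn (winv flip \<xi>) = winv flip (turn \<xi>)"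
  by (induction \<xi>) auto

lemma turn3 [simp]: "turn (turn (turn \<xi>)) = \<xi>"
  by (induction \<xi>) auto

lemma normal_act: "normal_words flip (\<lambda>w. act_word gs_act w = id)"
proof
  show "act_word gs_act (winv flip w) = id" if "act_word gs_act w = id" for w
  proof -
    have "act_word gs_act (winv flip w) (act_word gs_act w t) = t" for t
      by (induction w arbitrary: t) simp_all
    then show ?thesis using that by (simp add: fun_eq_iff)
  qed
qed (auto simp: fun_eq_iff)

lemma normal_gs_relator: "normal_words flip gs_relator"
  using normal_act by (simp add: gs_relator_def[abs_def])

lemma gs_relator_act: "act_word gs_act u = act_word gs_act v \<Longrightarrow> gs_relator u \<longleftrightarrow> gs_relator v"
  by (simp add: gs_relator_def)

lemma act_gs_collect:
  "act_word gs_act w (x # v) = act_word root_rot w x #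
     act_word gs_act (gs_section (radd k (act_word root_rot w x)) (gs_collect k w)) v"
proof (induction w arbitrary: k)
  case (Cons y w)
  have r: "radd (rot k) z = radd k (rot z)" "radd (rot (rot k)) z = radd k (rot (rot z))" for z
    by (cases k; simp)+
  show ?case
  proof (cases y rule: letter_cases)
    case 1
    then show ?thesis using Cons[of "rot k"] by (simp add: r)
  next
    case 2
    then show ?thesis using Cons[of "rot (rot k)"] by (simp add: r)
  next
    case 3
    then show ?thesis
      using Cons[of k] by (cases k; cases "act_word root_rot w x") (simp_all add: inv_gs_a)
  next
    case 4
    then show ?thesis
      using Cons[of k] by (cases k; cases "act_word root_rot w x") (simp_all add: inv_gs_a gs_a3)
  qed
qed (cases k; simp)

lemma act_Nil: "act_word gs_act w [] = []"
proof (induction w)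
  case (Cons x w)
  then show ?case by (cases x rule: letter_cases) simp_all
qed simp

lemma root_rot_of_gs_relator: "gs_relator w \<Longrightarrow> act_word root_rot w x = x"
  using act_gs_collect[of w x "[]" L0] by (simp add: gs_relator_def)

lemma gs_section_of_relator: "gs_relator w \<Longrightarrow> gs_relator (gs_section x (gs_collect L0 w))"
  using act_gs_collect[of w x _ L0] root_rot_of_gs_relator[of w x] by (simp add: gs_relator_def fun_eq_iff)

text \<open>The order of an element of the first level stabiliser can be read off its sections.\<close>

lemma act_pow:
  assumes "\<And>x. act_word root_rot u x = x" "\<And>x. (act_word gs_act (gs_section x (gs_collect L0 u)) ^^ n) = id"
  shows "(act_word gs_act u ^^ n) = id"
proof -
  have "(act_word gs_act u ^^ n) (x # t) = x # (act_word gs_act (gs_section x (gs_collect L0 u)) ^^ n) t" for x t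
    using act_gs_collect[of u _ _ L0] assms(1) by (induction n arbitrary: t) simp_all
  moreover have "(act_word gs_act u ^^ n) [] = []"
    by (induction n) (simp_all add: act_Nil)
  ultimately have "(act_word gs_act u ^^ n) t = t" for t
    using assms(2) by (cases t) simp_all
  then show ?thesis by (simp add: fun_eq_iff)
qed

lemma gs_collect_expand: "gs_collect L0 (gs_expand \<xi>) = \<xi>"
proof -
  have "gs_collect L0 (gs_expand_letter y @ w) = y # gs_collect L0 w" for y w
    by (cases y rule: gs_expand_letter.cases) simp_all
  then show ?thesis by (induction \<xi>) simp_all
qed

lemma root_rot_expand: "act_word root_rot (gs_expand \<xi>) = id"
proof (induction \<xi>)
  case (Cons y \<xi>)
  then show ?case by (cases y rule: gs_expand_letter.cases) (simp_all add: fun_eq_iff)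
qed simp

lemma gs_relator_expand_iff: "gs_relator (gs_expand \<xi>) \<longleftrightarrow> (\<forall>x. gs_relator (gs_section x \<xi>))"
proof
  show "gs_relator (gs_expand \<xi>)" if "\<forall>x. gs_relator (gs_section x \<xi>)"
    using act_pow[of "gs_expand \<xi>" 1] that by (simp add: gs_collect_expand root_rot_expand gs_relator_def)
qed (metis gs_section_of_relator gs_collect_expand)

lemma act_replicate: "act_word \<tau> (concat (replicate n w)) = act_word \<tau> w ^^ n"
  by (induction n) simp_all

text \<open>The cube of a product \<open>a\<^sup>\<plusminus>\<^sup>1t\<^sup>\<plusminus>\<^sup>1\<close> has sections conjugate to \<open>t\<^sup>\<plusminus>\<^sup>1\<close>, which have order 3.\<close>

lemma two_letters9: "act_word gs_act [x, y] ^^ 9 = id"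
proof -
  have c: "act_word gs_act u ^^ 9 = id" if "(act_word gs_act (u @ u @ u)) ^^ 3 = id" for u
  proof -
    have "act_word gs_act u ^^ 9 = (act_word gs_act u ^^ 3) ^^ 3"
      by (simp add: funpow_mult)
    also have "act_word gs_act u ^^ 3 = act_word gs_act (u @ u @ u)"
      by (simp add: numeral_3_eq_3)
    finally show ?thesis using that by (simp only:)
  qed
  have 3: "f ^^ 3 = f \<circ> (f \<circ> f)" for f :: "letter3 list \<Rightarrow> letter3 list"
    by (simp add: numeral_3_eq_3)
  show ?thesis
  proof (cases "fst x = fst y")
    case True
    show ?thesis
      by (rule c, cases x rule: letter_cases; cases y rule: letter_cases)
        (use True in \<open>simp_all add: 3 fun_eq_iff gs_a3 gs_t3\<close>)
  next
    case False
    show ?thesis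
    proof (rule c, rule act_pow)
      show "act_word root_rot ([x, y] @ [x, y] @ [x, y]) z = z" for z
        using False by (cases x rule: letter_cases; cases y rule: letter_cases) simp_all
      show "act_word gs_act (gs_section z (gs_collect L0 ([x, y] @ [x, y] @ [x, y]))) ^^ 3 = id" for z
        using False by (cases x rule: letter_cases; cases y rule: letter_cases; cases z)
          (simp_all add: 3 fun_eq_iff gs_a3 gs_t3)
    qed
  qed
qed

text \<open>Sections of a commutator of generators are products of two letters.\<close>

lemma commutator9: "act_word gs_act [x, y, flip x, flip y] ^^ 9 = id"
proof (cases "fst x = fst y")
  case True
  then have "act_word gs_act [x, y, flip x, flip y] = id"
    by (cases x rule: letter_cases; cases y rule: letter_cases) (simp_all add: fun_eq_iff gs_a3 gs_t3)
  then show ?thesis by (simp only:) (simp add: id_funpow)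
next
  case False
  show ?thesis
  proof (rule act_pow)
    show "act_word root_rot [x, y, flip x, flip y] z = z" for z
      using False by (cases x rule: letter_cases; cases y rule: letter_cases) simp_all
    have "\<exists>a b. gs_section z (gs_collect L0 [x, y, flip x, flip y]) = [a, b]" for z
      using False by (cases x rule: letter_cases; cases y rule: letter_cases) simp_all
    then show "act_word gs_act (gs_section z (gs_collect L0 [x, y, flip x, flip y])) ^^ 9 = id" for z
      using two_letters9 by metis
  qed
qed

subsection \<open>Exponent sums of relators\<close>

lemma expsum_gs_section: "expsum GA (gs_section x \<xi>) = expsum x \<xi> - expsum (rot (rot x)) \<xi>" "expsum GT (gs_section x \<xi>) = expsum (rot x) \<xi>"
proof (induction \<xi>)
  case (Cons y \<xi>)
  obtain k s where y: "y = (k, s)" by (cases y)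
  { case 1 show ?case using Cons by (cases x; cases k) (simp_all add: y) }
  { case 2 show ?case using Cons by (cases x; cases k) (simp_all add: y) }
qed simp_all

lemma expsum_gs_collect: "expsum L0 (gs_collect k w) + expsum L1 (gs_collect k w) + expsum L2 (gs_collect k w) = expsum GT w"
  by (induction k w rule: gs_collect.induct) (auto, (metis letter3.exhaust)+)

lemma expsum_turn: "expsum (rot k) (turn \<xi>) = expsum k \<xi>"
  by (induction \<xi>) auto

lemma expsum_expand: "expsum GA (gs_expand \<xi>) = 0" "expsum GT (gs_expand \<xi>) = expsum L0 \<xi> + expsum L1 \<xi> + expsum L2 \<xi>"
proof (induction \<xi>)
  case (Cons y \<xi>)
  { case 1 show ?case using Cons by (cases y rule: gs_expand_letter.cases) simp_all }
  { case 2 show ?case using Cons by (cases y rule: gs_expand_letter.cases) simp_all }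
qed simp_all

lemma expsum_gs_subst:
  "expsum k (gs_subst w) = (case k of L0 \<Rightarrow> 2 * expsum GT w - expsum GA w | L1 \<Rightarrow> expsum GT w | L2 \<Rightarrow> expsum GA w - expsum GT w)"
proof (induction w)
  case (Cons y w)
  then show ?case by (cases y rule: letter_cases) (simp_all split: letter3.splits)
qed (simp split: letter3.splits)

text \<open>Zero exponent sums: the words in the commutator subgroup of the free group.\<close>

definition balanced :: "(gsgen \<times> bool) list \<Rightarrow> bool" where
  "balanced w \<longleftrightarrow> expsum GA w = 0 \<and> expsum GT w = 0"

lemma gs_relator_expsum_GA:
  assumes "gs_relator w"
  shows "3 dvd expsum GA w"
proof -
  define idx where "idx = case_letter3 (0 :: int) 1 2"
  have idx: "3 dvd idx (rot x) - idx x - 1" for x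
    by (cases x) (simp_all add: idx_def)
  have step: "3 dvd idx (rot z) - j - (i + 1)" if "3 dvd idx z - j - i" for z j i
  proof -
    have "idx (rot z) - j - (i + 1) = (idx (rot z) - idx z - 1) + (idx z - j - i)" by simp
    then show ?thesis using idx[of z] that by (metis dvd_add)
  qed
  have "3 dvd idx (act_word root_rot w x) - idx x - expsum GA w" for x
  proof (induction w)
    case (Cons y w)
    let ?z = "act_word root_rot w x"
    show ?case
    proof (cases y rule: letter_cases)
      case 1
      then show ?thesis using step[OF Cons] by (simp add: add.commute)
    next
      case 2
      have "3 dvd (idx (rot (rot ?z)) - idx x - (expsum GA w + 1 + 1)) + 3"
        using step[OF step[OF Cons]] by (rule dvd_add) simp
      then show ?thesis using 2 by (simp add: algebra_simps)
    qed (use Cons in simp_all)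
  qed simp
  from this[of L0] show ?thesis
    using root_rot_of_gs_relator[OF assms, of L0] by (simp add: idx_def)
qed

text \<open>The exponent of \<open>a\<close> in a section is the difference of the exponents of two of the \<open>t\<^sub>k\<close>. If all these
differences are divisible by 3, so is the sum of the three exponents.\<close>

lemma gs_relator_expsum_sections:
  assumes "\<And>x. gs_relator (gs_section x \<xi>)"
  shows "3 dvd expsum L0 \<xi> + expsum L1 \<xi> + expsum L2 \<xi>"
  using gs_relator_expsum_GA[OF assms[of L0]] gs_relator_expsum_GA[OF assms[of L1]] gs_relator_expsum_GA[OF assms[of L2]]
  by (simp add: expsum_gs_section) presburger

lemma gs_relator_expsum_GT:
  assumes "gs_relator w"
  shows "3 dvd expsum GT w"
  using gs_relator_expsum_sections[OF gs_section_of_relator[OF assms]] by (simp add: expsum_gs_collect)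

lemma gs_relator_expsum_section:
  assumes "\<And>x. gs_relator (gs_section x \<xi>)"
  shows "3 dvd expsum k \<xi>"
  using gs_relator_expsum_GT[OF assms[of "rot (rot k)"]] by (simp add: expsum_gs_section)

subsection \<open>The lifting substitution\<close>

lemma act_gs_section_subst: "act_word gs_act (gs_section L0 (gs_subst w)) = act_word gs_act w"
proof (induction w)
  case (Cons x w)
  then show ?case by (cases x rule: letter_cases) (simp_all add: fun_eq_iff gs_a3)
qed simp

lemma gs_relator_section_subst [simp]: "gs_relator (gs_section L0 (gs_subst w)) \<longleftrightarrow> gs_relator w"
  by (simp add: gs_relator_def act_gs_section_subst)

text \<open>On the other two subtrees the lifts of the generators commute, so that lifts of balanced words are
trivial there.\<close>

lemma gs_relator_section_balanced:
  assumes "balanced w" "x \<noteq> L0"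
  shows "gs_relator (gs_section x (gs_subst w))"
proof -
  interpret normal_words flip "\<lambda>w. gs_relator (gs_section x (gs_subst w))"
    by (rule normal_words_hom[OF normal_gs_relator]) simp_all
  show ?thesis
  proof (rule balanced_word)
    show "gs_relator (gs_section x (gs_subst [y, z, flip y, flip z]))" for y z
      using assms(2) by (cases x; cases y rule: letter_cases; cases z rule: letter_cases)
        (simp_all add: gs_relator_def fun_eq_iff gs_a3 gs_t3)
    show "count_list w y = count_list w (flip y)" for y
    proof (rule expsum_balanced)
      show "expsum g w = 0" for g
        using assms(1) by (cases g) (simp_all add: balanced_def)
    qed
  qed simp
qed

lemma gs_relator_subst_balanced: "gs_relator w \<Longrightarrow> balanced w \<Longrightarrow> gs_relator (gs_expand (gs_subst w))"
  unfolding gs_relator_expand_iff using gs_relator_section_balanced by (metis gs_relator_section_subst)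

lemma balanced_subst: "balanced w \<Longrightarrow> balanced (gs_expand (gs_subst w))"
  by (simp add: balanced_def expsum_expand expsum_gs_subst)

definition power_word :: "'g \<Rightarrow> int \<Rightarrow> ('g \<times> bool) list" where
  "power_word g i = replicate (nat \<bar>i\<bar>) (g, 0 \<le> i)"

lemma expsum_replicate: "expsum h (replicate n (g, s)) = (if h = g then if s then int n else - int n else 0)"
  by (induction n) auto

lemma expsum_power_word [simp]: "expsum h (power_word g i) = (if h = g then i else 0)"
  by (simp add: power_word_def expsum_replicate)

lemma act_power_word: "act_word \<tau> (power_word g i) = \<tau> (g, 0 \<le> i) ^^ nat \<bar>i\<bar>"
proof -
  have "act_word \<tau> (replicate n x) = \<tau> x ^^ n" for n x
    by (induction n) simp_all
  then show ?thesis by (simp add: power_word_def)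
qed

lemma gs_relator_power_word:
  assumes "3 dvd i"
  shows "gs_relator (power_word g i)"
proof -
  obtain j where j: "nat \<bar>i\<bar> = 3 * j"
    using assms by (metis dvdE nat_abs_mult_distrib nat_abs_triangle_ineq nat_numeral abs_numeral)
  have "gs_act x ^^ 3 = id" for x
    by (cases x rule: letter_cases) (simp_all add: numeral_3_eq_3 fun_eq_iff gs_a3 gs_t3)
  then have "gs_act x ^^ (3 * j) = id" for x
    by (simp add: id_funpow flip: funpow_mult)
  then show ?thesis by (simp add: gs_relator_def act_power_word j)
qed

text \<open>The sections of the lifts at the other two subtrees are products of two letters or squares of such
products.\<close>

lemma section_power9:
  assumes "x \<noteq> L0"
  shows "act_word gs_act (gs_section x (gs_lift l)) ^^ 9 = id"
proof -
  have "\<exists>a b. act_word gs_act (gs_section x (gs_lift l)) = act_word gs_act [a, b] \<or>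
      act_word gs_act (gs_section x (gs_lift l)) = act_word gs_act [a, b] ^^ 2"
  proof (cases l rule: letter_cases)
    case 3
    show ?thesis
      by (rule exI[of _ "(if x = L1 then GT else GA, False)"], rule exI[of _ "(if x = L1 then GA else GT, x \<noteq> L1)"])
        (use assms 3 in \<open>cases x; simp add: fun_eq_iff gs_a3 gs_t3 numeral_2_eq_2\<close>)
  next
    case 4
    show ?thesis
      by (rule exI[of _ "(if x = L1 then GA else GT, x = L1)"], rule exI[of _ "(if x = L1 then GT else GA, True)"])
        (use assms 4 in \<open>cases x; simp add: fun_eq_iff gs_a3 gs_t3 numeral_2_eq_2\<close>)
  next
    case 1
    then have "\<exists>a b. gs_section x (gs_lift l) = [a, b]" by simp
    then show ?thesis by metis
  next
    case 2
    then have "\<exists>a b. gs_section x (gs_lift l) = [a, b]" by simp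
    then show ?thesis by metis
  qed
  then obtain a b where ab: "act_word gs_act (gs_section x (gs_lift l)) = act_word gs_act [a, b] \<or>
      act_word gs_act (gs_section x (gs_lift l)) = act_word gs_act [a, b] ^^ 2" by blast
  have "(f ^^ 2) ^^ 9 = id" if "f ^^ 9 = id" for f :: "letter3 list \<Rightarrow> letter3 list"
  proof -
    have "(f ^^ 2) ^^ 9 = (f ^^ 9) ^^ 2" by (simp only: funpow_mult mult.commute)
    then show ?thesis by (simp only: that id_funpow)
  qed
  then show ?thesis using ab two_letters9 by metis
qed

text \<open>The lift of a relator need not be a relator, since \<open>x\<close> and \<open>y\<close> have order 9. But the exponent sums of a
relator are divisible by 3, so those of its cube are divisible by 9.\<close>

lemma gs_relator_subst_cube:
  assumes "gs_relator w"
  shows "gs_relator (gs_expand (gs_subst (w @ w @ w)))"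
  unfolding gs_relator_expand_iff
proof
  fix x
  show "gs_relator (gs_section x (gs_subst (w @ w @ w)))"
  proof (cases "x = L0")
    case True
    then show ?thesis using assms by (simp add: gs_relator_def act_gs_section_subst)
  next
    case False
    interpret normal_words flip "\<lambda>w. gs_relator (gs_section x (gs_subst w))"
      by (rule normal_words_hom[OF normal_gs_relator]) simp_all
    have nine: "gs_relator (gs_section x (gs_subst (power_word g (9 * i))))" for g i
    proof -
      have 9: "gs_relator (gs_section x (gs_subst (concat (replicate 9 [(g, s)]))))" for s
      proof -
        have "gs_section x (gs_subst (concat (replicate n [(g, s)]))) = concat (replicate n (gs_section x (gs_lift (g, s))))" for n
          by (induction n) simp_all
        then show ?thesis
          unfolding gs_relator_def using section_power9[OF False] by (simp only: act_replicate)
      qed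
      have r: "replicate (9 * n) y = concat (replicate n (concat (replicate 9 [y])))" for n and y :: "gsgen \<times> bool"
        by (induction n) (simp_all add: replicate_add)
      have "gs_relator (gs_section x (gs_subst (concat (replicate n (concat (replicate 9 [(g, s)]))))))" for n s
      proof (induction n)
        case 0
        show ?case using empty by simp
      next
        case (Suc n)
        show ?case using app[OF 9 Suc] by (simp only: replicate_Suc concat.simps)
      qed
      moreover have "nat \<bar>9 * i\<bar> = 9 * nat \<bar>i\<bar>" by (simp add: abs_mult nat_mult_distrib)
      ultimately show ?thesis by (simp only: power_word_def r)
    qed
    obtain i j where ij: "expsum GA w = 3 * i" "expsum GT w = 3 * j"
      using gs_relator_expsum_GA[OF assms] gs_relator_expsum_GT[OF assms] by (auto elim!: dvdE)
    let ?p = "power_word GA (9 * (- i)) @ power_word GT (9 * (- j))"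
    have "balanced ((w @ w @ w) @ ?p)"
      by (simp add: balanced_def ij)
    then have "gs_relator (gs_section x (gs_subst ((w @ w @ w) @ ?p)))"
      using False by (rule gs_relator_section_balanced)
    moreover have "gs_relator (gs_section x (gs_subst ?p))"
      by (rule app[OF nine nine])
    ultimately have "gs_relator (gs_section x (gs_subst ((w @ w @ w) @ ?p @ winv flip ?p @ [])))"
      using app[OF _ winv] by (metis append_Nil2 append_assoc)
    then show ?thesis
      unfolding cancel_word by simp
  qed
qed

lemma gs_relator_append: "gs_relator u \<Longrightarrow> gs_relator v \<Longrightarrow> gs_relator (u @ v)"
  using normal_words.app[OF normal_gs_relator] .

lemma gs_relator_winv: "gs_relator u \<Longrightarrow> gs_relator (winv flip u)"
  using normal_words.winv[OF normal_gs_relator] .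

lemma gs_relator_conj: "gs_relator v \<Longrightarrow> gs_relator (w @ v @ winv flip w)"
proof (induction w)
  case (Cons y w)
  then show ?case using normal_words.conj[OF normal_gs_relator, of "w @ v @ winv flip w" y] by simp
qed simp

text \<open>Absence of 3-torsion is required for balanced relators only: this makes the conditions stable under
the substitution, which maps \<open>a\<^sup>3\<close> and \<open>t\<^sup>3\<close> to words that are not relators, but balanced relators to
balanced relators. As for the Grigorchuk group, the marked elements need not generate \<open>E\<close>.\<close>

locale gs_marking = group E for E (structure) +
  fixes m :: "gsgen \<times> bool \<Rightarrow> 'e"
  assumes m_closed [simp]: "m x \<in> carrier E"
    and m_bar: "m (flip x) = inv (m x)"
    and central: "gs_relator w \<Longrightarrow> ev E m w \<otimes> ev E m v = ev E m v \<otimes> ev E m w"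
    and no_3_torsion: "gs_relator w \<Longrightarrow> balanced w \<Longrightarrow>
        ev E m w \<otimes> (ev E m w \<otimes> ev E m w) = \<one> \<Longrightarrow> ev E m w = \<one>"
begin

sublocale word_eval E flip m
  by unfold_locales (simp_all add: m_bar)

abbreviation ex where "ex \<xi> \<equiv> e (gs_expand \<xi>)"

lemma ex_append: "ex (\<xi> @ \<eta>) = ex \<xi> \<otimes> ex \<eta>"
  by (simp add: e_append)

lemma ex_winv: "ex (winv flip \<xi>) = inv (ex \<xi>)"
  by (simp add: e_winv)

lemma ev_subst: "ev E (\<lambda>x. ex (gs_lift x)) w = ex (gs_subst w)"
  by (induction w) (simp_all add: e_append)

text \<open>A central commutator is a homomorphism in each argument.\<close>

lemma commutator_power:
  assumes [simp]: "y \<in> carrier E" "z \<in> carrier E" "k \<in> carrier E"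
    and k: "y \<otimes> z = k \<otimes> (z \<otimes> y)" "k \<otimes> y = y \<otimes> k" "k \<otimes> z = z \<otimes> k"
  shows "y [^] (n::nat) \<otimes> z = k [^] n \<otimes> (z \<otimes> y [^] n)"
proof (induction n)
  case (Suc n)
  have ky: "k [^] n \<otimes> y = y \<otimes> k [^] n" by (rule group_commutes_pow) (simp_all add: k)
  have "y [^] Suc n \<otimes> z = y [^] n \<otimes> (y \<otimes> z)" by (simp add: m_assoc)
  also have "\<dots> = y [^] n \<otimes> z \<otimes> (k \<otimes> y)"
    by (simp add: k(1) m_assoc flip: k(3)) (simp add: k(3) flip: m_assoc)
  also have "\<dots> = k [^] n \<otimes> (z \<otimes> (y [^] n \<otimes> k \<otimes> y))"
    by (simp add: Suc m_assoc)
  also have "y [^] n \<otimes> k = k \<otimes> y [^] n"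
    using group_commutes_pow[of y k n] k(2) by simp
  also have "k [^] n \<otimes> (z \<otimes> (k \<otimes> y [^] n \<otimes> y)) = k [^] n \<otimes> ((z \<otimes> k) \<otimes> (y [^] n \<otimes> y))"
    by (simp add: m_assoc)
  also have "\<dots> = k [^] Suc n \<otimes> (z \<otimes> y [^] Suc n)"
    by (simp add: m_assoc flip: k(3))
  finally show ?case .
qed simp

text \<open>If \<open>y\<close> and \<open>z\<close> commute up to the value of a balanced relator, and \<open>y\<^sup>n\<close> commutes with \<open>z\<close>, then the
\<open>n\<close>-th power of the commutator is trivial. So the commutator is trivial when \<open>n\<close> is a power of 3.\<close>

lemma commute_of_power:
  assumes [simp]: "y \<in> carrier E" "z \<in> carrier E"
    and w: "gs_relator w" "balanced w" "e w = y \<otimes> (z \<otimes> (inv y \<otimes> inv z))"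
    and cen: "e w \<otimes> y = y \<otimes> e w" "e w \<otimes> z = z \<otimes> e w"
    and n: "n = 3 \<or> n = 9" and yn: "y [^] (n::nat) \<otimes> z = z \<otimes> y [^] n"
  shows "y \<otimes> z = z \<otimes> y"
proof -
  have yz: "y \<otimes> z = e w \<otimes> (z \<otimes> y)" by (simp add: w(3) m_assoc)
  have "e w [^] n \<otimes> (z \<otimes> y [^] n) = \<one> \<otimes> (z \<otimes> y [^] n)"
    using commutator_power[OF _ _ _ yz cen, of n] yn by simp
  then have k: "e w [^] n = \<one>" by (subst (asm) right_cancel) simp_all
  have 3: "e u = \<one>" if "e u [^] (3::nat) = \<one>" "gs_relator u" "balanced u" for u
    using that by (intro no_3_torsion) (simp_all add: numeral_3_eq_3 m_assoc)
  have "e w = \<one>"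
    using n
  proof
    assume "n = 3"
    then show ?thesis using 3[OF _ w(1,2)] k by blast
  next
    assume "n = 9"
    have "e (w @ w @ w) = e w [^] (3::nat)"
      by (simp add: e_append numeral_3_eq_3 m_assoc)
    moreover have "(e w [^] (3::nat)) [^] (3::nat) = \<one>"
      using k \<open>n = 9\<close> by (simp add: nat_pow_pow)
    ultimately have "e (w @ w @ w) = \<one>"
      using w by (intro 3) (simp_all add: gs_relator_append balanced_def)
    then have "e w [^] (3::nat) = \<one>" by (simp add: e_append numeral_3_eq_3 m_assoc)
    then show ?thesis using w(1,2) by (rule 3)
  qed
  then show ?thesis using yz by simp
qed

lemma gs_relator_subst_commutator:
  assumes "gs_relator w"
  shows "gs_relator (gs_expand (gs_subst (w @ v @ winv flip w @ winv flip v)))"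
proof -
  have "gs_relator (w @ (v @ winv flip w @ winv flip v))"
    using assms gs_relator_append gs_relator_conj gs_relator_winv by blast
  then show ?thesis
    by (intro gs_relator_subst_balanced) (simp_all add: balanced_def)
qed

text \<open>The lift of a relator commutes with other lifts up to a balanced relator, and its cube is the lift
of a cube, hence central.\<close>

lemma gs_marking_subst: "gs_marking E (\<lambda>x. ex (gs_lift x))"
proof unfold_locales
  show "ex (gs_lift (flip x)) = inv ex (gs_lift x)" for x
    by (simp add: gs_lift_bar e_winv)
  show "ev E (\<lambda>x. ex (gs_lift x)) w \<otimes> ev E (\<lambda>x. ex (gs_lift x)) v =
      ev E (\<lambda>x. ex (gs_lift x)) v \<otimes> ev E (\<lambda>x. ex (gs_lift x)) w" if "gs_relator w" for w v
    unfolding ev_subst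
  proof (rule commute_of_power)
    let ?w = "gs_expand (gs_subst (w @ v @ winv flip w @ winv flip v))"
    show rel: "gs_relator ?w" by (rule gs_relator_subst_commutator[OF that])
    show "balanced ?w" by (rule balanced_subst) (simp add: balanced_def)
    show "e ?w = ex (gs_subst w) \<otimes> (ex (gs_subst v) \<otimes> (inv ex (gs_subst w) \<otimes> inv ex (gs_subst v)))"
      by (simp add: e_append e_winv)
    show "e ?w \<otimes> ex (gs_subst w) = ex (gs_subst w) \<otimes> e ?w" "e ?w \<otimes> ex (gs_subst v) = ex (gs_subst v) \<otimes> e ?w"
      by (rule central[OF rel])+
    have "ex (gs_subst w) [^] (3::nat) = e (gs_expand (gs_subst (w @ w @ w)))"
      by (simp add: e_append numeral_3_eq_3 m_assoc)
    then show "ex (gs_subst w) [^] (3::nat) \<otimes> ex (gs_subst v) = ex (gs_subst v) \<otimes> ex (gs_subst w) [^] (3::nat)"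
      using central[OF gs_relator_subst_cube[OF that]] by simp
  qed simp_all
  show "ev E (\<lambda>x. ex (gs_lift x)) w = \<one>"
    if "gs_relator w" "balanced w" "ev E (\<lambda>x. ex (gs_lift x)) w \<otimes>
      (ev E (\<lambda>x. ex (gs_lift x)) w \<otimes> ev E (\<lambda>x. ex (gs_lift x)) w) = \<one>" for w
    using that no_3_torsion[OF gs_relator_subst_balanced balanced_subst] unfolding ev_subst by blast
qed simp_all

end

lemma winv_winv [simp]: "winv flip (winv flip w) = w"
  by (induction w) simp_all

text \<open>Conjugation by \<open>a\<^sup>k\<close>, which moves the first subtree to the subtree at \<open>k\<close>.\<close>

fun turn_by :: "letter3 \<Rightarrow> (letter3 \<times> bool) list \<Rightarrow> (letter3 \<times> bool) list" where
  "turn_by L0 \<xi> = \<xi>" | "turn_by L1 \<xi> = turn \<xi>" | "turn_by L2 \<xi> = turn (turn \<xi>)"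

lemma turn_by_simps [simp]: "turn_by k [] = []" "turn_by k (\<xi> @ \<eta>) = turn_by k \<xi> @ turn_by k \<eta>"
  "turn_by k (winv flip \<xi>) = winv flip (turn_by k \<xi>)"
  by (cases k; simp)+

lemma gs_section_turn_by_same: "gs_section k (turn_by k \<xi>) = gs_section L0 \<xi>"
  using gs_section_turn[of L0] gs_section_turn[of L1] by (cases k) simp_all

definition conj_balanced :: "(letter3 \<times> bool) list \<Rightarrow> bool" where
  "conj_balanced \<xi> \<longleftrightarrow> (\<forall>k. expsum k \<xi> = 0)"

lemma balanced_gs_section: "conj_balanced \<xi> \<Longrightarrow> balanced (gs_section x \<xi>)"
  by (simp add: conj_balanced_def balanced_def expsum_gs_section)

lemma gs_relator_turn_by_other:
  assumes "balanced v" "j \<noteq> k"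
  shows "gs_relator (gs_section j (turn_by k (gs_subst v)))"
  using assms(2) by (cases j; cases k) (simp_all add: gs_section_turn' gs_relator_section_balanced[OF assms(1)])

lemma conj_balanced_simps:
  "conj_balanced []" "conj_balanced u \<Longrightarrow> conj_balanced v \<Longrightarrow> conj_balanced (u @ v)" "conj_balanced u \<Longrightarrow> conj_balanced (winv flip u)"
  "conj_balanced u \<Longrightarrow> conj_balanced (x # u @ [flip x])" "conj_balanced (u @ x # flip x # v) \<longleftrightarrow> conj_balanced (u @ v)"
proof -
  obtain g s where x: "x = (g, s)" by (cases x)
  show "conj_balanced []" "conj_balanced u \<Longrightarrow> conj_balanced v \<Longrightarrow> conj_balanced (u @ v)" "conj_balanced u \<Longrightarrow> conj_balanced (winv flip u)"
    by (simp_all add: conj_balanced_def)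
  have "expsum k (x # flip x # v) = expsum k v" "expsum k (x # u @ [flip x]) = expsum k u" for k
    by (simp_all add: x)
  then show "conj_balanced u \<Longrightarrow> conj_balanced (x # u @ [flip x])" "conj_balanced (u @ x # flip x # v) \<longleftrightarrow> conj_balanced (u @ v)"
    by (simp_all only: conj_balanced_def expsum_simps(3) simp_thms)
qed

lemma conj_balanced_turn_by: "balanced v \<Longrightarrow> conj_balanced (turn_by k (gs_subst v))"
proof -
  assume v: "balanced v"
  have t: "conj_balanced (turn \<xi>)" if "conj_balanced \<xi>" for \<xi>
    unfolding conj_balanced_def
  proof
    fix k
    show "expsum k (turn \<xi>) = 0"
      using expsum_turn[of "rot (rot k)" \<xi>] that by (simp add: conj_balanced_def)
  qed
  have "conj_balanced (gs_subst v)"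
    using v by (simp add: conj_balanced_def expsum_gs_subst balanced_def split: letter3.splits)
  then show ?thesis using t by (cases k) simp_all
qed

context gs_marking
begin

lemma inv_m: "m (GA, False) = inv (m (GA, True))"
  using m_bar[of "(GA, True)"] by simp

text \<open>Indices are taken modulo 3, which is justified because \<open>a\<^sup>3\<close> is a relator and so has a central value.\<close>

lemma ex_turn: "ex (turn \<xi>) = m (GA, True) \<otimes> (ex \<xi> \<otimes> inv (m (GA, True)))"
proof (induction \<xi>)
  case (Cons y \<xi>)
  let ?a = "m (GA, True)"
  have "gs_relator [(GA, True), (GA, True), (GA, True)]"
    by (simp add: gs_relator_def fun_eq_iff gs_a3)
  from central[OF this] have a3: "?a \<otimes> (?a \<otimes> (?a \<otimes> e w)) = e w \<otimes> (?a \<otimes> (?a \<otimes> ?a))" for w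
    by (simp add: m_assoc)
  have "?a \<otimes> (?a \<otimes> (?a \<otimes> (m (GT, s) \<otimes> (inv ?a \<otimes> (inv ?a \<otimes> inv ?a))))) = m (GT, s)" for s
  proof -
    have "?a \<otimes> (?a \<otimes> (?a \<otimes> (m (GT, s) \<otimes> (inv ?a \<otimes> (inv ?a \<otimes> inv ?a))))) =
        (?a \<otimes> (?a \<otimes> (?a \<otimes> m (GT, s)))) \<otimes> (inv ?a \<otimes> (inv ?a \<otimes> inv ?a))"
      by (simp add: m_assoc)
    also have "\<dots> = (m (GT, s) \<otimes> (?a \<otimes> (?a \<otimes> ?a))) \<otimes> (inv ?a \<otimes> (inv ?a \<otimes> inv ?a))"
      using a3[of "[(GT, s)]"] by simp
    finally show ?thesis by (simp add: m_assoc)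
  qed
  then have "e (gs_expand_letter (rot k, s)) = ?a \<otimes> (e (gs_expand_letter (k, s)) \<otimes> inv ?a)" for k s
    by (cases k) (simp_all add: inv_m m_assoc)
  then show ?case
    using Cons by (cases y) (simp add: e_append m_assoc)
qed simp

text \<open>The values of the words that act trivially on the first subtree.\<close>

definition third where "third = {ex \<zeta> |\<zeta>. gs_relator (gs_section L0 \<zeta>)}"

lemma normal_commuting:
  "normal_words flip (\<lambda>w. \<forall>z\<in>third. ex (gs_subst w) \<otimes> z = z \<otimes> ex (gs_subst w))"
proof (rule normal_centralizing)
  show "inv ex (gs_subst [x]) \<otimes> (z \<otimes> ex (gs_subst [x])) \<in> third" if z: "z \<in> third" for x z
  proof -
    obtain \<zeta> where \<zeta>: "z = ex \<zeta>" "gs_relator (gs_section L0 \<zeta>)"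
      using z by (auto simp: third_def)
    let ?\<zeta> = "winv flip (gs_subst [x]) @ \<zeta> @ gs_subst [x]"
    have "gs_relator (gs_section L0 ?\<zeta>)"
      using gs_relator_conj[OF \<zeta>(2), of "winv flip (gs_section L0 (gs_subst [x]))"] by simp
    moreover have "inv ex (gs_subst [x]) \<otimes> (z \<otimes> ex (gs_subst [x])) = ex ?\<zeta>"
      by (simp only: \<zeta> ex_append ex_winv)
    ultimately show ?thesis unfolding third_def by blast
  qed
qed (auto simp: third_def)

text \<open>In the tree, the lift of a balanced word acts on the first subtree only, so it commutes with
everything that acts trivially there. For the lift of a commutator of generators, this carries over
to \<open>E\<close> because the commutator has order 9 in the tree. These commutators generate the balanced words
as a normal subgroup.\<close>

lemma rigid_commutes:
  assumes v: "balanced v" and \<zeta>: "gs_relator (gs_section L0 \<zeta>)"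
  shows "ex (gs_subst v) \<otimes> ex \<zeta> = ex \<zeta> \<otimes> ex (gs_subst v)"
proof -
  interpret N: normal_words flip "\<lambda>w. \<forall>z\<in>third. ex (gs_subst w) \<otimes> z = z \<otimes> ex (gs_subst w)"
    by (rule normal_commuting)
  have "\<forall>z\<in>third. ex (gs_subst v) \<otimes> z = z \<otimes> ex (gs_subst v)"
  proof (rule N.balanced_word)
    show "count_list v y = count_list v (flip y)" for y
    proof (rule expsum_balanced)
      show "expsum g v = 0" for g using v by (cases g) (simp_all add: balanced_def)
    qed
    show "\<forall>z\<in>third. ex (gs_subst [x, y, flip x, flip y]) \<otimes> z = z \<otimes> ex (gs_subst [x, y, flip x, flip y])" for x y
    proof
      fix z assume "z \<in> third"
      then obtain \<zeta> where z0: "z = ex \<zeta>" and z: "gs_relator (gs_section L0 \<zeta>)"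
        by (auto simp: third_def)
      define c where "c = [x, y, flip x, flip y]"
      have c: "balanced c" by (cases x; cases y) (simp add: c_def balanced_def)
      let ?w = "gs_expand (gs_subst c @ \<zeta> @ winv flip (gs_subst c) @ winv flip \<zeta>)"
      have rel: "gs_relator ?w"
        unfolding gs_relator_expand_iff
      proof
        fix j
        show "gs_relator (gs_section j (gs_subst c @ \<zeta> @ winv flip (gs_subst c) @ winv flip \<zeta>))"
        proof (cases "j = L0")
          case True
          have "gs_relator ((gs_section L0 (gs_subst c) @ gs_section L0 \<zeta> @ winv flip (gs_section L0 (gs_subst c))) @ winv flip (gs_section L0 \<zeta>))"
            by (intro gs_relator_append gs_relator_conj gs_relator_winv z)
          then show ?thesis using True by simp
        next
          case False
          have "gs_relator (gs_section j (gs_subst c) @ (gs_section j \<zeta> @ winv flip (gs_section j (gs_subst c)) @ winv flip (gs_section j \<zeta>)))"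
            by (intro gs_relator_append gs_relator_conj gs_relator_winv gs_relator_section_balanced[OF c False])
          then show ?thesis by simp
        qed
      qed
      have "ex (gs_subst c) \<otimes> ex \<zeta> = ex \<zeta> \<otimes> ex (gs_subst c)"
      proof (rule commute_of_power[where w = ?w and n = 9])
        show "balanced ?w"
          by (simp add: balanced_def expsum_expand)
        show "e ?w = ex (gs_subst c) \<otimes> (ex \<zeta> \<otimes> (inv ex (gs_subst c) \<otimes> inv ex \<zeta>))"
          by (simp add: e_append e_winv)
        show "e ?w \<otimes> ex (gs_subst c) = ex (gs_subst c) \<otimes> e ?w" "e ?w \<otimes> ex \<zeta> = ex \<zeta> \<otimes> e ?w"
          by (rule central[OF rel])+
        let ?c9 = "concat (replicate 9 c)"
        have "gs_expand (gs_subst (concat (replicate n c))) = concat (replicate n (gs_expand (gs_subst c)))" for n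
          by (induction n) simp_all
        then have "e (gs_expand (gs_subst ?c9)) = ex (gs_subst c) [^] (9::nat)"
          by (simp only:) (rule ev_replicate, auto)
        moreover have "gs_relator (gs_expand (gs_subst ?c9))"
        proof (rule gs_relator_subst_balanced)
          show "gs_relator ?c9" unfolding gs_relator_def act_replicate c_def by (rule commutator9)
          have "balanced (concat (replicate n c))" for n
            using c by (induction n) (simp_all add: balanced_def)
          then show "balanced ?c9" .
        qed
        ultimately show "ex (gs_subst c) [^] (9::nat) \<otimes> ex \<zeta> = ex \<zeta> \<otimes> ex (gs_subst c) [^] (9::nat)"
          using central by metis
      qed (use rel in simp_all)
      then show "ex (gs_subst [x, y, flip x, flip y]) \<otimes> z = z \<otimes> ex (gs_subst [x, y, flip x, flip y])"
        by (simp only: c_def z0)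
    qed
  qed simp
  then show ?thesis using \<zeta> unfolding third_def by blast
qed

lemma rigid_commutes_turn_by:
  assumes v: "balanced v" and \<zeta>: "gs_relator (gs_section k \<zeta>)"
  shows "ex (turn_by k (gs_subst v)) \<otimes> ex \<zeta> = ex \<zeta> \<otimes> ex (turn_by k (gs_subst v))"
proof -
  have step: "ex (turn \<eta>) \<otimes> ex \<zeta> = ex \<zeta> \<otimes> ex (turn \<eta>)"
    if "\<And>\<zeta>. gs_relator (gs_section j \<zeta>) \<Longrightarrow> ex \<eta> \<otimes> ex \<zeta> = ex \<zeta> \<otimes> ex \<eta>" "gs_relator (gs_section (rot j) \<zeta>)" for j \<eta> \<zeta>
  proof -
    let ?\<zeta> = "turn (turn \<zeta>)" and ?a = "m (GA, True)"
    have z: "ex \<zeta> = ?a \<otimes> (ex ?\<zeta> \<otimes> inv ?a)"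
      using ex_turn[of ?\<zeta>] by (simp only: turn3)
    have "gs_relator (gs_section j ?\<zeta>)"
      using that(2) gs_section_turn[of j ?\<zeta>] by simp
    from that(1)[OF this] have "?a \<otimes> (ex \<eta> \<otimes> ex ?\<zeta>) \<otimes> inv ?a = ?a \<otimes> (ex ?\<zeta> \<otimes> ex \<eta>) \<otimes> inv ?a"
      by (simp only:)
    then show ?thesis unfolding z ex_turn[of \<eta>] by (simp add: m_assoc del: gs_expand_simps)
  qed
  have 0: "ex (gs_subst v) \<otimes> ex \<zeta> = ex \<zeta> \<otimes> ex (gs_subst v)" if "gs_relator (gs_section L0 \<zeta>)" for \<zeta>
    by (rule rigid_commutes[OF v that])
  have 1: "ex (turn (gs_subst v)) \<otimes> ex \<zeta> = ex \<zeta> \<otimes> ex (turn (gs_subst v))" if "gs_relator (gs_section L1 \<zeta>)" for \<zeta>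
    by (rule step[OF 0, of L0]) (use that in simp_all)
  have 2: "ex (turn (turn (gs_subst v))) \<otimes> ex \<zeta> = ex \<zeta> \<otimes> ex (turn (turn (gs_subst v)))" if "gs_relator (gs_section L2 \<zeta>)" for \<zeta>
    by (rule step[OF 1, of L1]) (use that in simp_all)
  show ?thesis using \<zeta> 0 1 2 by (cases k) simp_all
qed

end

lemma (in group) int_pow_step:
  assumes "x \<in> carrier G"
  shows "x [^] (1 + i :: int) = x \<otimes> x [^] i" "x [^] (i - 1 :: int) = inv x \<otimes> x [^] i"
    "x [^] i \<otimes> x = x \<otimes> x [^] (i :: int)"
proof -
  show 1: "x [^] (1 + i :: int) = x \<otimes> x [^] i"
    using int_pow_mult[OF assms, of 1 i] assms by simp
  have "x [^] (-1 :: int) = inv x"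
    using int_pow_neg[OF assms, of 1] assms by simp
  then have "x [^] (- 1 + i :: int) = inv x \<otimes> x [^] i"
    using int_pow_mult[OF assms, of "-1" i] by simp
  then show "x [^] (i - 1 :: int) = inv x \<otimes> x [^] i" by simp
  show "x [^] i \<otimes> x = x \<otimes> x [^] (i :: int)"
    using int_pow_mult[OF assms, of i 1] 1 assms by (simp add: add.commute)
qed

context gs_marking
begin

lemma ex_turn_by_cong: "ex u = ex v \<Longrightarrow> ex (turn_by k u) = ex (turn_by k v)"
  by (cases k) (simp_all add: ex_turn)

text \<open>The lift of the section of \<open>\<xi>\<close> at \<open>k\<close>, moved to the subtree at \<open>k\<close>.\<close>

definition gs_part where "gs_part k \<xi> = ex (turn_by k (gs_subst (gs_section k \<xi>)))"

lemma gs_part_closed [simp]: "gs_part k \<xi> \<in> carrier E"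
  by (simp add: gs_part_def)

lemma gs_part_append: "gs_part k (\<xi> @ \<eta>) = gs_part k \<xi> \<otimes> gs_part k \<eta>"
  by (simp add: gs_part_def e_append)

lemma gs_part_winv: "gs_part k (winv flip \<xi>) = inv (gs_part k \<xi>)"
  by (simp add: gs_part_def e_winv)

lemma gs_part_Nil [simp]: "gs_part k [] = \<one>"
  by (simp add: gs_part_def)

lemma gs_part_commute:
  assumes "conj_balanced \<xi>" "conj_balanced \<eta>" "j \<noteq> k"
  shows "gs_part j \<xi> \<otimes> gs_part k \<eta> = gs_part k \<eta> \<otimes> gs_part j \<xi>"
  unfolding gs_part_def using assms by (intro rigid_commutes_turn_by gs_relator_turn_by_other balanced_gs_section)

text \<open>On the subtree at \<open>k\<close>, conjugation by \<open>g\<close> and by the part \<open>t\<close> of \<open>g\<close> at \<open>k\<close> have the same effect. Their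
quotient acts trivially there, so it commutes with the part of \<open>\<xi>\<close> at \<open>k\<close>.\<close>

lemma gs_part_conj:
  assumes "conj_balanced \<xi>"
  shows "gs_part k ([g] @ \<xi> @ [flip g]) = ex [g] \<otimes> (gs_part k \<xi> \<otimes> inv (ex [g]))"
proof -
  define t where "t = gs_part k [g]"
  define x where "x = ex [g]"
  define s where "s = gs_part k \<xi>"
  have [simp]: "t \<in> carrier E" "x \<in> carrier E" "s \<in> carrier E"
    by (simp_all add: t_def x_def s_def del: gs_expand_simps)
  have bar: "[flip g] = winv flip [g]" by simp
  let ?\<zeta> = "winv flip [g] @ turn_by k (gs_subst (gs_section k [g]))"
  have "act_word gs_act (gs_section k ?\<zeta>) = act_word gs_act (winv flip (gs_section k [g]) @ gs_section k [g] @ [])"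
    unfolding gs_section_simps(3) gs_section_turn_by_same gs_section_winv act_word_append act_gs_section_subst by simp
  moreover have "gs_relator (winv flip (gs_section k [g]) @ gs_section k [g] @ [])"
    using normal_words.cancel_word'[OF normal_gs_relator, of "[]" "gs_section k [g]" "[]"]
      normal_words.empty[OF normal_gs_relator] by simp
  ultimately have "gs_relator (gs_section k ?\<zeta>)"
    using gs_relator_act by blast
  then have "s \<otimes> (inv x \<otimes> t) = (inv x \<otimes> t) \<otimes> s"
    using rigid_commutes_turn_by[OF balanced_gs_section[OF assms], of k ?\<zeta>]
    by (simp only: ex_append ex_winv s_def t_def x_def gs_part_def)
  then have "x \<otimes> (s \<otimes> (inv x \<otimes> t)) \<otimes> inv t = x \<otimes> ((inv x \<otimes> t) \<otimes> s) \<otimes> inv t"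
    by (simp only:)
  then have "t \<otimes> (s \<otimes> inv t) = x \<otimes> (s \<otimes> inv x)"
    by (simp add: m_assoc)
  then show ?thesis
    unfolding bar gs_part_append gs_part_winv by (simp only: t_def x_def s_def)
qed

lemma commutator_one:
  "a \<in> carrier E \<Longrightarrow> b \<in> carrier E \<Longrightarrow> a \<otimes> b = b \<otimes> a \<Longrightarrow> a \<otimes> (b \<otimes> (inv a \<otimes> inv b)) = \<one>"
proof -
  assume [simp]: "a \<in> carrier E" "b \<in> carrier E" and ab: "a \<otimes> b = b \<otimes> a"
  have "a \<otimes> (b \<otimes> (inv a \<otimes> inv b)) = (a \<otimes> b) \<otimes> (inv a \<otimes> inv b)" by (simp add: m_assoc)
  then show ?thesis unfolding ab by (simp add: m_assoc)
qed

definition gs_parts where "gs_parts \<xi> = gs_part L0 \<xi> \<otimes> (gs_part L1 \<xi> \<otimes> gs_part L2 \<xi>)"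

lemma gs_parts_closed [simp]: "gs_parts \<xi> \<in> carrier E"
  by (simp add: gs_parts_def)

lemma gs_parts_append:
  assumes "conj_balanced \<xi>" "conj_balanced \<eta>"
  shows "gs_parts (\<xi> @ \<eta>) = gs_parts \<xi> \<otimes> gs_parts \<eta>"
proof -
  have 10: "gs_part L0 \<eta> \<otimes> gs_part L1 \<xi> = gs_part L1 \<xi> \<otimes> gs_part L0 \<eta>" and 20: "gs_part L0 \<eta> \<otimes> gs_part L2 \<xi> = gs_part L2 \<xi> \<otimes> gs_part L0 \<eta>"
    and 21: "gs_part L1 \<eta> \<otimes> gs_part L2 \<xi> = gs_part L2 \<xi> \<otimes> gs_part L1 \<eta>"
    by (rule gs_part_commute[OF assms(2,1)]; simp)+
  have "gs_parts (\<xi> @ \<eta>) = gs_part L0 \<xi> \<otimes> ((gs_part L0 \<eta> \<otimes> gs_part L1 \<xi>) \<otimes> ((gs_part L1 \<eta> \<otimes> gs_part L2 \<xi>) \<otimes> gs_part L2 \<eta>))"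
    by (simp add: gs_parts_def gs_part_append m_assoc)
  also have "\<dots> = gs_part L0 \<xi> \<otimes> (gs_part L1 \<xi> \<otimes> ((gs_part L0 \<eta> \<otimes> gs_part L2 \<xi>) \<otimes> (gs_part L1 \<eta> \<otimes> gs_part L2 \<eta>)))"
    unfolding 10 21 by (simp add: m_assoc)
  also have "\<dots> = gs_parts \<xi> \<otimes> gs_parts \<eta>"
    unfolding 20 by (simp add: gs_parts_def m_assoc)
  finally show ?thesis .
qed

lemma gs_parts_winv:
  assumes "conj_balanced \<xi>"
  shows "gs_parts (winv flip \<xi>) = inv (gs_parts \<xi>)"
proof -
  have "gs_parts (winv flip \<xi>) \<otimes> gs_parts \<xi> = \<one>"
    using gs_parts_append[OF conj_balanced_simps(3)[OF assms] assms]
    by (simp add: gs_parts_def gs_part_append gs_part_winv)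
  then show ?thesis by (simp add: inv_equality)
qed

lemma gs_parts_conj:
  assumes "conj_balanced \<xi>"
  shows "gs_parts ([g] @ \<xi> @ [flip g]) = ex [g] \<otimes> (gs_parts \<xi> \<otimes> inv (ex [g]))"
  unfolding gs_parts_def gs_part_conj[OF assms] by (simp add: m_assoc del: gs_expand_simps)

lemma gs_part_cancel: "gs_part k (u @ x # flip x # v) = gs_part k (u @ v)"
proof -
  have "u @ x # flip x # v = u @ [x] @ winv flip [x] @ v" by simp
  then show ?thesis by (simp only: gs_part_append gs_part_winv) simp
qed

lemma ex_cancel: "ex (u @ x # flip x # v) = ex (u @ v)"
proof -
  have "u @ x # flip x # v = u @ [x] @ winv flip [x] @ v" by simp
  then show ?thesis by (simp only: ex_append ex_winv) (simp del: gs_expand_simps)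
qed

lemma gs_parts_cancel: "gs_parts (u @ x # flip x # v) = gs_parts (u @ v)"
  by (simp only: gs_parts_def gs_part_cancel)

text \<open>As for the Grigorchuk group, the words that split form the kernel of a conjugation invariant
homomorphism from the words with zero exponent sums to the values of balanced relators.\<close>

definition splits where "splits \<xi> \<longleftrightarrow> conj_balanced \<xi> \<and> ex \<xi> = gs_parts \<xi>"

lemma normal_splits: "normal_words flip splits"
proof
  show "splits (u @ v)" if "splits u" "splits v" for u v
    using that by (simp add: splits_def conj_balanced_simps gs_parts_append e_append)
  show "splits (winv flip u)" if "splits u" for u
    using that by (simp add: splits_def conj_balanced_simps gs_parts_winv e_winv)
  show "splits (x # u @ [flip x])" if "splits u" for x u
  proof -
    have "ex ([x] @ u @ winv flip [x]) = ex [x] \<otimes> (ex u \<otimes> inv (ex [x]))"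
      by (simp only: ex_append ex_winv)
    then show ?thesis
      using that gs_parts_conj[of u x] by (simp add: splits_def conj_balanced_simps del: gs_expand_simps)
  qed
  show "splits (u @ x # flip x # v) \<longleftrightarrow> splits (u @ v)" for u x v
    by (simp only: splits_def conj_balanced_simps ex_cancel gs_parts_cancel)
qed (simp_all add: splits_def conj_balanced_simps gs_parts_def)

text \<open>Let \<open>k\<close> be the error term of the commutator \<open>[x, y]\<close>. The commutator \<open>[x\<^sup>3, y]\<close> is a product of three
conjugates of \<open>[x, y]\<close>, so its error term is \<open>k\<^sup>3\<close>. But \<open>x\<^sup>3\<close> is a relator and central, as are the lifts
of the cubes of its sections, which are again cubes of generators. So \<open>[x\<^sup>3, y]\<close> and its parts are
trivial, hence \<open>k\<^sup>3 = 1\<close>, and \<open>k = 1\<close>.\<close>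

lemma splits_commutator: "splits [x, y, flip x, flip y]"
proof -
  let ?c = "[x, y, flip x, flip y]"
  have c: "conj_balanced ?c" by (cases x; cases y) (simp add: conj_balanced_def)
  define R where "R = ex ?c"
  define P where "P = gs_parts ?c"
  define X where "X = ex [x]"
  have [simp]: "R \<in> carrier E" "P \<in> carrier E" "X \<in> carrier E"
    by (simp_all add: R_def P_def X_def del: gs_expand_simps)
  define W where "W = gs_expand (winv flip ?c @ turn_by L0 (gs_subst (gs_section L0 ?c)) @
      turn_by L1 (gs_subst (gs_section L1 ?c)) @ turn_by L2 (gs_subst (gs_section L2 ?c)))"
  define k where "k = inv R \<otimes> P"
  have [simp]: "k \<in> carrier E" by (simp add: k_def)
  have kW: "k = e W"
    unfolding W_def k_def R_def P_def gs_parts_def gs_part_def by (simp only: ex_append ex_winv)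
  have W: "gs_relator W"
    unfolding W_def gs_relator_expand_iff
  proof
    fix j
    let ?w = "gs_section j ?c" and ?s = "\<lambda>k. gs_section j (turn_by k (gs_subst (gs_section k ?c)))"
    have o: "act_word gs_act (?s k) = id" if "j \<noteq> k" for k
      using gs_relator_turn_by_other[OF balanced_gs_section[OF c] that] by (simp add: gs_relator_def)
    have s: "act_word gs_act (?s j) = act_word gs_act ?w"
      unfolding gs_section_turn_by_same act_gs_section_subst ..
    have "act_word gs_act (gs_section j (winv flip ?c @ turn_by L0 (gs_subst (gs_section L0 ?c)) @
      turn_by L1 (gs_subst (gs_section L1 ?c)) @ turn_by L2 (gs_subst (gs_section L2 ?c)))) = act_word gs_act (winv flip ?w @ ?w)"
      using o[of L0] o[of L1] o[of L2] s unfolding gs_section_simps(3) gs_section_winv act_word_append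
      by (cases j) (simp_all only: letter3.distinct simp_thms comp_id id_comp)
    then show "gs_relator (gs_section j (winv flip ?c @ turn_by L0 (gs_subst (gs_section L0 ?c)) @
      turn_by L1 (gs_subst (gs_section L1 ?c)) @ turn_by L2 (gs_subst (gs_section L2 ?c))))"
      using normal_words.cancel_word'[OF normal_gs_relator, of "[]" ?w "[]"] normal_words.empty[OF normal_gs_relator]
      unfolding gs_relator_def by simp
  qed
  have balW: "balanced W"
  proof -
    have "conj_balanced (winv flip ?c @ turn_by L0 (gs_subst (gs_section L0 ?c)) @
      turn_by L1 (gs_subst (gs_section L1 ?c)) @ turn_by L2 (gs_subst (gs_section L2 ?c)))"
      by (intro conj_balanced_simps conj_balanced_turn_by balanced_gs_section c)
    then show ?thesis unfolding W_def by (simp only: balanced_def expsum_expand conj_balanced_def) simp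
  qed
  have kz: "k \<otimes> e v = e v \<otimes> k" for v
    unfolding kW by (rule central[OF W])
  have kX: "k \<otimes> X = X \<otimes> k" and kR: "k \<otimes> R = R \<otimes> k" and kX': "k \<otimes> inv X = inv X \<otimes> k"
    using kz[of "gs_expand [x]"] kz[of "gs_expand ?c"] kz[of "winv flip (gs_expand [x])"]
    by (simp_all only: X_def R_def e_winv)
  let ?cube = "[x, x, x, y, flip x, flip x, flip x, flip y]"
  \<comment> \<open>The commutator of \<open>x\<^sup>3\<close> and \<open>y\<close>, as a word and as a product of conjugates of \<open>[x, y]\<close>.\<close>
  let ?d = "([x] @ ([x] @ ?c @ [flip x]) @ [flip x]) @ ([x] @ ?c @ [flip x]) @ ?c"
  have x3: "gs_relator [z, z, z]" for z
    by (cases z rule: letter_cases) (simp_all add: gs_relator_def fun_eq_iff gs_a3 gs_t3)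
  have red: "f ?d = f ?cube" if "\<And>u x v. f (u @ x # flip x # v) = f (u @ v)"
    for f :: "(letter3 \<times> bool) list \<Rightarrow> 'e"
  proof -
    have "f ?d = f ([x, x, x, y, flip x, flip y, flip x] @ [x, y, flip x, flip y, flip x] @ [x, y, flip x, flip y])"
      using that[of "[x, x, x, y, flip x, flip y, flip x]" "flip x" "[x, y, flip x, flip y, flip x] @ ?c"]
      by simp
    also have "\<dots> = f ([x, x, x, y, flip x, flip y] @ [y, flip x, flip y, flip x] @ [x, y, flip x, flip y])"
      using that[of "[x, x, x, y, flip x, flip y]" "flip x" "[y, flip x, flip y, flip x] @ ?c"] by simp
    also have "\<dots> = f ([x, x, x, y, flip x] @ [flip x, flip y, flip x] @ [x, y, flip x, flip y])"
      using that[of "[x, x, x, y, flip x]" "flip y" "[flip x, flip y, flip x] @ ?c"] by simp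
    also have "\<dots> = f ([x, x, x, y, flip x, flip x] @ [flip y] @ [y, flip x, flip y])"
      using that[of "[x, x, x, y, flip x, flip x, flip y]" "flip x" "[y, flip x, flip y]"] by simp
    also have "\<dots> = f ?cube"
      using that[of "[x, x, x, y, flip x, flip x]" "flip y" "[flip x, flip y]"] by simp
    finally show ?thesis .
  qed
  have exd: "ex ?cube = \<one>"
  proof -
    have "gs_relator (gs_expand [x, x, x])"
      unfolding gs_relator_expand_iff by (simp add: x3)
    from central[OF this, of "gs_expand [y]"]
    have "ex [x, x, x] \<otimes> ex [y] = ex [y] \<otimes> ex [x, x, x]" .
    moreover have "?cube = [x, x, x] @ [y] @ winv flip [x, x, x] @ winv flip [y]" by simp
    ultimately show ?thesis
      by (simp only: ex_append ex_winv) (rule commutator_one, simp_all del: gs_expand_simps)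
  qed
  have skd: "gs_part j ?cube = \<one>" for j
  proof -
    interpret S: gs_marking E "\<lambda>x. ex (gs_lift x)" by (rule gs_marking_subst)
    obtain z where z: "gs_section j [x, x, x] = [z, z, z]" by simp
    let ?v = "gs_section j [y]"
    have "S.e [z, z, z] \<otimes> S.e ?v = S.e ?v \<otimes> S.e [z, z, z]"
      by (rule S.central[OF x3])
    then have comm: "ex (gs_subst (gs_section j [x, x, x])) \<otimes> ex (gs_subst ?v) = ex (gs_subst ?v) \<otimes> ex (gs_subst (gs_section j [x, x, x]))"
      unfolding ev_subst z .
    have turn_by: "ex (turn_by k u) \<otimes> ex (turn_by k v) = ex (turn_by k v) \<otimes> ex (turn_by k u)"
      if "ex u \<otimes> ex v = ex v \<otimes> ex u" for k u v
    proof -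
      have "ex (turn_by k (u @ v)) = ex (turn_by k (v @ u))"
        by (rule ex_turn_by_cong) (use that in \<open>simp add: e_append\<close>)
      then show ?thesis by (simp add: e_append)
    qed
    have "?cube = [x, x, x] @ [y] @ winv flip [x, x, x] @ winv flip [y]" by simp
    moreover have "gs_part j [x, x, x] \<otimes> gs_part j [y] = gs_part j [y] \<otimes> gs_part j [x, x, x]"
      unfolding gs_part_def by (rule turn_by[OF comm])
    ultimately show ?thesis
      by (simp only: gs_part_append gs_part_winv) (rule commutator_one, simp_all)
  qed
  have c1: "conj_balanced ([x] @ ?c @ [flip x])" and c2: "conj_balanced ([x] @ ([x] @ ?c @ [flip x]) @ [flip x])"
    using conj_balanced_simps(4)[OF c, of x] conj_balanced_simps(4)[OF conj_balanced_simps(4)[OF c, of x], of x] by simp_all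
  have "gs_parts ?d = X \<otimes> (X \<otimes> (P \<otimes> inv X) \<otimes> inv X) \<otimes> (X \<otimes> (P \<otimes> inv X) \<otimes> P)"
    using gs_parts_append[OF c2 conj_balanced_simps(2)[OF c1 c]] gs_parts_append[OF c1 c] gs_parts_conj[OF c1, of x] gs_parts_conj[OF c, of x]
    by (simp only: X_def P_def)
  moreover have "gs_parts ?d = \<one>"
    using red[of gs_parts, OF gs_parts_cancel] skd by (simp add: gs_parts_def)
  moreover have "ex ?d = X \<otimes> (X \<otimes> (R \<otimes> inv X) \<otimes> inv X) \<otimes> (X \<otimes> (R \<otimes> inv X) \<otimes> R)"
  proof -
    have "?d = ([x] @ ([x] @ ?c @ winv flip [x]) @ winv flip [x]) @ ([x] @ ?c @ winv flip [x]) @ ?c" by simp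
    then have "ex ?d = X \<otimes> ((X \<otimes> (R \<otimes> inv X)) \<otimes> inv X) \<otimes> ((X \<otimes> (R \<otimes> inv X)) \<otimes> R)"
      by (simp only: ex_append ex_winv X_def R_def)
    then show ?thesis .
  qed
  moreover have "ex ?d = \<one>"
    using red[of ex, OF ex_cancel] exd by simp
  ultimately have PX: "X \<otimes> (X \<otimes> (P \<otimes> inv X) \<otimes> inv X) \<otimes> (X \<otimes> (P \<otimes> inv X) \<otimes> P) = \<one>"
    and RX: "X \<otimes> (X \<otimes> (R \<otimes> inv X) \<otimes> inv X) \<otimes> (X \<otimes> (R \<otimes> inv X) \<otimes> R) = \<one>"
    by simp_all
  have P: "P = R \<otimes> k" by (simp add: k_def)
  have push: "k \<otimes> (X \<otimes> y) = X \<otimes> (k \<otimes> y)" "k \<otimes> (R \<otimes> y) = R \<otimes> (k \<otimes> y)"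
    "k \<otimes> (inv X \<otimes> y) = inv X \<otimes> (k \<otimes> y)" if "y \<in> carrier E" for y
    using that kX kR kX' by (simp_all flip: m_assoc)
  have "X \<otimes> (X \<otimes> (R \<otimes> inv X) \<otimes> inv X) \<otimes> (X \<otimes> (R \<otimes> inv X) \<otimes> R) \<otimes> (k \<otimes> (k \<otimes> k)) = \<one>"
    using PX unfolding P by (simp add: m_assoc push kX kR kX')
  then have "k \<otimes> (k \<otimes> k) = \<one>" unfolding RX by simp
  then have "k = \<one>" using no_3_torsion[OF W balW] unfolding kW by blast
  then have "R = P" using P by simp
  then show ?thesis using c by (simp only: splits_def R_def P_def)
qed

lemma splits_if_conj_balanced:
  assumes "conj_balanced \<xi>"
  shows "splits \<xi>"
proof -
  interpret normal_words flip splits by (rule normal_splits)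
  show ?thesis
  proof (rule balanced_word[OF splits_commutator])
    show "count_list \<xi> x = count_list \<xi> (flip x)" for x
      by (rule expsum_balanced) (use assms in \<open>simp add: conj_balanced_def\<close>)
  qed simp
qed

abbreviation "\<alpha> \<equiv> m (GA, True)"
abbreviation "\<tau> \<equiv> m (GT, True)"

text \<open>The relators \<open>a\<^sup>3\<close> and \<open>t\<^sup>3\<close> may have any central values under a marking, so it cannot be shown that
relators have trivial values. It will be shown that these two values determine all others.\<close>

definition linear where
  "linear w \<longleftrightarrow> gs_relator w \<and> e w = \<alpha> [^] expsum GA w \<otimes> \<tau> [^] expsum GT w"

lemma e_power_word: "e (power_word g i) = m (g, True) [^] i"
proof -
  have 1: "e (replicate n x) = m x [^] n" for n x
    by (rule ev_replicate_letter) auto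
  have 2: "m (g, False) = inv (m (g, True))" using m_bar[of "(g, True)"] by simp
  show ?thesis
  proof (cases i)
    case (nonneg n)
    then show ?thesis by (simp add: power_word_def 1 int_pow_int)
  next
    case (neg n)
    have "e (power_word g i) = inv (m (g, True)) [^] Suc n"
      unfolding power_word_def neg using 1[of "Suc n" "(g, False)"] by (simp only: 2) (simp add: 2 nat_add_distrib)
    also have "\<dots> = inv (m (g, True) [^] int (Suc n))"
      by (simp only: nat_pow_inv m_closed int_pow_int)
    finally show ?thesis
      by (simp only: neg int_pow_neg m_closed)
  qed
qed

lemma power_central: "3 dvd (i :: int) \<Longrightarrow> m (g, True) [^] i \<otimes> e v = e v \<otimes> m (g, True) [^] i"
  unfolding e_power_word[symmetric] by (rule central[OF gs_relator_power_word])

lemma linear_power_word: "3 dvd i \<Longrightarrow> linear (power_word g i)"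
  unfolding linear_def using gs_relator_power_word by (cases g) (simp_all add: e_power_word)

text \<open>The exponents of \<open>\<tau>\<close> are divisible by 3, and \<open>\<tau>\<^sup>3\<close> is central.\<close>

lemma linear_append:
  assumes "linear u" "linear v"
  shows "linear (u @ v)"
proof -
  have "\<tau> [^] expsum GT u \<otimes> e (power_word GA (expsum GA v)) = e (power_word GA (expsum GA v)) \<otimes> \<tau> [^] expsum GT u"
    using assms(1) by (intro power_central gs_relator_expsum_GT) (simp add: linear_def)
  then have c: "\<tau> [^] expsum GT u \<otimes> \<alpha> [^] expsum GA v = \<alpha> [^] expsum GA v \<otimes> \<tau> [^] expsum GT u"
    by (simp only: e_power_word)
  have "e (u @ v) = \<alpha> [^] expsum GA u \<otimes> ((\<tau> [^] expsum GT u \<otimes> \<alpha> [^] expsum GA v) \<otimes> \<tau> [^] expsum GT v)"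
    using assms by (simp add: linear_def e_append m_assoc)
  also have "\<dots> = \<alpha> [^] expsum GA (u @ v) \<otimes> \<tau> [^] expsum GT (u @ v)"
    unfolding c by (simp add: int_pow_mult m_assoc)
  finally show ?thesis
    using assms gs_relator_append by (simp add: linear_def)
qed

lemma linear_balanced: "linear w \<Longrightarrow> balanced w \<Longrightarrow> e w = \<one>"
  by (simp add: linear_def balanced_def)

text \<open>The power \<open>\<alpha>\<^sup>k\<close> for a residue \<open>k\<close> modulo 3.\<close>

definition pre where "pre k = (case k of L0 \<Rightarrow> \<one> | L1 \<Rightarrow> \<alpha> | L2 \<Rightarrow> \<alpha> \<otimes> \<alpha>)"

lemma e_gs_collect: "pre k \<otimes> e w = ex (gs_collect k w) \<otimes> (pre k \<otimes> \<alpha> [^] expsum GA w)"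
proof (induction w arbitrary: k)
  case Nil
  show ?case by (cases k) (simp_all add: pre_def)
next
  case (Cons x w)
  have [simp]: "pre k \<in> carrier E" for k by (cases k) (simp_all add: pre_def)
  have a3: "gs_relator [(GA, True), (GA, True), (GA, True)]"
    by (simp add: gs_relator_def fun_eq_iff gs_a3)
  have c: "(\<alpha> \<otimes> (\<alpha> \<otimes> \<alpha>)) \<otimes> e w = e w \<otimes> (\<alpha> \<otimes> (\<alpha> \<otimes> \<alpha>))" for w
    using central[OF a3, of w] by (simp add: m_assoc)
  have c': "(inv \<alpha> \<otimes> (inv \<alpha> \<otimes> inv \<alpha>)) \<otimes> e w = e w \<otimes> (inv \<alpha> \<otimes> (inv \<alpha> \<otimes> inv \<alpha>))" for w
    using commute_inv[OF _ _ c, of w] by (simp add: inv_mult_group m_assoc)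
  show ?case
  proof (cases x)
    case x: (Pair g s)
    show ?thesis
    proof (cases g)
      case GT
      have "pre k \<otimes> m (GT, s) = e (gs_expand_letter (k, s)) \<otimes> pre k"
        by (cases k) (simp_all add: pre_def inv_m m_assoc)
      then have "pre k \<otimes> m (GT, s) \<otimes> e w = e (gs_expand_letter (k, s)) \<otimes> (pre k \<otimes> e w)"
        by (simp add: m_assoc)
      then show ?thesis
        by (simp add: x GT Cons e_append m_assoc)
    next
      case GA
      show ?thesis
      proof (cases s)
        case True
        show ?thesis
        proof (cases k)
          case L2
          have "pre k \<otimes> e (x # w) = (\<alpha> \<otimes> (\<alpha> \<otimes> \<alpha>)) \<otimes> e w"
            by (simp add: x GA True L2 pre_def m_assoc)
          also have "\<dots> = e w \<otimes> (\<alpha> \<otimes> (\<alpha> \<otimes> \<alpha>))" by (rule c)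
          also have "e w = ex (gs_collect L0 w) \<otimes> \<alpha> [^] expsum GA w"
            using Cons[of L0] by (simp add: pre_def)
          also have "\<dots> \<otimes> (\<alpha> \<otimes> (\<alpha> \<otimes> \<alpha>)) = ex (gs_collect L0 w) \<otimes> (((\<alpha> [^] expsum GA w \<otimes> \<alpha>) \<otimes> \<alpha>) \<otimes> \<alpha>)"
            by (simp add: m_assoc)
          also have "\<dots> = ex (gs_collect k (x # w)) \<otimes> (pre k \<otimes> \<alpha> [^] expsum GA (x # w))"
            by (simp only: int_pow_step m_closed m_assoc int_pow_closed monoid.m_closed)
              (simp add: x GA True L2 pre_def int_pow_step m_assoc)
          finally show ?thesis .
        qed (use Cons[of L1] Cons[of L2] in \<open>simp_all add: x GA True pre_def int_pow_step m_assoc\<close>)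
      next
        case False
        show ?thesis
        proof (cases k)
          case L0
          have "pre k \<otimes> e (x # w) = (inv \<alpha> \<otimes> (inv \<alpha> \<otimes> inv \<alpha>)) \<otimes> (pre L2 \<otimes> e w)"
            by (simp add: x GA False L0 pre_def inv_m m_assoc)
          also have "\<dots> = ((inv \<alpha> \<otimes> (inv \<alpha> \<otimes> inv \<alpha>)) \<otimes> ex (gs_collect L2 w)) \<otimes> (pre L2 \<otimes> \<alpha> [^] expsum GA w)"
            by (simp add: Cons m_assoc)
          also have "\<dots> = ex (gs_collect k (x # w)) \<otimes> (pre k \<otimes> \<alpha> [^] expsum GA (x # w))"
            unfolding c' by (simp add: x GA False L0 pre_def int_pow_step m_assoc)
          finally show ?thesis .
        qed (use Cons[of L0] Cons[of L1] in \<open>simp_all add: x GA False pre_def inv_m int_pow_step m_assoc\<close>)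
      qed
    qed
  qed
qed

lemma e_gs_relator: "e w = ex (gs_collect L0 w) \<otimes> \<alpha> [^] expsum GA w"
  using e_gs_collect[of L0 w] by (simp add: pre_def)

lemma ex_single_index:
  assumes "\<forall>y\<in>set \<xi>. fst y = k"
  shows "ex \<xi> = ex [(k, True)] [^] expsum k \<xi>"
  using assms
proof (induction \<xi>)
  case (Cons y \<xi>)
  define X where "X = ex [(k, True)]"
  have [simp]: "X \<in> carrier E" by (simp add: X_def)
  have X': "ex [(k, False)] = inv X"
    using ex_winv[of "[(k, True)]"] by (simp add: X_def del: gs_expand_simps)
  obtain s where y: "y = (k, s)" using Cons.prems by (cases y) auto
  have "ex (y # \<xi>) = ex [y] \<otimes> ex \<xi>" using ex_append[of "[y]" \<xi>] by simp
  also have "\<dots> = (if s then X else inv X) \<otimes> X [^] expsum k \<xi>"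
    using Cons X' by (simp add: y X_def del: gs_expand_simps)
  also have "\<dots> = X [^] expsum k (y # \<xi>)"
    by (simp add: y int_pow_step)
  finally show ?case by (simp only: X_def)
qed simp

lemma ex_power_word:
  assumes "3 dvd i"
  shows "ex (power_word k i) = \<tau> [^] i"
proof -
  have flat: "gs_expand (replicate n (L0, s)) = replicate n (GT, s)" for n s
    by (induction n) simp_all
  have 0: "ex (power_word L0 i) = \<tau> [^] i"
    using e_power_word[of GT i] by (simp add: power_word_def flat)
  have turn_by: "power_word (rot k) i = turn (power_word k i)" for k
    by (simp add: power_word_def turn_def map_replicate)
  have "\<tau> [^] i \<otimes> inv \<alpha> = inv \<alpha> \<otimes> \<tau> [^] i"
    using power_central[OF assms, of GT "[(GA, False)]"] by (simp add: inv_m)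
  then have c: "\<alpha> \<otimes> (\<tau> [^] i \<otimes> inv \<alpha>) = \<tau> [^] i" by simp
  have step: "ex (power_word (rot k) i) = \<tau> [^] i" if "ex (power_word k i) = \<tau> [^] i" for k
    unfolding turn_by ex_turn that by (rule c)
  show ?thesis
    using 0 step[OF 0] step[OF step[OF 0]] by (cases k) simp_all
qed

end

lemma gs_section_power_word:
  "gs_section x (power_word k i) =
     (if x = k then power_word GA i else if x = rot k then power_word GA (- i) else power_word GT i)"
  by (cases "i = 0") (auto simp: power_word_def gs_section_def map_replicate)

text \<open>Every letter \<open>t\<close> contributes one letter \<open>t\<close> to exactly one of the three sections, so each section has
smaller weight unless all conjugates in the word have the same index.\<close>

definition gs_weight :: "(gsgen \<times> bool) list \<Rightarrow> nat" where
  "gs_weight w = length (filter (\<lambda>x. fst x = GT) w)"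

lemma gs_weight_gs_section: "gs_weight (gs_section x \<xi>) = length (filter (\<lambda>y. x = rot (rot (fst y))) \<xi>)"
proof (induction \<xi>)
  case (Cons y \<xi>)
  obtain k s where "y = (k, s)" by (cases y)
  then show ?case using Cons by (cases x; cases k) (simp_all add: gs_weight_def)
qed (simp add: gs_weight_def)

lemma length_gs_collect: "length (gs_collect k w) = gs_weight w"
  by (induction k w rule: gs_collect.induct) (simp_all add: gs_weight_def)

text \<open>Induction on the weight, for all markings of \<open>E\<close> at once. If all conjugates have the same index, the
word is a power of \<open>t\<^sub>k\<close> times a power of \<open>a\<close>. Otherwise the collected word is multiplied by powers of
\<open>t\<^sub>0\<close>, \<open>t\<^sub>1\<close>, \<open>t\<^sub>2\<close> that cancel its exponent sums. The exponents needed are divisible by 3, so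
sections of the product remain relators with linear values, although their weight is not small. The
product splits, and by linearity its parts are trivial because its sections are balanced.\<close>

theorem gs_relation_linear:
  assumes "gs_marking E m" "gs_relator w"
  shows "gs_marking.linear E m w"
  using assms
proof (induction "gs_weight w" arbitrary: w m rule: less_induct)
  case less
  interpret gs_marking E m by fact
  interpret S: gs_marking E "\<lambda>x. ex (gs_lift x)" by (rule gs_marking_subst)
  define \<xi> where "\<xi> = gs_collect L0 w"
  have w: "e w = ex \<xi> \<otimes>\<^bsub>E\<^esub> \<alpha> [^]\<^bsub>E\<^esub> expsum GA w"
    unfolding \<xi>_def by (rule e_gs_relator)
  have sec: "gs_relator (gs_section x \<xi>)" for x
    unfolding \<xi>_def by (rule gs_section_of_relator[OF less.prems(2)])
  define n where "n k = expsum k \<xi>" for k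
  have n3: "3 dvd n k" for k
    unfolding n_def by (rule gs_relator_expsum_section[OF sec])
  have nT: "expsum GT w = n L0 + n L1 + n L2"
    unfolding n_def \<xi>_def by (rule expsum_gs_collect[symmetric])
  have "ex \<xi> = \<tau> [^]\<^bsub>E\<^esub> expsum GT w"
  proof (cases "\<exists>k. \<forall>y\<in>set \<xi>. fst y = k")
    case True
    then obtain k where k: "\<forall>y\<in>set \<xi>. fst y = k" by blast
    have "n j = 0" if "j \<noteq> k" for j
      using k that unfolding n_def by (induction \<xi>) auto
    then have "expsum GT w = n k" unfolding nT by (cases k) simp_all
    moreover have "ex \<xi> = ex (power_word k (n k))"
      unfolding ex_single_index[OF k]
      by (subst ex_single_index[of "power_word k (n k)" k]) (simp_all add: n_def power_word_def expsum_replicate)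
    ultimately show ?thesis using ex_power_word[OF n3] by simp
  next
    case False
    have "gs_weight (gs_section x \<xi>) < gs_weight w" for x
    proof -
      obtain y where "y \<in> set \<xi>" "fst y \<noteq> rot x" using False by blast
      then have "length (filter (\<lambda>y. x = rot (rot (fst y))) \<xi>) < length \<xi>"
        by (intro length_filter_less[of y]) auto
      then show ?thesis
        by (simp only: gs_weight_gs_section) (simp add: \<xi>_def length_gs_collect)
    qed
    from less.hyps[OF this gs_marking_subst sec] have lin: "S.linear (gs_section x \<xi>)" for x .
    \<comment> \<open>This word cancels the exponent sums, so that the splitting applies.\<close>
    let ?\<eta> = "power_word L0 (- n L0) @ power_word L1 (- n L1) @ power_word L2 (- n L2)"
    have conj_balanced: "conj_balanced (\<xi> @ ?\<eta>)"
      unfolding conj_balanced_def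
    proof
      show "expsum k (\<xi> @ ?\<eta>) = 0" for k by (cases k) (simp_all add: n_def)
    qed
    have "S.linear (gs_section x (\<xi> @ ?\<eta>))" for x
      using n3 unfolding gs_section_simps(3) gs_section_power_word
      by (intro S.linear_append lin) (auto intro: S.linear_power_word)
    then have "S.e (gs_section x (\<xi> @ ?\<eta>)) = \<one>\<^bsub>E\<^esub>" for x
      by (rule S.linear_balanced[OF _ balanced_gs_section[OF conj_balanced]])
    then have "ex (gs_subst (gs_section x (\<xi> @ ?\<eta>))) = ex []" for x
      unfolding ev_subst by simp
    from ex_turn_by_cong[OF this] have "gs_part x (\<xi> @ ?\<eta>) = \<one>\<^bsub>E\<^esub>" for x
      unfolding gs_part_def by simp
    then have "ex (\<xi> @ ?\<eta>) = \<one>\<^bsub>E\<^esub>"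
      using splits_if_conj_balanced[OF conj_balanced] by (simp only: splits_def gs_parts_def) simp
    then have "ex \<xi> \<otimes>\<^bsub>E\<^esub> \<tau> [^]\<^bsub>E\<^esub> (- expsum GT w) = \<one>\<^bsub>E\<^esub>"
    proof -
      assume "ex (\<xi> @ ?\<eta>) = \<one>\<^bsub>E\<^esub>"
      moreover have "- expsum GT w = - n L0 + (- n L1 + - n L2)" by (simp add: nT)
      then have "\<tau> [^]\<^bsub>E\<^esub> (- expsum GT w) = ex ?\<eta>"
        using n3 by (simp only: ex_append ex_power_word dvd_minus_iff int_pow_mult m_closed)
      ultimately show ?thesis by (simp only: ex_append)
    qed
    then have "ex \<xi> \<otimes>\<^bsub>E\<^esub> \<tau> [^]\<^bsub>E\<^esub> (- expsum GT w) \<otimes>\<^bsub>E\<^esub> \<tau> [^]\<^bsub>E\<^esub> expsum GT w = \<tau> [^]\<^bsub>E\<^esub> expsum GT w" by simp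
    then show ?thesis by (simp add: m_assoc flip: int_pow_mult)
  qed
  moreover have "\<tau> [^]\<^bsub>E\<^esub> expsum GT w \<otimes>\<^bsub>E\<^esub> \<alpha> [^]\<^bsub>E\<^esub> expsum GA w = \<alpha> [^]\<^bsub>E\<^esub> expsum GA w \<otimes>\<^bsub>E\<^esub> \<tau> [^]\<^bsub>E\<^esub> expsum GT w"
    using power_central[OF gs_relator_expsum_GT[OF less.prems(2)], of GT "power_word GA (expsum GA w)"]
    by (simp only: e_power_word)
  ultimately show ?case using w less.prems(2) by (simp add: linear_def)
qed

instance gsgen :: countable by countable_datatype

lemma ev_gupta_sidki: "ev gupta_sidki_group gs_act w = act_word gs_act w"
  by (induction w) (simp_all add: gupta_sidki_group_def tree_aut_def)

lemma word_eval_gs_act: "word_eval tree_aut flip gs_act"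
proof -
  interpret T: group "tree_aut :: (letter3 list \<Rightarrow> letter3 list) monoid" by (rule group_tree_aut)
  have comp: "f \<otimes>\<^bsub>tree_aut\<^esub> h = f \<circ> h" for f h :: "letter3 list \<Rightarrow> letter3 list"
    by (simp add: tree_aut_def)
  have gens: "gs_a \<in> carrier tree_aut" "gs_t \<in> carrier tree_aut"
    using gs_in_tree_aut by simp_all
  show ?thesis
  proof
    show c: "gs_act x \<in> carrier tree_aut" for x
      using T.m_closed[OF gens(1) gens(1)] T.m_closed[OF gens(2) gens(2)] gens
      by (cases x rule: letter_cases) (simp_all add: comp)
    show "gs_act (flip x) = inv\<^bsub>tree_aut\<^esub> gs_act x" for x
      by (intro T.inv_equality[symmetric] c) (simp add: tree_aut_def fun_eq_iff)
  qed
qed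

lemma gupta_sidki_group_words: "gupta_sidki_group = subgroup_generated tree_aut (range gs_act)"
proof -
  interpret T: group "tree_aut :: (letter3 list \<Rightarrow> letter3 list) monoid" by (rule group_tree_aut)
  interpret W: word_eval tree_aut flip gs_act by (rule word_eval_gs_act)
  have gens: "{gs_a, gs_t} \<subseteq> carrier gupta_sidki_group"
    unfolding gupta_sidki_group_def by (rule T.subgroup_generated_subset_carrier_subset[OF gs_in_tree_aut])
  interpret G: group gupta_sidki_group
    unfolding gupta_sidki_group_def by (rule T.group_subgroup_generated)
  have "gs_act x \<in> carrier gupta_sidki_group" for x
    using G.m_closed[of gs_a gs_a] G.m_closed[of gs_t gs_t] gens
    by (cases x rule: letter_cases) (simp_all add: gupta_sidki_group_def tree_aut_def)
  then have "carrier (subgroup_generated tree_aut (range gs_act)) \<subseteq> carrier gupta_sidki_group"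
    unfolding gupta_sidki_group_def
    by (intro T.subgroup_generated_minimal) (auto simp: carrier_subgroup_generated T.generate_is_subgroup)
  moreover have "carrier gupta_sidki_group \<subseteq> carrier (subgroup_generated tree_aut (range gs_act))"
  proof -
    have "range gs_act \<subseteq> carrier (subgroup_generated tree_aut (range gs_act))"
      by (rule T.subgroup_generated_subset_carrier_subset) auto
    moreover have "gs_a = gs_act (GA, True)" "gs_t = gs_act (GT, True)" by simp_all
    ultimately show ?thesis
      unfolding gupta_sidki_group_def
      by (intro T.subgroup_generated_minimal)
        (auto simp: carrier_subgroup_generated T.generate_is_subgroup simp del: gs_act.simps)
  qed
  ultimately show ?thesis
    by (simp add: gupta_sidki_group_def subgroup_generated_def)
qed

text \<open>The inverses of \<open>a\<close> and \<open>t\<close> are treated as further generators; in the rigid group \<open>E\<close> they are equal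
to the squares of \<open>a\<close> and \<open>t\<close>. As generators of \<open>E\<close> have trivial cubes, linear values are trivial.\<close>

theorem cellular_gupta_sidki:
  assumes inf: "infinite (UNIV :: 'u set)"
  shows "cellular TYPE('u) (integer_mod_group 3) gupta_sidki_group"
proof (rule cellular_if_rigid[where g = gs_act, OF _ inf])
  interpret T: word_eval tree_aut flip gs_act by (rule word_eval_gs_act)
  have nat3: "(3 :: nat) = Suc (Suc (Suc 0))" by simp
  show "group gupta_sidki_group"
    by (simp add: gupta_sidki_group_words)
  show "carrier gupta_sidki_group = range (ev gupta_sidki_group gs_act)"
    using carrier_subgroup_generated_words[OF word_eval_gs_act]
    by (simp add: gupta_sidki_group_words ev_subgroup_generated)
  show "range gs_act \<subseteq> carrier gupta_sidki_group"
    unfolding gupta_sidki_group_words by (rule T.subgroup_generated_subset_carrier_subset) auto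
  show "gs_act l [^]\<^bsub>gupta_sidki_group\<^esub> (3::nat) = \<one>\<^bsub>gupta_sidki_group\<^esub>" for l
    by (cases l rule: letter_cases)
      (simp_all add: nat3 gupta_sidki_group_def tree_aut_def fun_eq_iff gs_a3 gs_t3)
  fix E :: "'u monoid" and m u v
  assume E: "group E" "range m \<subseteq> carrier E" "\<And>l. m l [^]\<^bsub>E\<^esub> (3::nat) = \<one>\<^bsub>E\<^esub>"
    and uniq: "\<And>u v. ev E m u [^]\<^bsub>E\<^esub> (3::nat) = \<one>\<^bsub>E\<^esub> \<Longrightarrow> ev E m v [^]\<^bsub>E\<^esub> (3::nat) = \<one>\<^bsub>E\<^esub> \<Longrightarrow>
        ev gupta_sidki_group gs_act u = ev gupta_sidki_group gs_act v \<Longrightarrow> ev E m u = ev E m v"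
    and uv: "ev gupta_sidki_group gs_act u = ev gupta_sidki_group gs_act v"
  interpret E: group E by fact
  have mc [simp]: "m x \<in> carrier E" for x using E(2) by blast
  have m3: "m x \<otimes>\<^bsub>E\<^esub> (m x \<otimes>\<^bsub>E\<^esub> m x) = \<one>\<^bsub>E\<^esub>" for x
    using E(3)[of x] by (simp add: nat3 E.m_assoc)
  have uniq': "ev E m u = ev E m v"
    if "ev E m u [^]\<^bsub>E\<^esub> (3::nat) = \<one>\<^bsub>E\<^esub>" "ev E m v [^]\<^bsub>E\<^esub> (3::nat) = \<one>\<^bsub>E\<^esub>"
      "act_word gs_act u = act_word gs_act v" for u v
    using uniq[of u v] that by (simp add: ev_gupta_sidki)
  have bar: "m (flip x) = inv\<^bsub>E\<^esub> m x" for x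
  proof -
    have "(m x \<otimes>\<^bsub>E\<^esub> m x) [^]\<^bsub>E\<^esub> (3::nat) = (m x [^]\<^bsub>E\<^esub> (3::nat)) \<otimes>\<^bsub>E\<^esub> (m x [^]\<^bsub>E\<^esub> (3::nat))"
      by (simp add: nat3 E.m_assoc)
    then have "ev E m [x, x] [^]\<^bsub>E\<^esub> (3::nat) = \<one>\<^bsub>E\<^esub>"
      using E(3) by simp
    moreover have "act_word gs_act [flip x] = act_word gs_act [x, x]"
      by (cases x rule: letter_cases) (simp_all add: fun_eq_iff gs_a3 gs_t3)
    ultimately have "ev E m [flip x] = ev E m [x, x]"
      using E(3) by (intro uniq') simp_all
    then show ?thesis
      using m3[of x] by (intro E.inv_equality[symmetric]) (simp_all add: E.m_assoc)
  qed
  interpret E: word_eval E flip m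
    by unfold_locales (simp_all add: bar)
  have marking: "gs_marking E m"
  proof
    show "m (flip x) = inv\<^bsub>E\<^esub> m x" for x by (rule bar)
    show "E.e w = \<one>\<^bsub>E\<^esub>" if "gs_relator w" "E.e w \<otimes>\<^bsub>E\<^esub> (E.e w \<otimes>\<^bsub>E\<^esub> E.e w) = \<one>\<^bsub>E\<^esub>" for w
      using uniq'[of w "[]"] that by (simp add: gs_relator_def nat3 E.m_assoc)
    show "E.e w \<otimes>\<^bsub>E\<^esub> E.e v = E.e v \<otimes>\<^bsub>E\<^esub> E.e w" if "gs_relator w" for w v
    proof (rule E.relator_central)
      show "m x [^]\<^bsub>E\<^esub> (3::nat) = \<one>\<^bsub>E\<^esub>" for x by (rule E(3))
      show "act_word gs_act w = id" "act_word gs_act (winv flip w) = id"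
        using that gs_relator_winv[OF that] by (simp_all only: gs_relator_def)
    qed (rule uniq')
  qed simp
  have rel: "gs_relator (u @ winv flip v)"
  proof -
    have "act_word gs_act (v @ winv flip v) = id"
      using normal_words.cancel_word[OF normal_gs_relator, of "[]" v "[]"] normal_words.empty[OF normal_gs_relator]
      by (simp add: gs_relator_def)
    then show ?thesis using uv by (simp add: gs_relator_def ev_gupta_sidki)
  qed
  let ?w = "u @ winv flip v"
  have triv: "m x [^]\<^bsub>E\<^esub> i = \<one>\<^bsub>E\<^esub>" if "3 dvd i" for x and i :: int
  proof -
    obtain j where "i = int 3 * j" using \<open>3 dvd i\<close> by (auto elim: dvdE)
    then show ?thesis
      using E(3)[of x] by (simp only: E.int_pow_pow[symmetric] mc int_pow_int) simp
  qed
  have "E.e ?w = m (GA, True) [^]\<^bsub>E\<^esub> expsum GA ?w \<otimes>\<^bsub>E\<^esub> m (GT, True) [^]\<^bsub>E\<^esub> expsum GT ?w"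
    using gs_relation_linear[OF marking rel] by (simp only: gs_marking.linear_def[OF marking])
  also have "\<dots> = \<one>\<^bsub>E\<^esub>"
    using triv[OF gs_relator_expsum_GA[OF rel]] triv[OF gs_relator_expsum_GT[OF rel]] by (simp del: expsum_simps expsum_winv)
  finally have "E.e u \<otimes>\<^bsub>E\<^esub> inv\<^bsub>E\<^esub> E.e v = \<one>\<^bsub>E\<^esub>"
    by (simp add: E.e_append E.e_winv)
  then show "E.e u = E.e v"
    by (metis E.e_closed E.inv_equality E.inv_inv E.inv_closed)
qed simp

theorem proposition4p8:
  assumes "infinite (UNIV :: 'u set)"
  shows "cellular TYPE('u) (integer_mod_group 2) grigorchuk_group \<and>
         cellular TYPE('u) (integer_mod_group 3) gupta_sidki_group"
  using cellular_grigorchuk[OF assms] cellular_gupta_sidki[OF assms] by blast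

end
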